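(* Let $k\ge2$ and $\alpha,\beta>0$, and consider the dihedral group $I_{2k}$ with multiplicity $\kappa=(\alpha,\beta)$. For $z=|z|e^{i\phi_1}$, $w=|w|e^{i\phi_2}$, $u,v\in[-1,1]$ put $q=q_{u,v}(k\phi_1,k\phi_2)$ and $$a_j^+=|zw|\cos\Big(\frac{q-2j\pi}{k}\Big),\qquad a_j^-=|zw|\cos\Big(\frac{\pi-q-2j\pi}{k}\Big),\qquad j=0,\dots,k-1.$$ Then $$\mathcal J_\kappa(z,w)=\frac{\Gamma(k(\alpha+\beta))}{2\Gamma(\alpha+\beta)^k}\int_{-1}^1\int_{-1}^1\int_{T^{k-1}}\Big(e^{\sum_{j=0}^{k-1}a_j^+t_j}+e^{\sum_{j=0}^{k-1}a_j^-t_j}\Big)\prod_{j=0}^{k-1}t_j^{\alpha+\beta-1}\,dt_1\cdots dt_{k-1}\,d\nu^\alpha(u)\,d\nu^\beta(v),$$ where $(t_1,\dots,t_{k-1})$ ranges over $T^{k-1}$ and $t_0=1-\sum_{j=1}^{k-1}t_j$.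
   Context: Identify $\mathbb{R}^2$ with $\mathbb{C}$, with inner product $\langle z,w\rangle=\mathrm{Re}(z\bar w)$, and write $z=|z|e^{i\phi_1}$, $w=|w|e^{i\phi_2}$. The dihedral group $I_{2k}$ (order $4k$) contains the reflections $z\mapsto\bar ze^{ij\pi/k}$, $j=0,\dots,2k-1$, which form two conjugacy classes ($j$ even, containing $z\mapsto\bar z$; and $j$ odd); the multiplicity $\kappa=(\alpha,\beta)$ takes the value $\alpha$ on the roots of the class with $j$ even and $\beta$ on the class with $j$ odd. Dunkl operators: $T_jf(x)=\partial_jf(x)+\sum_{\alpha\in R_+}\kappa(\alpha)\alpha_j\frac{f(x)-f(\sigma_\alpha x)}{\langle\alpha,x\rangle}$; the Dunkl kernel $E_\kappa(x,y)$ is the joint eigenfunction $T_j^{(x)}E_\kappa=y_jE_\kappa$, $E_\kappa(0,y)=1$; the generalized Bessel function is $\mathcal J_\kappa(x,y)=\frac1{|G|}\sum_{g\in G}E_\kappa(x,gy)$. Measures on $[-1,1]$: $d\nu^\alpha(u)=\frac{\Gamma(\alpha+1/2)}{\sqrt\pi\,\Gamma(\alpha)}(1-u^2)^{\alpha-1}du$. Notation: $\xi_{u,v}(\theta_1,\theta_2)=v\cos\theta_1\cos\theta_2+u\sin\theta_1\sin\theta_2$ and $q_{u,v}(\theta_1,\theta_2)=\arccos\xi_{u,v}(\theta_1,\theta_2)\in[0,\pi]$. $T^{n}=\{(t_1,\dots,t_n):t_j>0,\ \sum t_j<1\}$ is the open unit simplex in $\mathbb{R}^n$. *)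

theory Defs
  imports "HOL-Analysis.Analysis"
begin

text \<open>R^2 is identified with the type complex; the inner product on complex
  (real_inner instance) is x \<bullet> y = Re x * Re y + Im x * Im y = Re (x * cnj y).\<close>

definition dih_refl :: "nat \<Rightarrow> nat \<Rightarrow> complex \<Rightarrow> complex" where
  "dih_refl k j z = cnj z * cis (real j * pi / real k)"

definition dih_rot :: "nat \<Rightarrow> nat \<Rightarrow> complex \<Rightarrow> complex" where
  "dih_rot k j z = z * cis (real j * pi / real k)"

text \<open>A (unit) root of the reflection dih_refl k j: sigma_alpha x = x - 2 (alpha.x) alpha.\<close>
definition dih_root :: "nat \<Rightarrow> nat \<Rightarrow> complex" where
  "dih_root k j = \<i> * cis (real j * pi / (2 * real k))"

definition dih_mult :: "nat \<Rightarrow> real \<Rightarrow> real \<Rightarrow> nat \<Rightarrow> real" where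
  "dih_mult k a b j = (if even j then a else b)"

definition dunkl_op :: "nat \<Rightarrow> real \<Rightarrow> real \<Rightarrow> complex \<Rightarrow> (complex \<Rightarrow> real) \<Rightarrow> complex \<Rightarrow> real" where
  "dunkl_op k a b e f x = frechet_derivative f (at x) e
     + (\<Sum>j<2*k. dih_mult k a b j * (dih_root k j \<bullet> e)
          * (f x - f (dih_refl k j x)) / (dih_root k j \<bullet> x))"

text \<open>Points off all mirrors (where the difference quotients are literally defined).\<close>
definition dih_regular :: "nat \<Rightarrow> complex \<Rightarrow> bool" where
  "dih_regular k x \<longleftrightarrow> (\<forall>j<2*k. dih_root k j \<bullet> x \<noteq> 0)"

definition dunkl_kernel :: "nat \<Rightarrow> real \<Rightarrow> real \<Rightarrow> complex \<Rightarrow> complex \<Rightarrow> real" where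
  "dunkl_kernel k a b x y =
     (THE f. (\<forall>p. f differentiable (at p)) \<and> f 0 = 1 \<and>
        (\<forall>p. dih_regular k p \<longrightarrow>
           dunkl_op k a b 1 f p = Re y * f p \<and> dunkl_op k a b \<i> f p = Im y * f p)) x"

definition gen_bessel :: "nat \<Rightarrow> real \<Rightarrow> real \<Rightarrow> complex \<Rightarrow> complex \<Rightarrow> real" where
  "gen_bessel k a b x y =
     (\<Sum>j<2*k. dunkl_kernel k a b x (dih_rot k j y) + dunkl_kernel k a b x (dih_refl k j y))
       / (4 * real k)"

definition nu_density :: "real \<Rightarrow> real \<Rightarrow> real" where
  "nu_density a u = Gamma (a + 1/2) / (sqrt pi * Gamma a) * (1 - u\<^sup>2) powr (a - 1)"

definition xi_uv :: "real \<Rightarrow> real \<Rightarrow> real \<Rightarrow> real \<Rightarrow> real" where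
  "xi_uv u v t1 t2 = v * cos t1 * cos t2 + u * sin t1 * sin t2"

definition q_uv :: "real \<Rightarrow> real \<Rightarrow> real \<Rightarrow> real \<Rightarrow> real" where
  "q_uv u v t1 t2 = arccos (xi_uv u v t1 t2)"

text \<open>Open unit simplex T^n, coordinates indexed by {1..n} (extensional functions,
  i.e. points of the space of PiM {1..n} (\<lambda>_. lborel)).\<close>
definition unit_simplex :: "nat \<Rightarrow> (nat \<Rightarrow> real) set" where
  "unit_simplex n = {t \<in> {1..n} \<rightarrow>\<^sub>E UNIV. (\<forall>j\<in>{1..n}. 0 < t j) \<and> (\<Sum>j=1..n. t j) < 1}"

definition simplex_ext :: "nat \<Rightarrow> (nat \<Rightarrow> real) \<Rightarrow> nat \<Rightarrow> real" where
  "simplex_ext n t j = (if j = 0 then 1 - (\<Sum>i=1..n. t i) else t j)"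

end

theory Submission
  imports Defs "HOL-Computational_Algebra.Fundamental_Theorem_Algebra"
    "HOL-Complex_Analysis.Cauchy_Integral_Formula" "HOL-Probability.Probability_Measure"
begin

text \<open>Write $A = \sum_j \kappa_j (1 - \sigma_j)$ and $\lambda = \alpha + \beta$. The radial part of the Dunkl
  system says $(n + A) E_n = \langle x, y\rangle E_{n-1}$ for the homogeneous components $E_n$ of the Dunkl
  kernel. As $A$ is positive on the functions on an orbit, this determines the kernel (an energy estimate
  along rays), and it also constructs it: $n + A$ is inverted on the isotypic components, and the angular
  equations follow by induction, because every reflection anticommutes with the angular operator.

  Put $S(r) = \sum_n (k\lambda + 1)_n E_n r^n$. The radial equation for $S$ is a singular linear equation
  in $r$, whose solution is unique by the same energy estimate. After the substitution
  $r = 2\rho/(1 + \rho^2)$ a closed form, modelled on Dunkl's Poisson kernel for the map $z \mapsto z^k$,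
  satisfies it; the reflections collapse by Poisson kernel sums over roots of unity, and what remains is an
  integration by parts in $u$ and $v$. Averaging over the group leaves one integral of a power of
  $1 - 2\rho^k \xi_{u,v} + \rho^{2k}$.

  The measures $\nu^\alpha$, $\nu^\beta$ and the Dirichlet distribution on the simplex are probability
  measures, and by the Feynman parametrization the same integral is the expectation of
  $(1 - rL)^{-k\lambda - 1}$ with $L = \sum_j t_j \cos((q - 2j\pi)/k)$. Hence the components of the Bessel
  function are the moments $\mathbb{E}[L^n]/n!$, that is, $\mathcal J_\kappa = \mathbb{E}[e^{|zw| L}]$. The
  two exponentials come from the symmetry $(u, v) \mapsto (-u, -v)$, which replaces $q$ by $\pi - q$.\<close>

section \<open>Roots of unity and the Poisson kernel\<close>

lemma cis_root_of_unity: "k > 0 \<Longrightarrow> cis (2 * pi * real i / real k) ^ k = 1"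
  using cis_multiple_2pi[of "real i"] by (simp add: Complex.DeMoivre)

lemma prod_diff_roots_of_unity:
  assumes k: "k > 0"
  shows "(\<Prod>i<k. x - y * cis (2 * pi * real i / real k)) = x ^ k - y ^ k"
proof (cases "y = 0")
  case True
  then show ?thesis using k by simp
next
  case False
  define p :: "complex poly" where "p = monom 1 k - 1"
  have "degree (monom 1 k :: complex poly) = k" by (simp add: degree_monom_eq)
  then have "degree p = k"
    unfolding p_def diff_conv_add_uminus using k by (subst degree_add_eq_left) auto
  then have lead: "lead_coeff p = 1" using k by (simp add: p_def)
  have poly_p: "poly p z = z ^ k - 1" for z by (simp add: p_def poly_monom)
  have "rsquarefree p"
    unfolding rsquarefree_roots
  proof (intro allI notI)
    fix z assume z: "poly p z = 0 \<and> poly (pderiv p) z = 0"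
    have "poly (pderiv p) z = of_nat k * z ^ (k - 1)"
      by (simp add: p_def pderiv_diff pderiv_monom poly_monom)
    with z k have "z = 0" by auto
    with z k show False by (simp add: poly_p power_0_left)
  qed
  from complex_poly_decompose_rsquarefree[OF this]
  have "p = (\<Prod>z | poly p z = 0. [:- z, 1:])" using lead by simp
  then have "poly p (x / y) = poly (\<Prod>z | poly p z = 0. [:- z, 1:]) (x / y)" by (rule arg_cong)
  also have "\<dots> = (\<Prod>z | z ^ k = 1. x / y - z)"
    by (simp add: poly_prod poly_p)
  also have "\<dots> = (\<Prod>i<k. x / y - cis (2 * pi * real i / real k))"
    by (rule prod.reindex_bij_betw[OF Complex.bij_betw_roots_unity[OF k], symmetric])
  finally have roots: "(x / y) ^ k - 1 = (\<Prod>i<k. x / y - cis (2 * pi * real i / real k))"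
    by (simp add: poly_p)
  have "(\<Prod>i<k. x - y * cis (2 * pi * real i / real k))
      = (\<Prod>i<k. y * (x / y - cis (2 * pi * real i / real k)))"
    using False by (simp add: right_diff_distrib)
  also have "\<dots> = y ^ k * ((x / y) ^ k - 1)"
    by (simp only: prod.distrib prod_constant card_lessThan roots)
  finally show ?thesis using False by (simp add: right_diff_distrib power_divide)
qed

lemma sum_roots_of_unity_power:
  assumes k: "k > 0" and m: "m < k"
  shows "(\<Sum>i<k. cis (2 * pi * real m / real k) ^ i) = (if m = 0 then of_nat k else 0)"
proof (cases "m = 0")
  case False
  have "cis (2 * pi * real m / real k) \<noteq> cis (2 * pi * real 0 / real k)"
    using inj_onD[OF bij_betw_imp_inj_on[OF Complex.bij_betw_roots_unity[OF k]], of m 0] m k False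
    by auto
  then show ?thesis
    using geometric_sum[of "cis (2 * pi * real m / real k)" k] k False
    by (simp add: cis_root_of_unity)
qed simp

lemma sum_inverse_one_minus_roots_of_unity:
  assumes k: "k > 0" and z: "z ^ k \<noteq> 1"
  shows "(\<Sum>i<k. 1 / (1 - z * cis (2 * pi * real i / real k))) = of_nat k / (1 - z ^ k)"
proof -
  let ?w = "\<lambda>i. cis (2 * pi * real i / real k)"
  have partial_geometric: "1 / (1 - z * ?w i) = (\<Sum>m<k. z ^ m * ?w m ^ i) / (1 - z ^ k)" for i
  proof -
    have "?w i ^ m = ?w m ^ i" for m by (simp add: Complex.DeMoivre mult_ac)
    moreover have "1 - (z * ?w i) ^ k = (1 - z * ?w i) * (\<Sum>m<k. (z * ?w i) ^ m)"
      by (rule one_diff_power_eq)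
    ultimately have "1 - z ^ k = (1 - z * ?w i) * (\<Sum>m<k. z ^ m * ?w m ^ i)"
      by (simp add: power_mult_distrib cis_root_of_unity[OF k])
    moreover have "1 - z ^ k \<noteq> 0" using z by simp
    ultimately show ?thesis by simp
  qed
  have "(\<Sum>i<k. 1 / (1 - z * ?w i)) = (\<Sum>i<k. \<Sum>m<k. z ^ m * ?w m ^ i) / (1 - z ^ k)"
    by (simp only: partial_geometric sum_divide_distrib)
  also have "(\<Sum>i<k. \<Sum>m<k. z ^ m * ?w m ^ i) = (\<Sum>m<k. z ^ m * (\<Sum>i<k. ?w m ^ i))"
    by (subst sum.swap) (simp add: sum_distrib_left)
  also have "\<dots> = (\<Sum>m<k. if m = 0 then of_nat k else 0)"
    by (intro sum.cong) (auto simp: sum_roots_of_unity_power[OF k])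
  finally show ?thesis using k by simp
qed

definition poisson_denom :: "real \<Rightarrow> real \<Rightarrow> real" where
  "poisson_denom r c = 1 - 2 * r * c + r\<^sup>2"

lemma poisson_denom_lower:
  assumes "\<bar>c\<bar> \<le> 1"
  shows "(1 - \<bar>r\<bar>)\<^sup>2 \<le> poisson_denom r c"
proof -
  have "r * c \<le> \<bar>r\<bar> * \<bar>c\<bar>" by (simp add: abs_mult[symmetric])
  also have "\<dots> \<le> \<bar>r\<bar>" using assms by (simp add: mult_left_le)
  finally show ?thesis by (simp add: poisson_denom_def power2_eq_square algebra_simps)
qed

lemma poisson_denom_pos:
  assumes "\<bar>c\<bar> \<le> 1" "\<bar>r\<bar> < 1"
  shows "poisson_denom r c > 0"
  using poisson_denom_lower[OF assms(1), of r] zero_less_power[of "1 - \<bar>r\<bar>" 2] assms(2) by linarith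

lemma cmod_one_minus_sq:
  assumes "cmod u = 1"
  shows "(cmod (1 - of_real r * u))\<^sup>2 = poisson_denom r (Re u)"
proof -
  have "(Re u)\<^sup>2 + (Im u)\<^sup>2 = 1"
    using assms cmod_power2[of u] by simp
  moreover have "(cmod (1 - of_real r * u))\<^sup>2 = 1 - 2 * r * Re u + r\<^sup>2 * ((Re u)\<^sup>2 + (Im u)\<^sup>2)"
    unfolding cmod_power2 by (simp add: power2_eq_square algebra_simps)
  ultimately show ?thesis by (simp add: poisson_denom_def)
qed

lemma abs_Re_le_1: "cmod u = 1 \<Longrightarrow> \<bar>Re u\<bar> \<le> 1"
  using abs_Re_le_cmod[of u] by simp

lemma poisson_kernel_eq_Re:
  assumes u: "cmod u = 1" and r: "\<bar>r\<bar> < 1"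
  shows "(1 - r\<^sup>2) / poisson_denom r (Re u) = 2 * Re (1 / (1 - of_real r * u)) - 1"
proof -
  have "Re (1 / (1 - of_real r * u)) = (1 - r * Re u) / poisson_denom r (Re u)"
    unfolding cmod_one_minus_sq[OF u, symmetric] by (simp add: Re_divide cmod_power2)
  then show ?thesis
    using poisson_denom_pos[OF abs_Re_le_1[OF u] r] by (simp add: poisson_denom_def field_simps)
qed

lemma sum_poisson_kernel:
  assumes k: "k > 0" and u: "cmod u = 1" and r: "\<bar>r\<bar> < 1"
  shows "(\<Sum>i<k. (1 - r\<^sup>2) / poisson_denom r (Re (u * cis (2 * pi * real i / real k))))
    = real k * ((1 - (r ^ k)\<^sup>2) / poisson_denom (r ^ k) (Re (u ^ k)))"
proof -
  let ?w = "\<lambda>i. cis (2 * pi * real i / real k)" and ?z = "of_real r * u"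
  have rk: "\<bar>r ^ k\<bar> < 1" using r k by (simp add: power_abs power_less_one_iff)
  have z_power: "?z ^ k = of_real (r ^ k) * u ^ k" by (simp add: power_mult_distrib)
  have uk: "cmod (u ^ k) = 1" using u by (simp add: norm_power)
  then have "cmod (?z ^ k) < 1" using rk unfolding z_power norm_mult norm_of_real by simp
  then have z: "?z ^ k \<noteq> 1" by auto
  have "(\<Sum>i<k. (1 - r\<^sup>2) / poisson_denom r (Re (u * ?w i)))
      = (\<Sum>i<k. 2 * Re (1 / (1 - ?z * ?w i)) - 1)"
    by (intro sum.cong refl, subst poisson_kernel_eq_Re) (use u r in \<open>simp_all add: norm_mult mult.assoc\<close>)
  also have "\<dots> = 2 * Re (\<Sum>i<k. 1 / (1 - ?z * ?w i)) - real k"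
    by (simp add: sum_subtractf sum_distrib_left)
  also have "(\<Sum>i<k. 1 / (1 - ?z * ?w i)) = of_nat k * (1 / (1 - of_real (r ^ k) * u ^ k))"
    unfolding sum_inverse_one_minus_roots_of_unity[OF k z] z_power by simp
  also have "2 * Re \<dots> - real k = real k * (2 * Re (1 / (1 - of_real (r ^ k) * u ^ k)) - 1)"
  proof -
    have "2 * Re (of_nat k * v) - real k = real k * (2 * Re v - 1)" for v
      by (simp add: algebra_simps)
    then show ?thesis .
  qed
  finally show ?thesis by (simp only: poisson_kernel_eq_Re[OF uk rk])
qed

lemma prod_poisson_denom:
  assumes k: "k > 0" and u: "cmod u = 1"
  shows "(\<Prod>i<k. poisson_denom r (Re (u * cis (2 * pi * real i / real k))))
    = poisson_denom (r ^ k) (Re (u ^ k))"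
proof -
  let ?w = "\<lambda>i. cis (2 * pi * real i / real k)"
  have "(\<Prod>i<k. poisson_denom r (Re (u * ?w i))) = (cmod (\<Prod>i<k. 1 - (of_real r * u) * ?w i))\<^sup>2"
    unfolding prod_norm[symmetric] prod_power_distrib
    by (intro prod.cong refl, subst cmod_one_minus_sq[symmetric])
      (use u in \<open>simp_all add: norm_mult mult.assoc\<close>)
  also have "(\<Prod>i<k. 1 - (of_real r * u) * ?w i) = 1 - of_real (r ^ k) * u ^ k"
    by (simp only: prod_diff_roots_of_unity[OF k] power_mult_distrib power_one of_real_power)
  finally show ?thesis
    using u by (simp add: cmod_one_minus_sq norm_power del: of_real_power)
qed

definition poisson_scale :: "real \<Rightarrow> real" where
  "poisson_scale t = 2 * t / (1 + t\<^sup>2)"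

lemma one_plus_square_pos: "1 + t\<^sup>2 > (0 :: real)"
  by (simp add: add_pos_nonneg)

lemma one_minus_poisson_scale: "1 - poisson_scale t * c = poisson_denom t c / (1 + t\<^sup>2)"
  using one_plus_square_pos[of t] by (simp add: poisson_scale_def poisson_denom_def field_simps)

lemma one_minus_poisson_scale_pos:
  assumes "\<bar>c\<bar> \<le> 1" "\<bar>t\<bar> < 1"
  shows "1 - poisson_scale t * c > 0"
  unfolding one_minus_poisson_scale
  using poisson_denom_pos[OF assms] one_plus_square_pos by (rule divide_pos_pos)

lemma abs_poisson_scale_le: "\<bar>poisson_scale t\<bar> \<le> 2 * \<bar>t\<bar>"
proof -
  have "2 * \<bar>t\<bar> / (1 + t\<^sup>2) \<le> 2 * \<bar>t\<bar> / 1" by (intro frac_le) auto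
  then show ?thesis by (simp add: poisson_scale_def abs_mult abs_divide)
qed

lemma abs_poisson_scale_less_1:
  assumes "\<bar>t\<bar> < 1"
  shows "\<bar>poisson_scale t\<bar> < 1"
  using one_minus_poisson_scale_pos[OF _ assms, of 1] one_minus_poisson_scale_pos[OF _ assms, of "-1"]
  by (simp add: abs_less_iff)

definition poisson_scale' :: "real \<Rightarrow> real" where
  "poisson_scale' t = 2 * (1 - t\<^sup>2) / (1 + t\<^sup>2)\<^sup>2"

lemma poisson_scale_has_derivative: "(poisson_scale has_real_derivative poisson_scale' t) (at t)"
  unfolding poisson_scale_def[abs_def] poisson_scale'_def using one_plus_square_pos[of t]
  by (auto intro!: derivative_eq_intros simp: field_simps power2_eq_square)

lemma poisson_scale'_eq: "t * (1 + t\<^sup>2) * poisson_scale' t = (1 - t\<^sup>2) * poisson_scale t"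
proof -
  have cancel: "t * D * (2 * z / D\<^sup>2) = z * (2 * t / D)" if "D > 0" for D z
    using that by (simp add: power2_eq_square)
  show ?thesis
    unfolding poisson_scale'_def poisson_scale_def by (rule cancel[OF one_plus_square_pos])
qed

lemma poisson_scale'_bounds:
  assumes "\<bar>t\<bar> \<le> 1"
  shows "0 \<le> poisson_scale' t" "poisson_scale' t \<le> 2"
proof -
  have "t\<^sup>2 \<le> 1" using assms by (simp add: abs_square_le_1)
  then show "0 \<le> poisson_scale' t" by (simp add: poisson_scale'_def)
  have "2 * (1 - t\<^sup>2) / (1 + t\<^sup>2)\<^sup>2 \<le> 2 / 1"
    using \<open>t\<^sup>2 \<le> 1\<close> by (intro frac_le one_le_power) auto
  then show "poisson_scale' t \<le> 2" by (simp add: poisson_scale'_def)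
qed

lemma poisson_scale_mult_le:
  assumes "\<bar>c\<bar> \<le> 1"
  shows "poisson_scale t * c \<le> 2 * \<bar>t\<bar>"
proof -
  have "poisson_scale t * c \<le> \<bar>poisson_scale t\<bar> * \<bar>c\<bar>"
    using abs_ge_self[of "poisson_scale t * c"] by (simp add: abs_mult)
  also have "\<dots> \<le> (2 * \<bar>t\<bar>) * 1"
    using abs_poisson_scale_le assms by (intro mult_mono) auto
  finally show ?thesis by simp
qed

lemma sum_inverse_one_minus_poisson_scale:
  assumes k: "k > 0" and u: "cmod u = 1" and t: "\<bar>t\<bar> < 1"
  shows "(\<Sum>i<k. 1 / (1 - poisson_scale t * Re (u * cis (2 * pi * real i / real k))))
    = real k * ((1 + t\<^sup>2) * (1 - (t ^ k)\<^sup>2) / ((1 - t\<^sup>2) * poisson_denom (t ^ k) (Re (u ^ k))))"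
proof -
  let ?p = "\<lambda>i. poisson_denom t (Re (u * cis (2 * pi * real i / real k)))"
  have t_sq: "1 - t\<^sup>2 \<noteq> 0" using t by (simp add: abs_square_less_1 less_imp_neq)
  have "(\<Sum>i<k. 1 / (1 - poisson_scale t * Re (u * cis (2 * pi * real i / real k))))
      = (1 + t\<^sup>2) / (1 - t\<^sup>2) * (\<Sum>i<k. (1 - t\<^sup>2) / ?p i)"
    unfolding one_minus_poisson_scale using t_sq by (simp add: sum_distrib_left)
  then show ?thesis unfolding sum_poisson_kernel[OF k u t] by simp
qed

lemma prod_one_minus_poisson_scale:
  assumes "k > 0" "cmod u = 1"
  shows "(\<Prod>i<k. 1 - poisson_scale t * Re (u * cis (2 * pi * real i / real k)))
    = poisson_denom (t ^ k) (Re (u ^ k)) / (1 + t\<^sup>2) ^ k"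
  unfolding one_minus_poisson_scale prod_dividef prod_poisson_denom[OF assms] by simp

section \<open>The dihedral group acting on functions\<close>

lemma sum_periodic_shift:
  fixes h :: "int \<Rightarrow> 'a :: ab_group_add"
  assumes per: "\<And>i. h (i + int N) = h i"
  shows "(\<Sum>i<N. h (int i + m)) = (\<Sum>i<N. h (int i))"
proof -
  have shift_by_one: "(\<Sum>i<N. h (int i + (l + 1))) = (\<Sum>i<N. h (int i + l))" for l
  proof -
    have "(\<Sum>i<N. h (int i + (l + 1))) + h l = (\<Sum>i<Suc N. h (int i + l))"
      by (subst sum.lessThan_Suc_shift) (simp add: algebra_simps)
    also have "\<dots> = (\<Sum>i<N. h (int i + l)) + h l"
      using per[of l] by (simp add: algebra_simps)
    finally show ?thesis by simp
  qed
  show ?thesis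
  proof (induction m rule: int_induct[where k = 0])
    case (step1 i)
    then show ?case using shift_by_one[of i] by simp
  next
    case (step2 i)
    then show ?case using shift_by_one[of "i - 1"] by simp
  qed simp
qed

lemma sum_periodic_reflect:
  fixes h :: "int \<Rightarrow> 'a :: ab_group_add"
  assumes per: "\<And>i. h (i + int N) = h i"
  shows "(\<Sum>i<N. h (m - int i)) = (\<Sum>i<N. h (int i))"
proof -
  have "(\<Sum>i<N. h (m - int i)) = (\<Sum>i<N. h (m - int (N - Suc i)))"
    by (subst sum.nat_diff_reindex) simp
  also have "\<dots> = (\<Sum>i<N. h (int i + (m + 1 - int N)))"
    by (intro sum.cong) (auto simp: of_nat_diff algebra_simps)
  also have "\<dots> = (\<Sum>i<N. h (int i))"
    by (rule sum_periodic_shift[where h = h]) (rule per)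
  finally show ?thesis .
qed

lemma sum_even_odd: "(\<Sum>j<2*m. h (int j)) = (\<Sum>i<m. h (2 * int i) + h (2 * int i + 1))"
  for h :: "int \<Rightarrow> 'a :: comm_monoid_add"
  by (induction m) (auto simp: add_ac)

locale multiplicity =
  fixes a b :: real
  assumes a: "a > 0" and b: "b > 0"
begin

abbreviation lam :: real where "lam \<equiv> a + b"

lemma lam_pos: "lam > 0"
  using a b by simp

end

locale dihedral = multiplicity a b for k :: nat and a b :: real +
  assumes k: "k \<ge> 1"
begin

definition zeta :: "int \<Rightarrow> complex" where
  "zeta i = cis (real_of_int i * pi / real k)"

definition rot :: "int \<Rightarrow> complex \<Rightarrow> complex" where "rot i x = x * zeta i"
definition rfl :: "int \<Rightarrow> complex \<Rightarrow> complex" where "rfl i x = cnj x * zeta i"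
definition kappa :: "int \<Rightarrow> real" where "kappa i = (if even i then a else b)"

definition orbit :: "complex \<Rightarrow> complex set" where
  "orbit x = range (\<lambda>i. rot i x) \<union> range (\<lambda>i. rfl i x)"

definition orbit_sum :: "(complex \<Rightarrow> real) \<Rightarrow> complex \<Rightarrow> real" where
  "orbit_sum f x = (\<Sum>i<2*k. f (rot (int i) x) + f (rfl (int i) x))"

definition refl_diff :: "(complex \<Rightarrow> real) \<Rightarrow> complex \<Rightarrow> real" where
  "refl_diff f x = (\<Sum>j<2*k. kappa (int j) * (f x - f (rfl (int j) x)))"

lemma k_pos [simp]: "k > 0" "real k > 0" "k \<noteq> 0"
  using k by auto

lemma zeta_0 [simp]: "zeta 0 = 1"
  by (simp add: zeta_def)

lemma zeta_add: "zeta (i + j) = zeta i * zeta j"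
  by (simp add: zeta_def cis_mult ring_distribs add_divide_distrib)

lemma cnj_zeta: "cnj (zeta i) = zeta (- i)"
  by (simp add: zeta_def cis_cnj)

lemma norm_zeta [simp]: "cmod (zeta i) = 1"
  by (simp add: zeta_def)

lemma zeta_period [simp]: "zeta (i + 2 * int k) = zeta i"
proof -
  have "real_of_int (2 * int k) * pi / real k = 2 * pi" by simp
  then have "zeta (2 * int k) = 1" unfolding zeta_def by (simp only: cis_2pi)
  then show ?thesis by (simp add: zeta_add)
qed

lemma zeta_even: "zeta (2 * int i) = cis (2 * pi * real i / real k)"
  by (simp add: zeta_def mult_ac)

lemma zeta_power: "zeta i ^ k = (if even i then 1 else -1)"
proof -
  have "zeta i ^ k = cis (pi * real_of_int i)"
    unfolding zeta_def Complex.DeMoivre by (simp add: mult.commute)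
  also have "\<dots> = (if even i then 1 else -1)"
    by (simp add: complex_eq_iff cos_integer_2pi cos_npi_int sin_npi_int)
  finally show ?thesis .
qed

lemma norm_rot [simp]: "cmod (rot i x) = cmod x"
  by (simp add: rot_def norm_mult)

lemma norm_rfl [simp]: "cmod (rfl i x) = cmod x"
  by (simp add: rfl_def norm_mult)

lemma rot_0 [simp]: "rot 0 x = x"
  by (simp add: rot_def)

lemma rot_rot: "rot j (rot i x) = rot (j + i) x"
  by (simp add: rot_def zeta_add mult_ac)

lemma rot_rfl: "rot j (rfl i x) = rfl (j + i) x"
  by (simp add: rfl_def rot_def zeta_add mult_ac)

lemma rfl_rot: "rfl j (rot i x) = rfl (j - i) x"
  by (simp add: rfl_def rot_def cnj_zeta diff_conv_add_uminus zeta_add mult_ac del: add_uminus_conv_diff)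

lemma rfl_rfl: "rfl j (rfl i x) = rot (j - i) x"
  by (simp add: rfl_def rot_def cnj_zeta diff_conv_add_uminus zeta_add mult_ac del: add_uminus_conv_diff)

lemma rot_period [simp]: "rot (i + 2 * int k) x = rot i x"
  by (simp add: rot_def)

lemma rfl_period [simp]: "rfl (i + 2 * int k) x = rfl i x"
  by (simp add: rfl_def)

lemma kappa_period [simp]: "kappa (i + 2 * int k) = kappa i"
  by (simp add: kappa_def)

lemma kappa_nonneg: "0 \<le> kappa i"
  using a b by (simp add: kappa_def)

lemma rot_scaleR: "rot i (t *\<^sub>R x) = t *\<^sub>R rot i x"
  by (simp add: rot_def)

lemma rfl_scaleR: "rfl i (t *\<^sub>R x) = t *\<^sub>R rfl i x"
  by (simp add: rfl_def)

lemma rot_power: "rot j x ^ k = (if even j then x ^ k else - (x ^ k))"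
  by (simp add: rot_def power_mult_distrib zeta_power)

lemma rfl_power: "rfl j x ^ k = (if even j then cnj (x ^ k) else - cnj (x ^ k))"
  by (simp add: rfl_def power_mult_distrib zeta_power)

lemma dih_refl_eq: "dih_refl k j x = rfl (int j) x"
  by (simp add: dih_refl_def rfl_def zeta_def)

lemma dih_rot_eq: "dih_rot k j x = rot (int j) x"
  by (simp add: dih_rot_def rot_def zeta_def)

lemma dih_mult_eq: "dih_mult k a b j = kappa (int j)"
  by (simp add: dih_mult_def kappa_def)

lemma sum_reflect_index:
  assumes "\<And>i. h (i + 2 * int k) = h i"
  shows "(\<Sum>i<2*k. h (m - int i)) = (\<Sum>i<2*k. h (int i) :: real)"
  using assms by (intro sum_periodic_reflect[where h = h]) simp

lemma sum_shift_index:
  assumes "\<And>i. h (i + 2 * int k) = h i"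
  shows "(\<Sum>i<2*k. h (int i + m)) = (\<Sum>i<2*k. h (int i) :: real)"
  using assms by (intro sum_periodic_shift[where h = h]) simp

lemma sum_kappa: "(\<Sum>j<2*k. kappa (int j)) = real k * lam"
  by (simp only: sum_even_odd) (simp add: kappa_def)

lemma self_in_orbit [simp]: "x \<in> orbit x"
  by (auto simp: orbit_def intro: range_eqI[of _ _ 0])

lemma rfl_in_orbit: "p \<in> orbit x \<Longrightarrow> rfl j p \<in> orbit x"
  by (auto simp: orbit_def rfl_rot rfl_rfl)

lemma norm_orbit: "p \<in> orbit x \<Longrightarrow> cmod p = cmod x"
  by (auto simp: orbit_def)

lemma orbit_sum_cong: "(\<And>p. p \<in> orbit x \<Longrightarrow> f p = g p) \<Longrightarrow> orbit_sum f x = orbit_sum g x"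
  unfolding orbit_sum_def orbit_def by (intro sum.cong) auto

lemma orbit_sum_mono: "(\<And>p. p \<in> orbit x \<Longrightarrow> f p \<le> g p) \<Longrightarrow> orbit_sum f x \<le> orbit_sum g x"
  unfolding orbit_sum_def orbit_def by (intro sum_mono add_mono) auto

lemma orbit_sum_rfl: "orbit_sum (\<lambda>p. f (rfl j p)) x = orbit_sum f x"
proof -
  have "(\<Sum>i<2*k. f (rfl (j - int i) x)) = (\<Sum>i<2*k. f (rfl (int i) x))"
    by (rule sum_reflect_index[where h = "\<lambda>i. f (rfl i x)"]) simp
  moreover have "(\<Sum>i<2*k. f (rot (j - int i) x)) = (\<Sum>i<2*k. f (rot (int i) x))"
    by (rule sum_reflect_index[where h = "\<lambda>i. f (rot i x)"]) simp
  ultimately show ?thesis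
    by (simp add: orbit_sum_def rfl_rot rfl_rfl sum.distrib)
qed

lemma orbit_sum_add: "orbit_sum (\<lambda>p. f p + g p) x = orbit_sum f x + orbit_sum g x"
  by (simp add: orbit_sum_def sum.distrib)

lemma orbit_sum_diff: "orbit_sum (\<lambda>p. f p - g p) x = orbit_sum f x - orbit_sum g x"
  by (simp add: orbit_sum_def sum.distrib sum_subtractf)

lemma orbit_sum_cmult: "orbit_sum (\<lambda>p. r * f p) x = r * orbit_sum f x"
  by (simp add: orbit_sum_def sum_distrib_left ring_distribs)

lemma orbit_sum_sum: "orbit_sum (\<lambda>p. \<Sum>j\<in>J. f j p) x = (\<Sum>j\<in>J. orbit_sum (f j) x)"
  unfolding orbit_sum_def by (subst sum.swap) (simp add: sum.distrib)

lemma orbit_sum_const: "orbit_sum (\<lambda>_. r) x = 4 * real k * r"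
  by (simp add: orbit_sum_def)

lemma orbit_sum_sums:
  assumes "\<And>p. p \<in> orbit x \<Longrightarrow> (\<lambda>n. f n p) sums g p"
  shows "(\<lambda>n. orbit_sum (f n) x) sums orbit_sum g x"
  unfolding orbit_sum_def using assms by (intro sums_sum sums_add) (auto simp: orbit_def)

lemma le_orbit_sum:
  assumes "\<And>p. p \<in> orbit x \<Longrightarrow> 0 \<le> f p"
  shows "f x \<le> orbit_sum f x"
proof -
  have "f (rot (int 0) x) + f (rfl (int 0) x) \<le> orbit_sum f x"
    unfolding orbit_sum_def using assms
    by (intro member_le_sum) (auto simp: orbit_def intro!: add_nonneg_nonneg)
  moreover have "0 \<le> f (rfl 0 x)" using assms rfl_in_orbit[OF self_in_orbit] by blast
  ultimately show ?thesis by simp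
qed

lemma abs_orbit_sum_mult_rfl_le: "\<bar>orbit_sum (\<lambda>p. f p * f (rfl j p)) x\<bar> \<le> orbit_sum (\<lambda>p. (f p)\<^sup>2) x"
proof -
  have "0 \<le> orbit_sum (\<lambda>p. (f p + e * f (rfl j p))\<^sup>2) x" if "e * e = 1" for e
    unfolding orbit_sum_def by (intro sum_nonneg add_nonneg_nonneg) simp_all
  moreover have "orbit_sum (\<lambda>p. (f p + e * f (rfl j p))\<^sup>2) x
      = 2 * orbit_sum (\<lambda>p. (f p)\<^sup>2) x + 2 * e * orbit_sum (\<lambda>p. f p * f (rfl j p)) x"
    if "e * e = 1" for e
  proof -
    have "(f p + e * f (rfl j p))\<^sup>2 = (f p)\<^sup>2 + (f (rfl j p))\<^sup>2 + 2 * e * (f p * f (rfl j p))" for p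
    proof -
      have "(f p + e * f (rfl j p))\<^sup>2
          = (f p)\<^sup>2 + e * e * (f (rfl j p))\<^sup>2 + 2 * e * (f p * f (rfl j p))"
        by (simp add: power2_eq_square algebra_simps)
      with that show ?thesis by simp
    qed
    then show ?thesis
      by (simp add: orbit_sum_add orbit_sum_cmult orbit_sum_rfl[of "\<lambda>p. (f p)\<^sup>2"])
  qed
  ultimately have "0 \<le> 2 * orbit_sum (\<lambda>p. (f p)\<^sup>2) x + 2 * e * orbit_sum (\<lambda>p. f p * f (rfl j p)) x"
    if "e * e = 1" for e
    using that by simp
  from this[of 1] this[of "-1"] show ?thesis by (simp add: abs_le_iff)
qed

lemma abs_sum_kappa_orbit_sum_le:
  "\<bar>\<Sum>j<2*k. kappa (int j) * orbit_sum (\<lambda>p. f p * f (rfl (int j) p)) x\<bar>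
     \<le> real k * lam * orbit_sum (\<lambda>p. (f p)\<^sup>2) x"
proof -
  have "\<bar>\<Sum>j<2*k. kappa (int j) * orbit_sum (\<lambda>p. f p * f (rfl (int j) p)) x\<bar>
      \<le> (\<Sum>j<2*k. kappa (int j) * orbit_sum (\<lambda>p. (f p)\<^sup>2) x)"
    by (rule order.trans[OF sum_abs])
      (intro sum_mono, simp add: abs_mult kappa_nonneg abs_orbit_sum_mult_rfl_le mult_left_mono)
  then show ?thesis by (simp add: sum_distrib_right[symmetric] sum_kappa)
qed

lemma refl_diff_eq:
  "refl_diff f x = real k * lam * f x - (\<Sum>j<2*k. kappa (int j) * f (rfl (int j) x))"
  by (simp add: refl_diff_def right_diff_distrib sum_subtractf sum_distrib_right[symmetric] sum_kappa)

lemma refl_diff_add: "refl_diff (\<lambda>x. f x + g x) x = refl_diff f x + refl_diff g x"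
  by (simp add: refl_diff_def sum.distrib[symmetric] algebra_simps)

lemma refl_diff_diff: "refl_diff (\<lambda>x. f x - g x) x = refl_diff f x - refl_diff g x"
  by (simp add: refl_diff_def sum_subtractf[symmetric] algebra_simps)

lemma refl_diff_cmult: "refl_diff (\<lambda>x. r * f x) x = r * refl_diff f x"
  by (simp add: refl_diff_def sum_distrib_left algebra_simps)

lemma orbit_sum_refl_diff_nonneg: "0 \<le> orbit_sum (\<lambda>p. f p * refl_diff f p) x"
proof -
  have "orbit_sum (\<lambda>p. f p * refl_diff f p) x = real k * lam * orbit_sum (\<lambda>p. (f p)\<^sup>2) x
      - (\<Sum>j<2*k. kappa (int j) * orbit_sum (\<lambda>p. f p * f (rfl (int j) p)) x)"
    unfolding orbit_sum_cmult[symmetric] orbit_sum_sum[symmetric] orbit_sum_diff[symmetric]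
    by (simp add: refl_diff_eq algebra_simps power2_eq_square sum_distrib_left)
  with abs_sum_kappa_orbit_sum_le[of f x] show ?thesis by linarith
qed

lemma shifted_refl_sum_eq_0_imp_eq_0:
  assumes n: "n > 0"
    and eq_0: "\<And>p. p \<in> orbit x \<Longrightarrow>
      (n + real k * lam) * f p + (\<Sum>j<2*k. kappa (int j) * f (rfl (int j) p)) = 0"
  shows "f x = 0"
proof -
  let ?S = "orbit_sum (\<lambda>p. (f p)\<^sup>2) x"
  have "(n + real k * lam) * ?S + (\<Sum>j<2*k. kappa (int j) * orbit_sum (\<lambda>p. f p * f (rfl (int j) p)) x)
      = orbit_sum (\<lambda>p. f p * ((n + real k * lam) * f p + (\<Sum>j<2*k. kappa (int j) * f (rfl (int j) p)))) x"
    unfolding orbit_sum_cmult[symmetric] orbit_sum_sum[symmetric] orbit_sum_add[symmetric]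
    by (simp add: algebra_simps power2_eq_square sum_distrib_left)
  also have "\<dots> = orbit_sum (\<lambda>_. 0) x"
    by (intro orbit_sum_cong) (simp only: eq_0 mult_zero_right)
  finally have "n * ?S \<le> 0"
    using abs_sum_kappa_orbit_sum_le[of f x] by (simp add: orbit_sum_const distrib_right abs_le_iff)
  moreover have "(f x)\<^sup>2 \<le> ?S" by (rule le_orbit_sum) simp
  ultimately show ?thesis using n by (smt (verit) mult_pos_pos zero_less_power2)
qed

section \<open>Dunkl operators\<close>

definition root_vec :: "int \<Rightarrow> complex" where
  "root_vec i = \<i> * cis (real_of_int i * pi / (2 * real k))"

lemma dih_root_eq: "dih_root k j = root_vec (int j)"
  by (simp add: dih_root_def root_vec_def)

lemma root_vec_nonzero: "root_vec i \<noteq> 0"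
  by (simp add: root_vec_def)

lemma root_vec_period: "root_vec (i + 2 * int k) = - root_vec i"
proof -
  have "real_of_int (i + 2 * int k) * pi / (2 * real k) = real_of_int i * pi / (2 * real k) + pi"
    by (simp add: field_simps)
  then show ?thesis unfolding root_vec_def by (simp add: cis_mult[symmetric])
qed

lemma inner_eq_Re: "x \<bullet> y = Re (x * cnj y)"
  by (simp add: inner_complex_def)

lemma root_vec_inner_rfl: "root_vec i \<bullet> rfl j x = - (root_vec (2 * j - i) \<bullet> x)"
proof -
  have "cis (real_of_int i * pi / (2 * real k)) * cnj (zeta j)
      = cnj (cis (real_of_int (2 * j - i) * pi / (2 * real k)))"
    by (simp add: zeta_def cis_cnj cis_mult) (simp add: diff_divide_distrib left_diff_distrib)
  then have "root_vec i * cnj (rfl j x) = - cnj (root_vec (2 * j - i) * cnj x)"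
    by (simp add: root_vec_def rfl_def algebra_simps)
  then show ?thesis by (simp add: inner_eq_Re del: complex_cnj_mult)
qed

lemma rfl_eq_root_vec: "rfl j x = x - (2 * (root_vec j \<bullet> x)) *\<^sub>R root_vec j"
proof -
  have "cmod (root_vec j) = 1" by (simp add: root_vec_def norm_mult)
  then have unit: "root_vec j * cnj (root_vec j) = 1" by (simp add: complex_norm_square[symmetric])
  have square: "(root_vec j)\<^sup>2 = - zeta j"
    by (simp add: root_vec_def zeta_def power_mult_distrib Complex.DeMoivre)
  have "complex_of_real (2 * (root_vec j \<bullet> x)) = root_vec j * cnj x + cnj (root_vec j) * x"
    by (simp add: complex_eq_iff inner_complex_def)
  then have "(2 * (root_vec j \<bullet> x)) *\<^sub>R root_vec j
      = (root_vec j)\<^sup>2 * cnj x + (root_vec j * cnj (root_vec j)) * x"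
    by (simp only: scaleR_conv_of_real) (simp add: algebra_simps power2_eq_square)
  then show ?thesis by (simp add: unit square rfl_def mult.commute)
qed

text \<open>The mirrors are the zero set of $\mathrm{Im}\, x^{2k}$, because
  $x^{2k} - \bar x^{2k} = \prod_j (x - \sigma_j x)$.\<close>

lemma dih_regular_iff_Im_power: "dih_regular k x \<longleftrightarrow> Im (x ^ (2 * k)) \<noteq> 0"
proof -
  have "zeta (int j) = cis (2 * pi * real j / real (2 * k))" for j
    by (simp add: zeta_def mult.commute)
  then have "(\<Prod>j<2*k. x - rfl (int j) x) = x ^ (2 * k) - cnj (x ^ (2 * k))"
    using prod_diff_roots_of_unity[of "2 * k" x "cnj x"] by (simp add: rfl_def)
  also have "\<dots> = complex_of_real (2 * Im (x ^ (2 * k))) * \<i>"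
    by (rule complex_diff_cnj)
  finally have "Im (x ^ (2 * k)) = 0 \<longleftrightarrow> (\<Prod>j<2*k. x - rfl (int j) x) = 0" by simp
  also have "\<dots> \<longleftrightarrow> (\<exists>j<2*k. root_vec (int j) \<bullet> x = 0)"
    using root_vec_nonzero by (auto simp: rfl_eq_root_vec)
  finally show ?thesis by (auto simp: dih_regular_def dih_root_eq)
qed

lemma dih_regular_orbit:
  assumes "dih_regular k x" "p \<in> orbit x"
  shows "dih_regular k p"
proof -
  have "p ^ (2 * k) \<in> {x ^ (2 * k), cnj (x ^ (2 * k))}"
    using assms(2) by (auto simp: orbit_def power_mult mult.commute[of 2] rot_power rfl_power
        split: if_splits)
  with assms(1) show ?thesis
    unfolding dih_regular_iff_Im_power by (auto simp del: complex_cnj_power)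
qed

lemma dih_regular_scaleR: "dih_regular k x \<Longrightarrow> t \<noteq> 0 \<Longrightarrow> dih_regular k (t *\<^sub>R x)"
  by (auto simp: dih_regular_def)

lemma closure_dih_regular: "closure {p. dih_regular k p} = UNIV"
proof -
  define H where "H = (\<Union>j<2*k. {p. root_vec (int j) \<bullet> p = 0})"
  have "negligible H"
    unfolding H_def by (intro negligible_Union) (auto simp: root_vec_nonzero intro!: negligible_hyperplane)
  then have "negligible (interior H)"
    using interior_subset by (rule negligible_subset)
  then have "interior H = {}" using open_not_negligible by blast
  moreover have "{p. dih_regular k p} = - H"
    by (auto simp: H_def dih_regular_def dih_root_eq)
  ultimately show ?thesis by (simp add: closure_complement)
qed

lemma dunkl_op_eq:
  "dunkl_op k a b e f x = frechet_derivative f (at x) e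
     + (\<Sum>j<2*k. kappa (int j) * (root_vec (int j) \<bullet> e) * (f x - f (rfl (int j) x)) / (root_vec (int j) \<bullet> x))"
  by (simp add: dunkl_op_def dih_mult_eq dih_refl_eq dih_root_eq)

lemma linear_dunkl_op:
  assumes "f differentiable (at x)"
  shows "linear (\<lambda>e. dunkl_op k a b e f x)"
proof -
  have frechet: "linear (frechet_derivative f (at x))"
    using assms by (rule linear_frechet_derivative)
  show ?thesis
    unfolding dunkl_op_eq
    by (rule linear_compose_add[OF frechet], rule linear_compose_sum)
      (auto intro!: linearI simp: inner_add_right distrib_left distrib_right add_divide_distrib)
qed

lemma dunkl_op_eq_Re_Im:
  assumes "f differentiable (at x)"
  shows "dunkl_op k a b e f x = Re e * dunkl_op k a b 1 f x + Im e * dunkl_op k a b \<i> f x"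
proof -
  note lin = linear_dunkl_op[OF assms]
  have "e = Re e *\<^sub>R 1 + Im e *\<^sub>R \<i>" by (simp add: complex_eq_iff)
  then have "dunkl_op k a b e f x = dunkl_op k a b (Re e *\<^sub>R 1 + Im e *\<^sub>R \<i>) f x"
    by (rule arg_cong)
  then show ?thesis by (simp only: linear_add[OF lin] linear_scale[OF lin] real_scaleR_def)
qed

lemma dunkl_op_eq_inner_iff:
  assumes "f differentiable (at x)"
  shows "dunkl_op k a b 1 f x = Re y * c \<and> dunkl_op k a b \<i> f x = Im y * c
    \<longleftrightarrow> (\<forall>e. dunkl_op k a b e f x = (e \<bullet> y) * c)" (is "?partials \<longleftrightarrow> ?all")
proof
  assume ?partials
  then have "dunkl_op k a b e f x = (e \<bullet> y) * c" for e
    unfolding dunkl_op_eq_Re_Im[OF assms, of e] by (simp add: inner_complex_def algebra_simps)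
  then show ?all by simp
next
  assume ?all
  from this[rule_format, of 1] this[rule_format, of \<i>] show ?partials
    by (simp add: inner_complex_def)
qed

lemma dunkl_op_add:
  assumes "f differentiable (at x)" "g differentiable (at x)"
  shows "dunkl_op k a b e (\<lambda>x. f x + g x) x = dunkl_op k a b e f x + dunkl_op k a b e g x"
proof -
  have "((\<lambda>x. f x + g x) has_derivative
      (\<lambda>h. frechet_derivative f (at x) h + frechet_derivative g (at x) h)) (at x)"
    using assms by (intro has_derivative_add) (simp_all add: frechet_derivative_works)
  then have "frechet_derivative (\<lambda>x. f x + g x) (at x) e
      = frechet_derivative f (at x) e + frechet_derivative g (at x) e"
    by (simp add: frechet_derivative_at[symmetric])
  then show ?thesis unfolding dunkl_op_eq
    by (simp add: sum.distrib[symmetric] add_divide_distrib[symmetric] algebra_simps)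
qed

lemma dunkl_op_cmult:
  assumes "f differentiable (at x)"
  shows "dunkl_op k a b e (\<lambda>x. r * f x) x = r * dunkl_op k a b e f x"
proof -
  have "((\<lambda>x. r * f x) has_derivative (\<lambda>h. r * frechet_derivative f (at x) h)) (at x)"
    using assms by (intro has_derivative_mult_right) (simp add: frechet_derivative_works)
  then have "frechet_derivative (\<lambda>x. r * f x) (at x) e = r * frechet_derivative f (at x) e"
    by (simp add: frechet_derivative_at[symmetric])
  then show ?thesis unfolding dunkl_op_eq by (simp add: sum_distrib_left algebra_simps)
qed

lemma dunkl_op_const: "dunkl_op k a b e (\<lambda>x. r) x = 0"
  by (simp add: dunkl_op_eq)

lemma dunkl_op_sum:
  fixes m :: nat
  assumes "\<And>j. f j differentiable (at x)"
  shows "dunkl_op k a b e (\<lambda>x. \<Sum>j<m. f j x) x = (\<Sum>j<m. dunkl_op k a b e (f j) x)"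
proof (induction m)
  case (Suc m)
  have "(\<lambda>x. \<Sum>j<m. f j x) differentiable (at x)"
    by (intro differentiable_sum) (auto simp: assms)
  with Suc show ?case by (simp add: dunkl_op_add assms)
qed (simp add: dunkl_op_const)

lemma dunkl_op_radial:
  assumes "dih_regular k x"
  shows "dunkl_op k a b x f x = frechet_derivative f (at x) x + refl_diff f x"
  unfolding dunkl_op_eq refl_diff_def
  using assms by (auto simp: dih_regular_def dih_root_eq intro!: sum.cong)

lemma has_derivative_rot: "(rot i has_derivative rot i) (at x)"
  unfolding rot_def[abs_def] by (auto intro!: derivative_eq_intros)

lemma has_derivative_rfl: "(rfl i has_derivative rfl i) (at x)"
  unfolding rfl_def[abs_def]
  by (auto intro!: derivative_eq_intros bounded_linear.has_derivative[OF bounded_linear_cnj])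

lemma differentiable_rfl: "f differentiable (at (rfl j x)) \<Longrightarrow> (\<lambda>p. f (rfl j p)) differentiable (at x)"
  unfolding differentiable_def using has_derivative_compose[OF has_derivative_rfl] by blast

lemma dunkl_op_rfl:
  assumes "f differentiable (at (rfl j x))"
  shows "dunkl_op k a b e (\<lambda>p. f (rfl j p)) x = dunkl_op k a b (rfl j e) f (rfl j x)"
proof -
  have "((\<lambda>p. f (rfl j p)) has_derivative (\<lambda>h. frechet_derivative f (at (rfl j x)) (rfl j h))) (at x)"
    using assms by (intro has_derivative_compose[OF has_derivative_rfl]) (simp add: frechet_derivative_works)
  then have frechet: "frechet_derivative (\<lambda>p. f (rfl j p)) (at x) e
      = frechet_derivative f (at (rfl j x)) (rfl j e)"
    by (simp add: frechet_derivative_at[symmetric])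
  let ?h = "\<lambda>i. kappa i * (root_vec i \<bullet> rfl j e) * (f (rfl j x) - f (rfl i (rfl j x))) / (root_vec i \<bullet> rfl j x)"
  have reflected_term: "?h (2 * j - i)
      = kappa i * (root_vec i \<bullet> e) * (f (rfl j x) - f (rfl j (rfl i x))) / (root_vec i \<bullet> x)" for i
  proof -
    have "kappa (2 * j - i) = kappa i" "rfl (2 * j - i) (rfl j x) = rfl j (rfl i x)"
      by (simp_all add: kappa_def rfl_rfl)
    then show ?thesis by (simp add: root_vec_inner_rfl)
  qed
  have "(\<Sum>i<2*k. ?h (int i)) = (\<Sum>i<2*k. ?h (2 * j - int i))"
    by (rule sum_reflect_index[where h = ?h, symmetric]) (simp add: root_vec_period inner_minus_left)
  then show ?thesis unfolding dunkl_op_eq frechet reflected_term by simp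
qed

lemma dunkl_op_inner_mult:
  assumes reg: "dih_regular k x" and diff: "f differentiable (at x)"
  shows "dunkl_op k a b e (\<lambda>x. (x \<bullet> y) * f x) x = (e \<bullet> y) * f x + (x \<bullet> y) * dunkl_op k a b e f x
    + (\<Sum>j<2*k. kappa (int j) * ((e - rfl (int j) e) \<bullet> y) * f (rfl (int j) x))"
proof -
  have "((\<lambda>x. (x \<bullet> y) * f x) has_derivative
      (\<lambda>h. (x \<bullet> y) * frechet_derivative f (at x) h + (h \<bullet> y) * f x)) (at x)"
    by (rule derivative_eq_intros diff[unfolded frechet_derivative_works] refl)+ simp
  then have frechet: "frechet_derivative (\<lambda>x. (x \<bullet> y) * f x) (at x) e
      = (x \<bullet> y) * frechet_derivative f (at x) e + (e \<bullet> y) * f x"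
    by (simp add: frechet_derivative_at[symmetric])
  have "kappa j * (root_vec j \<bullet> e) * ((x \<bullet> y) * f x - (rfl j x \<bullet> y) * f (rfl j x)) / (root_vec j \<bullet> x)
      = (x \<bullet> y) * (kappa j * (root_vec j \<bullet> e) * (f x - f (rfl j x)) / (root_vec j \<bullet> x))
        + kappa j * ((e - rfl j e) \<bullet> y) * f (rfl j x)" if "root_vec j \<bullet> x \<noteq> 0" for j
  proof -
    have x_diff: "rfl j x \<bullet> y = x \<bullet> y - 2 * (root_vec j \<bullet> x) * (root_vec j \<bullet> y)"
      by (simp add: rfl_eq_root_vec inner_diff_left)
    have e_diff: "(e - rfl j e) \<bullet> y = 2 * (root_vec j \<bullet> e) * (root_vec j \<bullet> y)"
      by (simp add: rfl_eq_root_vec inner_diff_left)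
    show ?thesis unfolding x_diff e_diff using that by (simp add: field_simps)
  qed
  then have "(\<Sum>j<2*k. kappa (int j) * (root_vec (int j) \<bullet> e)
        * ((x \<bullet> y) * f x - (rfl (int j) x \<bullet> y) * f (rfl (int j) x)) / (root_vec (int j) \<bullet> x))
      = (x \<bullet> y) * (\<Sum>j<2*k. kappa (int j) * (root_vec (int j) \<bullet> e)
          * (f x - f (rfl (int j) x)) / (root_vec (int j) \<bullet> x))
        + (\<Sum>j<2*k. kappa (int j) * ((e - rfl (int j) e) \<bullet> y) * f (rfl (int j) x))"
    using reg by (simp add: dih_regular_def dih_root_eq sum.distrib sum_distrib_left)
  then show ?thesis unfolding dunkl_op_eq frechet by (simp add: algebra_simps)
qed

end

section \<open>Uniqueness of the Dunkl kernel\<close>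

lemma has_real_derivative_along_ray:
  fixes f :: "'a :: real_normed_vector \<Rightarrow> real"
  assumes "f differentiable (at (s *\<^sub>R x))"
  shows "((\<lambda>s. f (s *\<^sub>R x)) has_real_derivative frechet_derivative f (at (s *\<^sub>R x)) x) (at s)"
proof -
  let ?D = "frechet_derivative f (at (s *\<^sub>R x))"
  have "(f has_derivative ?D) (at (s *\<^sub>R x))" using assms by (simp add: frechet_derivative_works)
  then have "((\<lambda>s. f (s *\<^sub>R x)) has_derivative (\<lambda>h. ?D (h *\<^sub>R x))) (at s)"
    by (rule has_derivative_compose[rotated]) (auto intro!: derivative_eq_intros)
  moreover have "(\<lambda>h. ?D (h *\<^sub>R x)) = (*) (?D x)"
    using linear_scale[OF linear_frechet_derivative[OF assms]] by (simp add: fun_eq_iff mult.commute)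
  ultimately show ?thesis by (simp add: has_field_derivative_def)
qed

lemma gronwall_eq_0:
  fixes V V' :: "real \<Rightarrow> real"
  assumes cont: "continuous_on {0..t} V" and V_0: "V 0 = 0" and t: "0 \<le> t" and nonneg: "0 \<le> V t"
    and deriv: "\<And>s. 0 < s \<Longrightarrow> s < t \<Longrightarrow> (V has_real_derivative V' s) (at s)"
    and bound: "\<And>s. 0 < s \<Longrightarrow> s < t \<Longrightarrow> V' s \<le> C * V s"
  shows "V t = 0"
proof -
  define W where "W s = V s * exp (- C * s)" for s
  have "W t \<le> W 0"
  proof (rule DERIV_nonpos_imp_decreasing_open[where f = W, OF t])
    show "\<exists>y. (W has_real_derivative y) (at s) \<and> y \<le> 0" if "0 < s" "s < t" for s
    proof (intro exI conjI)
      show "(W has_real_derivative (V' s - C * V s) * exp (- C * s)) (at s)"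
        unfolding W_def using that
        by (auto intro!: derivative_eq_intros deriv simp: algebra_simps)
      show "(V' s - C * V s) * exp (- C * s) \<le> 0"
        using bound[of s] that by (intro mult_nonpos_nonneg) auto
    qed
    show "continuous_on {0..t} W"
      unfolding W_def by (intro continuous_intros cont)
  qed
  then have "V t \<le> 0" by (simp add: W_def V_0 mult_le_0_iff)
  with nonneg show ?thesis by simp
qed

context dihedral
begin

text \<open>The energy is the weighted $\ell^2$-norm on the orbit; the operator \<open>refl_diff\<close>, whose coefficient \<open>e\<close>
  may blow up at $0$, only decreases it.\<close>

lemma orbit_energy_growth_le:
  fixes F F' w w' g :: "complex \<Rightarrow> real"
  assumes d: "0 < d" and C: "0 \<le> C" and e: "0 \<le> e"
    and w_lower: "\<And>p. p \<in> orbit x \<Longrightarrow> d \<le> w p"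
    and system: "\<And>p. p \<in> orbit x \<Longrightarrow> w p * F' p = g p * F p - e * refl_diff F p"
    and growth: "\<And>p. p \<in> orbit x \<Longrightarrow> w' p + 2 * g p \<le> C"
  shows "orbit_sum (\<lambda>p. w' p * (F p)\<^sup>2 + 2 * (F p * (w p * F' p))) x
    \<le> C / d * orbit_sum (\<lambda>p. w p * (F p)\<^sup>2) x"
proof -
  have "orbit_sum (\<lambda>p. w' p * (F p)\<^sup>2 + 2 * (F p * (w p * F' p))) x
      = orbit_sum (\<lambda>p. (w' p + 2 * g p) * (F p)\<^sup>2 - 2 * e * (F p * refl_diff F p)) x"
    by (intro orbit_sum_cong, subst system) (simp_all add: algebra_simps power2_eq_square)
  also have "\<dots> = orbit_sum (\<lambda>p. (w' p + 2 * g p) * (F p)\<^sup>2) x - 2 * e * orbit_sum (\<lambda>p. F p * refl_diff F p) x"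
    by (simp only: orbit_sum_diff orbit_sum_cmult)
  also have "\<dots> \<le> orbit_sum (\<lambda>p. (w' p + 2 * g p) * (F p)\<^sup>2) x"
    using e orbit_sum_refl_diff_nonneg[of F x] by simp
  also have "\<dots> \<le> orbit_sum (\<lambda>p. C * (F p)\<^sup>2) x"
    using growth by (intro orbit_sum_mono mult_right_mono) auto
  also have "\<dots> = C / d * orbit_sum (\<lambda>p. d * (F p)\<^sup>2) x"
    using d by (simp add: orbit_sum_cmult)
  also have "\<dots> \<le> C / d * orbit_sum (\<lambda>p. w p * (F p)\<^sup>2) x"
    using d C w_lower by (intro mult_left_mono orbit_sum_mono mult_right_mono) auto
  finally show ?thesis .
qed

lemma radial_system_eq_0:
  fixes F F' w w' g :: "real \<Rightarrow> complex \<Rightarrow> real"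
  assumes t: "0 \<le> t" and C: "0 \<le> C" and d: "0 < d"
    and cont_F: "\<And>p. p \<in> orbit x \<Longrightarrow> continuous_on {0..t} (\<lambda>s. F s p)"
    and cont_w: "\<And>p. p \<in> orbit x \<Longrightarrow> continuous_on {0..t} (\<lambda>s. w s p)"
    and F_0: "\<And>p. p \<in> orbit x \<Longrightarrow> F 0 p = 0"
    and w_lower: "\<And>s p. 0 \<le> s \<Longrightarrow> s \<le> t \<Longrightarrow> p \<in> orbit x \<Longrightarrow> d \<le> w s p"
    and deriv_F: "\<And>s p. 0 < s \<Longrightarrow> s < t \<Longrightarrow> p \<in> orbit x \<Longrightarrow>
      ((\<lambda>s. F s p) has_real_derivative F' s p) (at s)"
    and deriv_w: "\<And>s p. 0 < s \<Longrightarrow> s < t \<Longrightarrow> p \<in> orbit x \<Longrightarrow>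
      ((\<lambda>s. w s p) has_real_derivative w' s p) (at s)"
    and system: "\<And>s p. 0 < s \<Longrightarrow> s < t \<Longrightarrow> p \<in> orbit x \<Longrightarrow>
      w s p * F' s p = g s p * F s p - e s * refl_diff (F s) p"
    and e_nonneg: "\<And>s. 0 < s \<Longrightarrow> s < t \<Longrightarrow> 0 \<le> e s"
    and growth: "\<And>s p. 0 < s \<Longrightarrow> s < t \<Longrightarrow> p \<in> orbit x \<Longrightarrow> w' s p + 2 * g s p \<le> C"
  shows "F t x = 0"
proof -
  define V where "V s = orbit_sum (\<lambda>p. w s p * (F s p)\<^sup>2) x" for s
  define V' where "V' s = orbit_sum (\<lambda>p. w' s p * (F s p)\<^sup>2 + 2 * (F s p * (w s p * F' s p))) x" for s
  have V_lower: "d * orbit_sum (\<lambda>p. (F s p)\<^sup>2) x \<le> V s" if "0 \<le> s" "s \<le> t" for s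
    unfolding V_def orbit_sum_cmult[symmetric]
    using w_lower that by (intro orbit_sum_mono mult_right_mono) auto
  have square_le: "(F s x)\<^sup>2 \<le> orbit_sum (\<lambda>p. (F s p)\<^sup>2) x" for s
    by (rule le_orbit_sum) simp
  have V_growth: "V' s \<le> C / d * V s" if "0 < s" "s < t" for s
    unfolding V_def V'_def using that w_lower system e_nonneg growth
    by (intro orbit_energy_growth_le[OF d C, where g = "g s" and e = "e s"]) auto
  have "V t = 0"
  proof (rule gronwall_eq_0[OF _ _ t _ _ V_growth])
    show "continuous_on {0..t} V"
      unfolding V_def orbit_sum_def by (auto intro!: continuous_intros cont_F cont_w simp: orbit_def)
    show "V 0 = 0"
      unfolding V_def by (subst orbit_sum_cong[of x _ "\<lambda>_. 0"]) (simp_all add: F_0 orbit_sum_const)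
    have "0 \<le> d * orbit_sum (\<lambda>p. (F t p)\<^sup>2) x"
      using d order.trans[OF zero_le_power2 square_le] by simp
    then show "0 \<le> V t" using V_lower[OF t] by simp
    show "(V has_real_derivative V' s) (at s)" if s: "0 < s" "s < t" for s
    proof -
      have "((\<lambda>s. w s p * (F s p)\<^sup>2) has_real_derivative
          w' s p * (F s p)\<^sup>2 + 2 * (F s p * (w s p * F' s p))) (at s)" if "p \<in> orbit x" for p
        using deriv_F[OF s that] deriv_w[OF s that] by (auto intro!: derivative_eq_intros)
      then show ?thesis
        unfolding V_def V'_def orbit_sum_def by (intro DERIV_sum DERIV_add) (auto simp: orbit_def)
    qed
  qed
  then have "orbit_sum (\<lambda>p. (F t p)\<^sup>2) x \<le> 0"
    using V_lower[of t] t d by (simp add: mult_le_0_iff)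
  with square_le[of t] have "(F t x)\<^sup>2 \<le> 0" by linarith
  then show ?thesis by simp
qed

definition dunkl_eigen :: "complex \<Rightarrow> (complex \<Rightarrow> real) \<Rightarrow> bool" where
  "dunkl_eigen y f \<longleftrightarrow> (\<forall>p. f differentiable (at p)) \<and>
     (\<forall>p. dih_regular k p \<longrightarrow> (\<forall>e. dunkl_op k a b e f p = (e \<bullet> y) * f p))"

lemma dunkl_kernel_eq_The:
  "dunkl_kernel k a b x y = (THE f. dunkl_eigen y f \<and> f 0 = 1) x"
proof -
  have "((\<forall>p. f differentiable (at p)) \<and> f 0 = 1 \<and> (\<forall>p. dih_regular k p \<longrightarrow>
      dunkl_op k a b 1 f p = Re y * f p \<and> dunkl_op k a b \<i> f p = Im y * f p))
      \<longleftrightarrow> dunkl_eigen y f \<and> f 0 = 1" for f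
    unfolding dunkl_eigen_def using dunkl_op_eq_inner_iff[of f] by blast
  then show ?thesis unfolding dunkl_kernel_def by simp
qed

lemma dunkl_eigen_diff:
  assumes f: "dunkl_eigen y f" and g: "dunkl_eigen y g"
  shows "dunkl_eigen y (\<lambda>p. f p - g p)"
proof -
  have diff: "f differentiable (at p)" "g differentiable (at p)" for p
    using f g by (simp_all add: dunkl_eigen_def)
  then have minus_diff: "(\<lambda>p. (-1) * g p) differentiable (at p)" for p
    by (intro differentiable_mult differentiable_const)
  have "dunkl_eigen y (\<lambda>p. f p + (-1) * g p)"
    unfolding dunkl_eigen_def
  proof (intro conjI allI impI)
    show "(\<lambda>p. f p + (-1) * g p) differentiable (at p)" for p
      by (intro differentiable_add diff minus_diff)
    show "dunkl_op k a b e (\<lambda>p. f p + (-1) * g p) p = (e \<bullet> y) * (f p + (-1) * g p)"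
      if "dih_regular k p" for p e
      using f g that unfolding dunkl_op_add[OF diff(1) minus_diff] dunkl_op_cmult[OF diff(2)]
      by (simp add: dunkl_eigen_def algebra_simps)
  qed
  then show ?thesis by simp
qed

lemma dunkl_eigen_eq_0_regular:
  assumes f: "dunkl_eigen y f" and f_0: "f 0 = 0" and x: "dih_regular k x"
  shows "f x = 0"
proof -
  let ?D = "\<lambda>p. frechet_derivative f (at p)"
  have diff: "f differentiable (at p)" for p
    using f by (simp add: dunkl_eigen_def)
  have scale_D: "?D q (s *\<^sub>R p) = s * ?D q p" for q s p
    using linear_scale[OF linear_frechet_derivative[OF diff[of q]], of s p] by simp
  have radial: "?D p p + refl_diff f p = (p \<bullet> y) * f p" if "dih_regular k p" for p
    using f that dunkl_op_radial[OF that, of f] by (simp add: dunkl_eigen_def)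
  have scale_regular: "dih_regular k (s *\<^sub>R p)" if "p \<in> orbit x" "s > 0" for s p
    using dih_regular_orbit[OF x that(1)] that(2) by (simp add: dih_regular_scaleR)
  have "f (1 *\<^sub>R x) = 0"
  proof (rule radial_system_eq_0[where F = "\<lambda>s p. f (s *\<^sub>R p)" and F' = "\<lambda>s p. ?D (s *\<^sub>R p) p"
      and w = "\<lambda>_ _. 1" and w' = "\<lambda>_ _. 0" and g = "\<lambda>_ p. p \<bullet> y" and e = "\<lambda>s. 1 / s"
      and C = "2 * (cmod x * cmod y)" and d = 1])
    have "isCont f p" for p using diff by (rule differentiable_imp_continuous_within)
    then have "continuous_on UNIV f" by (simp add: continuous_on_eq_continuous_at)
    then show "continuous_on {0..1} (\<lambda>s. f (s *\<^sub>R p))" for p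
      by (auto intro!: continuous_intros continuous_on_compose2[of UNIV f])
    show "((\<lambda>s. f (s *\<^sub>R p)) has_real_derivative ?D (s *\<^sub>R p) p) (at s)" for s p
      by (rule has_real_derivative_along_ray[OF diff])
    show "1 * ?D (s *\<^sub>R p) p = (p \<bullet> y) * f (s *\<^sub>R p) - 1 / s * refl_diff (\<lambda>p. f (s *\<^sub>R p)) p"
      if s: "0 < s" and p: "p \<in> orbit x" for s p
    proof -
      have refl_diff_scale: "refl_diff (\<lambda>p. f (s *\<^sub>R p)) p = refl_diff f (s *\<^sub>R p)"
        by (simp add: refl_diff_def rfl_scaleR)
      have solve: "1 * D = B - 1 / s * A" if "s * D + A = s * B" for D A B
        using s that by (simp add: field_simps)
      have "s * ?D (s *\<^sub>R p) p + refl_diff f (s *\<^sub>R p) = s * ((p \<bullet> y) * f (s *\<^sub>R p))"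
        using radial[OF scale_regular[OF p s]] unfolding scale_D by simp
      then show ?thesis unfolding refl_diff_scale by (rule solve)
    qed
    show "0 + 2 * (p \<bullet> y) \<le> 2 * (cmod x * cmod y)" if "p \<in> orbit x" for p
      using norm_cauchy_schwarz[of p y] norm_orbit[OF that] by simp
  qed (simp_all add: f_0)
  then show ?thesis by simp
qed

lemma dunkl_eigen_eq_0:
  assumes f: "dunkl_eigen y f" and f_0: "f 0 = 0"
  shows "f x = 0"
proof -
  have "continuous_on UNIV f"
    using f differentiable_imp_continuous_within[of f _ UNIV]
    by (simp add: dunkl_eigen_def continuous_on_eq_continuous_within)
  then have "closed {p. f p = 0}" by (intro closed_Collect_eq) auto
  then have "closure {p. dih_regular k p} \<subseteq> {p. f p = 0}"
    using dunkl_eigen_eq_0_regular[OF f f_0] by (intro closure_minimal) auto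
  then show ?thesis using closure_dih_regular by auto
qed

lemma dunkl_kernel_eqI:
  assumes f: "dunkl_eigen y f" "f 0 = 1"
  shows "dunkl_kernel k a b x y = f x"
proof -
  have "(THE f. dunkl_eigen y f \<and> f 0 = 1) = f"
  proof (rule the_equality)
    show "g = f" if g: "dunkl_eigen y g \<and> g 0 = 1" for g
    proof
      fix p
      have "dunkl_eigen y (\<lambda>p. g p - f p)" using g f by (intro dunkl_eigen_diff) auto
      from dunkl_eigen_eq_0[OF this, of p] show "g p = f p" using f g by simp
    qed
  qed (use f in blast)
  then show ?thesis by (simp add: dunkl_kernel_eq_The)
qed

section \<open>Inverting the radial operator\<close>

definition sign_char :: "real \<Rightarrow> real \<Rightarrow> int \<Rightarrow> real" where
  "sign_char e d i = (if even i then e else d)"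

text \<open>For signs $e$ and $d$ the function $\sigma_i \mapsto$ \<open>sign_char e d i\<close> extends to a linear character
  of the group, whose value at the rotation $\sigma_i \sigma_0$ is \<open>sign_char e d i * e\<close>; this is the
  projection onto it.\<close>

definition isotypic :: "real \<Rightarrow> real \<Rightarrow> (complex \<Rightarrow> real) \<Rightarrow> complex \<Rightarrow> real" where
  "isotypic e d f x = 1 / (4 * real k) *
     (\<Sum>i<2*k. sign_char e d (int i) * (e * f (rot (int i) x) + f (rfl (int i) x)))"

definition refl_eigenvalue :: "real \<Rightarrow> real \<Rightarrow> real" where
  "refl_eigenvalue e d = real k * (a * (1 - e) + b * (1 - d))"

lemma isotypic_rfl:
  assumes e: "e \<in> {1, -1}" and d: "d \<in> {1, -1}"
  shows "isotypic e d f (rfl j x) = sign_char e d j * isotypic e d f x"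
proof -
  let ?chi = "sign_char e d"
  have chi_shift: "?chi (i - j) = ?chi j * ?chi i * e" "?chi (i + j) = ?chi j * ?chi i * e"
    and e_sq: "e * (e * r) = r" for i r
    using e d by (auto simp: sign_char_def)
  have "(\<Sum>i<2*k. ?chi (int i) * e * f (rfl (int i + j) x))
      = (\<Sum>i<2*k. ?chi (int i - j) * e * f (rfl (int i) x))"
    using sum_shift_index[of "\<lambda>i. ?chi (i - j) * e * f (rfl i x)" j] by (simp add: sign_char_def)
  moreover have "(\<Sum>i<2*k. ?chi (int i) * f (rot (int i - j) x))
      = (\<Sum>i<2*k. ?chi (int i + j) * f (rot (int i) x))"
    using sum_shift_index[of "\<lambda>i. ?chi (i + j) * f (rot i x)" "- j"] by (simp add: sign_char_def)
  ultimately have "(\<Sum>i<2*k. ?chi (int i) * (e * f (rfl (int i + j) x) + f (rot (int i - j) x)))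
      = (\<Sum>i<2*k. ?chi j * ?chi (int i) * (e * f (rot (int i) x) + f (rfl (int i) x)))"
    by (simp add: chi_shift e_sq ring_distribs sum.distrib mult_ac)
  then show ?thesis
    by (simp add: isotypic_def rot_rfl rfl_rfl sum_distrib_left mult_ac)
qed

lemma sum_kappa_sign_char: "(\<Sum>j<2*k. kappa (int j) * sign_char e d (int j)) = real k * (a * e + b * d)"
  using sum_even_odd[of "\<lambda>j. kappa j * sign_char e d j" k] by (simp add: kappa_def sign_char_def)

lemma refl_diff_isotypic:
  assumes "e \<in> {1, -1}" "d \<in> {1, -1}"
  shows "refl_diff (isotypic e d f) x = refl_eigenvalue e d * isotypic e d f x"
  by (simp add: refl_diff_eq isotypic_rfl[OF assms] mult.assoc[symmetric] sum_distrib_right[symmetric]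
      sum_kappa_sign_char) (simp add: refl_eigenvalue_def algebra_simps)

lemma sum_isotypic_rfl:
  "(\<Sum>e\<in>{1, -1}. \<Sum>d\<in>{1, -1}. isotypic e d f (rfl j x))
    = (\<Sum>i<2*k. if even (int i - j) then f (rfl (int i) x) else 0) / real k"
proof -
  have orthogonality:
    "(\<Sum>e\<in>{1, -1}. \<Sum>d\<in>{1, -1}. sign_char e d j * (sign_char e d i * (e * r + s)))
      = 4 * (if even (i - j) then s else 0)" for i r s
    by (auto simp: sign_char_def)
  have "(\<Sum>e\<in>{1, -1}. \<Sum>d\<in>{1, -1}. isotypic e d f (rfl j x))
    = (\<Sum>e\<in>{1, -1}. \<Sum>d\<in>{1, -1}. 1 / (4 * real k) * (\<Sum>i<2*k.
        sign_char e d j * (sign_char e d (int i) * (e * f (rot (int i) x) + f (rfl (int i) x)))))"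
    by (intro sum.cong refl, subst isotypic_rfl) (simp_all add: isotypic_def sum_distrib_left mult_ac)
  also have "\<dots> = 1 / (4 * real k) * (\<Sum>i<2*k. \<Sum>e\<in>{1, -1}. \<Sum>d\<in>{1, -1}.
        sign_char e d j * (sign_char e d (int i) * (e * f (rot (int i) x) + f (rfl (int i) x))))"
    by (simp add: sum.distrib sum_subtractf sum_negf add_divide_distrib diff_divide_distrib ring_distribs)
  also have "\<dots> = (\<Sum>i<2*k. if even (int i - j) then f (rfl (int i) x) else 0) / real k"
    unfolding orthogonality by (simp add: sum_distrib_left[symmetric])
  finally show ?thesis .
qed

lemma sum_kappa_sum_isotypic:
  "(\<Sum>j<2*k. kappa (int j) * (\<Sum>e\<in>{1, -1}. \<Sum>d\<in>{1, -1}. isotypic e d f (rfl (int j) x)))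
    = (\<Sum>j<2*k. kappa (int j) * f (rfl (int j) x))"
proof -
  have "(\<Sum>j<2*k. kappa (int j) * (if even (int i - int j) then c else 0)) = real k * (kappa (int i) * c)"
    for i :: nat and c
    using sum_even_odd[of "\<lambda>j. kappa j * (if even (int i - j) then c else 0)" k]
    by (simp add: kappa_def)
  then have "(\<Sum>i<2*k. \<Sum>j<2*k. kappa (int j) * (if even (int i - int j) then f (rfl (int i) x) else 0)) / real k
      = (\<Sum>i<2*k. kappa (int i) * f (rfl (int i) x))"
    by (simp add: sum_distrib_left[symmetric])
  then show ?thesis
    unfolding sum_isotypic_rfl by (subst (asm) sum.swap) (simp add: sum_distrib_left sum_divide_distrib)
qed

definition resolvent :: "real \<Rightarrow> (complex \<Rightarrow> real) \<Rightarrow> complex \<Rightarrow> real" where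
  "resolvent n f x = 1 / (n + real k * lam) * f x + (\<Sum>e\<in>{1, -1}. \<Sum>d\<in>{1, -1}.
     (1 / (n + refl_eigenvalue e d) - 1 / (n + real k * lam)) * isotypic e d f x)"

lemma refl_eigenvalue_nonneg: "e \<in> {1, -1} \<Longrightarrow> d \<in> {1, -1} \<Longrightarrow> 0 \<le> refl_eigenvalue e d"
  unfolding refl_eigenvalue_def using a b by (intro mult_nonneg_nonneg add_nonneg_nonneg) auto

lemma resolvent_eq:
  assumes n: "n > 0"
  shows "n * resolvent n f x + refl_diff (resolvent n f) x = f x"
proof -
  define N where "N = n + real k * lam"
  have N: "N > 0" using n lam_pos by (simp add: N_def add_pos_nonneg)
  define M where "M = 1 / N"
  have NM: "N * M = 1" using N by (simp add: M_def)
  let ?sum = "\<lambda>g :: real \<Rightarrow> real \<Rightarrow> real. \<Sum>e\<in>{1, -1}. \<Sum>d\<in>{1, -1}. g e d"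
  let ?P = "\<lambda>e d. isotypic e d f"
  define m where "m e d = 1 / (n + refl_eigenvalue e d) - M" for e d
  have linear: "n * resolvent n f x + refl_diff (resolvent n f) x
      = M * (n * f x + refl_diff f x) + ?sum (\<lambda>e d. m e d * (n * ?P e d x + refl_diff (?P e d) x))"
    unfolding resolvent_def[abs_def] N_def[symmetric] M_def[symmetric] m_def[symmetric]
    by (simp add: refl_diff_add refl_diff_cmult algebra_simps)
  have "m e d * (n * ?P e d x + refl_diff (?P e d) x)
      = ?P e d x - M * (n * ?P e d x + refl_diff (?P e d) x)"
    if ed: "e \<in> {1, -1}" "d \<in> {1, -1}" for e d
  proof -
    have "n + refl_eigenvalue e d > 0" using n refl_eigenvalue_nonneg[OF ed] by simp
    moreover have "n * ?P e d x + refl_diff (?P e d) x = (n + refl_eigenvalue e d) * ?P e d x"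
      by (simp only: refl_diff_isotypic[OF ed] distrib_right)
    ultimately show ?thesis by (simp add: m_def left_diff_distrib)
  qed
  then have "?sum (\<lambda>e d. m e d * (n * ?P e d x + refl_diff (?P e d) x))
      = ?sum (\<lambda>e d. ?P e d x - M * (n * ?P e d x + refl_diff (?P e d) x))"
    by (intro sum.cong refl)
  then have isotypic_sum: "?sum (\<lambda>e d. m e d * (n * ?P e d x + refl_diff (?P e d) x))
      = ?sum (\<lambda>e d. ?P e d x)
        - M * (n * ?sum (\<lambda>e d. ?P e d x) + refl_diff (\<lambda>x. ?sum (\<lambda>e d. ?P e d x)) x)"
    by (simp add: refl_diff_add algebra_simps)
  have "n * f x + refl_diff f x - (n * ?sum (\<lambda>e d. ?P e d x) + refl_diff (\<lambda>x. ?sum (\<lambda>e d. ?P e d x)) x)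
      = N * (f x - ?sum (\<lambda>e d. ?P e d x))"
    unfolding refl_diff_eq sum_kappa_sum_isotypic N_def by (simp only: algebra_simps)
  then have "M * (n * f x + refl_diff f x)
      - M * (n * ?sum (\<lambda>e d. ?P e d x) + refl_diff (\<lambda>x. ?sum (\<lambda>e d. ?P e d x)) x)
      = f x - ?sum (\<lambda>e d. ?P e d x)"
    unfolding right_diff_distrib[symmetric] using NM
    by (simp only: mult.assoc[symmetric] mult.commute[of M] mult_1)
  then show ?thesis unfolding linear isotypic_sum by linarith
qed


text \<open>Pointwise bounds for the values and for the derivatives obey the same rules under the operations from
  which the resolvent is built; \<open>B f x M\<close> is either of them.\<close>

definition invariant_bound :: "((complex \<Rightarrow> real) \<Rightarrow> complex \<Rightarrow> real \<Rightarrow> bool) \<Rightarrow> bool" where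
  "invariant_bound B \<longleftrightarrow>
     (\<forall>f g x M N. B f x M \<longrightarrow> B g x N \<longrightarrow> B (\<lambda>x. f x + g x) x (M + N)) \<and>
     (\<forall>f x M r R. B f x M \<longrightarrow> \<bar>r\<bar> \<le> R \<longrightarrow> B (\<lambda>x. r * f x) x (R * M)) \<and>
     (\<forall>f x M i. B f (rot i x) M \<longrightarrow> B (\<lambda>x. f (rot i x)) x M) \<and>
     (\<forall>f x M i. B f (rfl i x) M \<longrightarrow> B (\<lambda>x. f (rfl i x)) x M)"

lemma
  assumes "invariant_bound B"
  shows invariant_bound_add: "B f x M \<Longrightarrow> B g x N \<Longrightarrow> B (\<lambda>x. f x + g x) x (M + N)"
    and invariant_bound_cmult: "B f x M \<Longrightarrow> \<bar>r\<bar> \<le> R \<Longrightarrow> B (\<lambda>x. r * f x) x (R * M)"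
    and invariant_bound_rot: "B f (rot i x) M \<Longrightarrow> B (\<lambda>x. f (rot i x)) x M"
    and invariant_bound_rfl: "B f (rfl i x) M \<Longrightarrow> B (\<lambda>x. f (rfl i x)) x M"
  using assms unfolding invariant_bound_def by blast+

lemma invariant_bound_sum:
  fixes m :: nat
  assumes B: "invariant_bound B" and f: "\<And>i. B (f i) x M"
  shows "B (\<lambda>x. \<Sum>i<m. f i x) x (real m * M)"
proof (induction m)
  case 0
  show ?case using invariant_bound_cmult[OF B f, of 0 0] by simp
next
  case (Suc m)
  from invariant_bound_add[OF B this f[of m]] show ?case by (simp add: ring_distribs add_ac)
qed

lemma invariant_bound_isotypic:
  assumes B: "invariant_bound B" and f: "\<And>p. cmod p = cmod x \<Longrightarrow> B f p M"
    and e: "e \<in> {1, -1}" and d: "d \<in> {1, -1}"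
  shows "B (isotypic e d f) x M"
proof -
  note add = invariant_bound_add[OF B] and cmult = invariant_bound_cmult[OF B]
  have "B (\<lambda>x. sign_char e d (int i) * (e * f (rot (int i) x) + f (rfl (int i) x))) x (1 * (1 * M + M))" for i
    using e d by (intro cmult add invariant_bound_rot[OF B] invariant_bound_rfl[OF B] f)
      (auto simp: sign_char_def)
  from invariant_bound_sum[OF B this, where m = "2 * k"]
  have "B (isotypic e d f) x (1 / (4 * real k) * (real (2 * k) * (1 * (1 * M + M))))"
    unfolding isotypic_def[abs_def] by (intro cmult) auto
  then show ?thesis by simp
qed

lemma invariant_bound_resolvent:
  assumes B: "invariant_bound B" and n: "n > 0" and f: "\<And>p. cmod p = cmod x \<Longrightarrow> B f p M"
  shows "B (resolvent n f) x (5 * M / n)"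
proof -
  note add = invariant_bound_add[OF B] and cmult = invariant_bound_cmult[OF B]
  have coeff: "\<bar>1 / (n + real k * lam)\<bar> \<le> 1 / n"
    using n lam_pos by (simp add: frac_le)
  have coeff_diff: "\<bar>1 / (n + refl_eigenvalue e d) - 1 / (n + real k * lam)\<bar> \<le> 1 / n"
    if "e \<in> {1, -1}" "d \<in> {1, -1}" for e d
  proof -
    have between: "0 \<le> 1 / (n + s)" "1 / (n + s) \<le> 1 / n" if "s \<ge> 0" for s
      using n that by (simp_all add: frac_le)
    have "0 \<le> real k * lam" using lam_pos by simp
    from between[OF this] between[OF refl_eigenvalue_nonneg[OF that]] show ?thesis by linarith
  qed
  have sum_signs: "(\<Sum>e\<in>{1, -1}. g e) = g 1 + g (-1)" for g :: "real \<Rightarrow> real"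
    by simp
  have "B (resolvent n f) x (1 / n * M + ((1 / n * M + 1 / n * M) + (1 / n * M + 1 / n * M)))"
    unfolding resolvent_def[abs_def] sum_signs
    by (intro add cmult coeff coeff_diff invariant_bound_isotypic[OF B] f; simp)
  moreover have "1 / n * M + ((1 / n * M + 1 / n * M) + (1 / n * M + 1 / n * M)) = 5 * M / n"
    using n by (simp add: field_simps)
  ultimately show ?thesis by simp
qed

end

definition deriv_bound :: "('a :: real_normed_vector \<Rightarrow> 'b :: real_normed_vector) \<Rightarrow> 'a \<Rightarrow> real \<Rightarrow> bool" where
  "deriv_bound f x M \<longleftrightarrow> (\<exists>D. (f has_derivative D) (at x) \<and> (\<forall>h. norm (D h) \<le> M * norm h))"

lemma deriv_boundI:
  "(f has_derivative D) (at x) \<Longrightarrow> (\<And>h. norm (D h) \<le> M * norm h) \<Longrightarrow> deriv_bound f x M"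
  by (auto simp: deriv_bound_def)

lemma deriv_bound_frechet:
  assumes "deriv_bound f x M"
  shows "(f has_derivative frechet_derivative f (at x)) (at x)"
    and "norm (frechet_derivative f (at x) h) \<le> M * norm h"
proof -
  from assms obtain D where D: "(f has_derivative D) (at x)" "\<And>h. norm (D h) \<le> M * norm h"
    by (auto simp: deriv_bound_def)
  with frechet_derivative_at[OF D(1)]
  show "(f has_derivative frechet_derivative f (at x)) (at x)"
    and "norm (frechet_derivative f (at x) h) \<le> M * norm h" by simp_all
qed

lemma deriv_bound_const: "deriv_bound (\<lambda>x. c) x 0"
  by (rule deriv_boundI[OF has_derivative_const]) simp

lemma deriv_bound_add:
  assumes "deriv_bound f x M" "deriv_bound g x N"
  shows "deriv_bound (\<lambda>x. f x + g x) x (M + N)"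
proof -
  from assms(1) obtain D where D: "(f has_derivative D) (at x)" "\<And>h. norm (D h) \<le> M * norm h"
    by (auto simp: deriv_bound_def)
  from assms(2) obtain E where E: "(g has_derivative E) (at x)" "\<And>h. norm (E h) \<le> N * norm h"
    by (auto simp: deriv_bound_def)
  have "norm (D h + E h) \<le> (M + N) * norm h" for h
    using norm_triangle_mono[OF D(2) E(2), of h h] by (simp add: distrib_right)
  with has_derivative_add[OF D(1) E(1)] show ?thesis by (rule deriv_boundI)
qed

lemma deriv_bound_cmult:
  fixes f :: "'a :: real_normed_vector \<Rightarrow> 'b :: real_normed_algebra"
  assumes "deriv_bound f x M" and r: "norm r \<le> R"
  shows "deriv_bound (\<lambda>x. r * f x) x (R * M)"
proof -
  from assms(1) obtain D where D: "(f has_derivative D) (at x)" "\<And>h. norm (D h) \<le> M * norm h"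
    by (auto simp: deriv_bound_def)
  have "norm (r * D h) \<le> R * M * norm h" for h
  proof -
    have "norm (r * D h) \<le> norm r * norm (D h)" by (rule norm_mult_ineq)
    also have "\<dots> \<le> R * (M * norm h)"
      using r D(2)[of h] order.trans[OF norm_ge_zero r] by (intro mult_mono) auto
    finally show ?thesis by (simp add: mult.assoc)
  qed
  with has_derivative_mult_right[OF D(1)] show ?thesis by (rule deriv_boundI)
qed

lemma deriv_bound_compose:
  assumes "deriv_bound f (g x) M" and g: "(g has_derivative g') (at x)" and "\<And>h. norm (g' h) = norm h"
  shows "deriv_bound (\<lambda>x. f (g x)) x M"
proof -
  from assms(1) obtain D where D: "(f has_derivative D) (at (g x))" "\<And>h. norm (D h) \<le> M * norm h"
    by (auto simp: deriv_bound_def)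
  have "norm (D (g' h)) \<le> M * norm h" for h using D(2)[of "g' h"] assms(3) by simp
  with has_derivative_compose[OF g D(1)] show ?thesis by (rule deriv_boundI)
qed

lemma deriv_bound_mono:
  assumes "deriv_bound f x M" "M \<le> N"
  shows "deriv_bound f x N"
proof -
  from assms(1) obtain D where D: "(f has_derivative D) (at x)" "\<And>h. norm (D h) \<le> M * norm h"
    by (auto simp: deriv_bound_def)
  with assms(2) show ?thesis
    by (intro deriv_boundI[OF D(1)] order.trans[OF D(2)] mult_right_mono) auto
qed

lemma deriv_bound_inner_mult:
  fixes f :: "'a :: real_inner \<Rightarrow> real"
  assumes "deriv_bound f x M" and C: "\<bar>f x\<bar> \<le> C"
  shows "deriv_bound (\<lambda>x. (x \<bullet> y) * f x) x (norm y * C + norm x * norm y * M)"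
proof -
  from assms(1) obtain D where D: "(f has_derivative D) (at x)" "\<And>h. norm (D h) \<le> M * norm h"
    by (auto simp: deriv_bound_def)
  have "\<bar>(x \<bullet> y) * D h + (h \<bullet> y) * f x\<bar> \<le> (norm y * C + norm x * norm y * M) * norm h" for h
  proof -
    have "\<bar>(x \<bullet> y) * D h\<bar> \<le> (norm x * norm y) * (M * norm h)"
      unfolding abs_mult using D(2)[of h] Cauchy_Schwarz_ineq2[of x y] by (intro mult_mono) auto
    moreover have "\<bar>(h \<bullet> y) * f x\<bar> \<le> (norm h * norm y) * C"
      unfolding abs_mult using C Cauchy_Schwarz_ineq2[of h y] by (intro mult_mono) auto
    ultimately show ?thesis by (simp add: algebra_simps)
  qed
  moreover have "((\<lambda>x. (x \<bullet> y) * f x) has_derivative (\<lambda>h. (x \<bullet> y) * D h + (h \<bullet> y) * f x)) (at x)"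
    using D(1) by (auto intro!: derivative_eq_intros)
  ultimately show ?thesis by (intro deriv_boundI) auto
qed

lemma has_derivative_suminf_M_test:
  fixes f :: "nat \<Rightarrow> 'a :: real_normed_vector \<Rightarrow> 'b :: banach"
  assumes S: "convex S" "open S" "x \<in> S" and M: "summable M"
    and f: "\<And>n p. p \<in> S \<Longrightarrow> deriv_bound (f n) p (M n)"
    and summ: "\<And>p. p \<in> S \<Longrightarrow> summable (\<lambda>n. f n p)"
  shows "summable (\<lambda>n. frechet_derivative (f n) (at x) h)"
    and "((\<lambda>p. \<Sum>n. f n p) has_derivative (\<lambda>h. \<Sum>n. frechet_derivative (f n) (at x) h)) (at x)"
proof -
  let ?D = "\<lambda>n p. frechet_derivative (f n) (at p)"
  note bound = deriv_bound_frechet(2)[OF f]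
  have summ_D: "summable (\<lambda>n. ?D n p h)" if "p \<in> S" for p h
    by (rule summable_comparison_test[OF _ summable_mult2[OF M]]) (use bound[OF that] in auto)
  show "summable (\<lambda>n. ?D n x h)" by (rule summ_D[OF S(3)])
  have "\<exists>g. \<forall>p\<in>S. (\<lambda>n. f n p) sums g p \<and> (g has_derivative (\<lambda>h. \<Sum>n. ?D n p h)) (at p within S)"
  proof (rule has_derivative_series[OF S(1)])
    show "x \<in> S" by (rule S(3))
    show "(\<lambda>n. f n x) sums (\<Sum>n. f n x)" by (rule summable_sums[OF summ[OF S(3)]])
    show "(f n has_derivative ?D n p) (at p within S)" if "p \<in> S" for n p
      by (rule has_derivative_at_withinI[OF deriv_bound_frechet(1)[OF f[OF that]]])
    fix e :: real assume "e > 0"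
    with suminf_exist_split2[OF M] have "\<forall>\<^sub>F N in sequentially. (\<Sum>n. M (n + N)) < e"
      by (rule order_tendstoD(2))
    then show "\<forall>\<^sub>F N in sequentially. \<forall>p\<in>S. \<forall>h. norm ((\<Sum>n<N. ?D n p h) - (\<Sum>n. ?D n p h)) \<le> e * norm h"
    proof (rule eventually_mono, intro ballI allI)
      fix N p h assume N: "(\<Sum>n. M (n + N)) < e" and p: "p \<in> S"
      have summ_tail: "summable (\<lambda>n. M (n + N))" by (rule summable_ignore_initial_segment[OF M])
      have "norm ((\<Sum>n<N. ?D n p h) - (\<Sum>n. ?D n p h)) = norm (\<Sum>n. ?D (n + N) p h)"
        using suminf_split_initial_segment[OF summ_D[OF p, of h], of N] by (simp add: norm_minus_commute)
      also have "\<dots> \<le> (\<Sum>n. M (n + N) * norm h)"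
        using bound[OF p] summable_mult2[OF summ_tail] by (intro norm_suminf_le) auto
      also have "\<dots> = (\<Sum>n. M (n + N)) * norm h" by (rule suminf_mult2[OF summ_tail, symmetric])
      also have "\<dots> \<le> e * norm h" using N by (intro mult_right_mono) auto
      finally show "norm ((\<Sum>n<N. ?D n p h) - (\<Sum>n. ?D n p h)) \<le> e * norm h" .
    qed
  qed
  then obtain g where g: "\<And>p. p \<in> S \<Longrightarrow> (\<lambda>n. f n p) sums g p"
    "\<And>p. p \<in> S \<Longrightarrow> (g has_derivative (\<lambda>h. \<Sum>n. ?D n p h)) (at p within S)" by blast
  have "(g has_derivative (\<lambda>h. \<Sum>n. ?D n x h)) (at x)"
    using g(2)[OF S(3)] at_within_open[OF S(3,2)] by simp
  then show "((\<lambda>p. \<Sum>n. f n p) has_derivative (\<lambda>h. \<Sum>n. ?D n x h)) (at x)"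
    by (rule has_derivative_transform_within_open[OF _ S(2,3)]) (use g(1) in \<open>simp add: sums_iff\<close>)
qed

section \<open>Existence of the Dunkl kernel\<close>

context dihedral
begin

lemma invariant_bound_abs: "invariant_bound (\<lambda>f x M. \<bar>f x\<bar> \<le> M)"
  unfolding invariant_bound_def
proof (intro conjI allI impI)
  show "\<bar>f x + g x\<bar> \<le> M + N" if "\<bar>f x\<bar> \<le> M" "\<bar>g x\<bar> \<le> N" for f g :: "complex \<Rightarrow> real" and x M N
    using that by linarith
  show "\<bar>r * f x\<bar> \<le> R * M" if "\<bar>f x\<bar> \<le> M" "\<bar>r\<bar> \<le> R" for f :: "complex \<Rightarrow> real" and x M r R
    unfolding abs_mult using that by (intro mult_mono) auto
qed

lemma invariant_bound_deriv_bound: "invariant_bound deriv_bound"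
  unfolding invariant_bound_def
  using deriv_bound_add deriv_bound_cmult[where 'b = real, unfolded real_norm_def]
    deriv_bound_compose[OF _ has_derivative_rot norm_rot]
    deriv_bound_compose[OF _ has_derivative_rfl norm_rfl]
  by blast

primrec dunkl_comp :: "complex \<Rightarrow> nat \<Rightarrow> complex \<Rightarrow> real" where
  "dunkl_comp y 0 = (\<lambda>x. 1)"
| "dunkl_comp y (Suc n) = resolvent (real (Suc n)) (\<lambda>x. (x \<bullet> y) * dunkl_comp y n x)"

declare dunkl_comp.simps(2) [simp del]

lemma dunkl_comp_rec:
  "real (Suc n) * dunkl_comp y (Suc n) x + refl_diff (dunkl_comp y (Suc n)) x = (x \<bullet> y) * dunkl_comp y n x"
  unfolding dunkl_comp.simps by (rule resolvent_eq) simp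

lemma resolvent_homogeneous:
  assumes "\<And>p. g (t *\<^sub>R p) = s * f p"
  shows "resolvent n g (t *\<^sub>R x) = s * resolvent n f x"
proof -
  have "isotypic e d g (t *\<^sub>R x) = s * isotypic e d f x" for e d
    by (simp add: isotypic_def rot_scaleR rfl_scaleR assms sum_distrib_left algebra_simps)
  then show ?thesis by (simp add: resolvent_def assms algebra_simps)
qed

lemma dunkl_comp_scaleR: "dunkl_comp y n (t *\<^sub>R x) = t ^ n * dunkl_comp y n x"
proof (induction n arbitrary: x)
  case (Suc n)
  show ?case unfolding dunkl_comp.simps
    by (rule resolvent_homogeneous) (simp add: Suc algebra_simps)
qed simp

lemma dunkl_comp_scaleR_left: "dunkl_comp (t *\<^sub>R y) n x = t ^ n * dunkl_comp y n x"
proof (induction n arbitrary: x)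
  case (Suc n)
  have "resolvent (real (Suc n)) (\<lambda>x. (x \<bullet> t *\<^sub>R y) * dunkl_comp (t *\<^sub>R y) n x) (1 *\<^sub>R x)
      = t ^ Suc n * resolvent (real (Suc n)) (\<lambda>x. (x \<bullet> y) * dunkl_comp y n x) x"
    by (rule resolvent_homogeneous) (simp add: Suc algebra_simps)
  then show ?case by (simp add: dunkl_comp.simps)
qed simp

lemma dunkl_comp_at_0: "dunkl_comp y n 0 = (if n = 0 then 1 else 0)"
  using dunkl_comp_scaleR[of y n 0 0] by (cases n) simp_all

lemma abs_dunkl_comp_le: "\<bar>dunkl_comp y n x\<bar> \<le> (5 * (cmod x * cmod y)) ^ n / fact n"
proof (induction n arbitrary: x)
  case (Suc n)
  let ?M = "(cmod x * cmod y) * ((5 * (cmod x * cmod y)) ^ n / fact n)"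
  have "\<bar>(p \<bullet> y) * dunkl_comp y n p\<bar> \<le> ?M" if "cmod p = cmod x" for p
    unfolding abs_mult using Suc[of p] Cauchy_Schwarz_ineq2[of p y] that
    by (intro mult_mono) auto
  then have "\<bar>dunkl_comp y (Suc n) x\<bar> \<le> 5 * ?M / real (Suc n)"
    unfolding dunkl_comp.simps by (intro invariant_bound_resolvent[OF invariant_bound_abs]) auto
  also have "\<dots> = (5 * (cmod x * cmod y)) ^ Suc n / fact (Suc n)"
    by (simp add: mult_ac)
  finally show ?case .
qed simp

lemma deriv_bound_dunkl_comp:
  assumes r: "1 \<le> r" and x: "cmod x \<le> r"
  shows "deriv_bound (dunkl_comp y n) x (real n * (5 * (r * cmod y)) ^ n / fact n)"
  using x
proof (induction n arbitrary: x)
  case 0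
  show ?case using deriv_bound_const[of 1 x] by simp
next
  case (Suc n)
  define C where "C = (5 * (r * cmod y)) ^ n / fact n"
  have C: "0 \<le> C" using r by (simp add: C_def)
  let ?M = "r * cmod y * (real (Suc n) * C)"
  have "deriv_bound (\<lambda>x. (x \<bullet> y) * dunkl_comp y n x) p ?M" if "cmod p = cmod x" for p
  proof (rule deriv_bound_mono)
    have p: "cmod p \<le> r" using that Suc.prems by simp
    have "(5 * (cmod p * cmod y)) ^ n \<le> (5 * (r * cmod y)) ^ n"
      using p by (intro power_mono mult_left_mono mult_right_mono) auto
    then have "\<bar>dunkl_comp y n p\<bar> \<le> C"
      unfolding C_def using order.trans[OF abs_dunkl_comp_le] by (simp add: divide_right_mono)
    moreover have "deriv_bound (dunkl_comp y n) p (real n * C)"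
      using Suc.IH[OF p] by (simp add: C_def)
    ultimately show "deriv_bound (\<lambda>x. (x \<bullet> y) * dunkl_comp y n x) p
        (cmod y * C + cmod p * cmod y * (real n * C))"
      by (intro deriv_bound_inner_mult)
    have "cmod y * C + cmod p * (cmod y * (real n * C)) \<le> r * (cmod y * C) + r * (cmod y * (real n * C))"
    proof (rule add_mono)
      show "cmod y * C \<le> r * (cmod y * C)"
        using mult_right_mono[OF r mult_nonneg_nonneg[OF norm_ge_zero C]] by (simp only: mult_1)
      show "cmod p * (cmod y * (real n * C)) \<le> r * (cmod y * (real n * C))"
        using p C by (intro mult_right_mono mult_nonneg_nonneg) auto
    qed
    then show "cmod y * C + cmod p * cmod y * (real n * C) \<le> ?M"
      by (simp add: algebra_simps)
  qed
  then have "deriv_bound (dunkl_comp y (Suc n)) x (5 * ?M / real (Suc n))"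
    unfolding dunkl_comp.simps by (intro invariant_bound_resolvent[OF invariant_bound_deriv_bound]) auto
  moreover have "5 * ?M / real (Suc n) = real (Suc n) * (5 * (r * cmod y)) ^ Suc n / fact (Suc n)"
    by (simp add: C_def field_simps)
  ultimately show ?case by (simp only:)
qed

lemma has_derivative_dunkl_comp:
  "(dunkl_comp y n has_derivative frechet_derivative (dunkl_comp y n) (at x)) (at x)"
  using deriv_bound_dunkl_comp[of "max 1 (cmod x)" x y n] by (intro deriv_bound_frechet(1)) auto

lemma differentiable_dunkl_comp: "dunkl_comp y n differentiable (at x)"
  using has_derivative_dunkl_comp by (rule differentiableI)

lemma frechet_derivative_dunkl_comp_self:
  "frechet_derivative (dunkl_comp y n) (at x) x = real n * dunkl_comp y n x"
proof -
  have "((\<lambda>t. t ^ n * dunkl_comp y n x) has_real_derivative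
      frechet_derivative (dunkl_comp y n) (at x) x) (at 1)"
    using has_real_derivative_along_ray[of "dunkl_comp y n" 1 x] differentiable_dunkl_comp
    by (simp add: dunkl_comp_scaleR)
  moreover have "((\<lambda>t. t ^ n * dunkl_comp y n x) has_real_derivative real n * dunkl_comp y n x) (at 1)"
    by (auto intro!: derivative_eq_intros)
  ultimately show ?thesis by (rule DERIV_unique)
qed


abbreviation angular :: "(complex \<Rightarrow> real) \<Rightarrow> complex \<Rightarrow> real" where
  "angular f x \<equiv> dunkl_op k a b (\<i> * x) f x"

lemma angular_rfl:
  assumes "f differentiable (at (rfl j x))"
  shows "angular (\<lambda>p. f (rfl j p)) x = - angular f (rfl j x)"
proof -
  have "rfl j (\<i> * x) = - (\<i> * rfl j x)" by (simp add: rfl_def)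
  then show ?thesis
    using dunkl_op_rfl[OF assms] linear_neg[OF linear_dunkl_op[OF assms]] by simp
qed

text \<open>Reflections reverse orientation, so they anticommute with the angular operator. Applied to the radial
  recursion, the angular operator therefore turns $n + \sum_j \kappa_j (1 - \sigma_j)$ into
  $n + \sum_j \kappa_j (1 + \sigma_j)$, which is again injective.\<close>

lemma angular_dunkl_comp_rec:
  fixes n :: nat
  assumes p: "dih_regular k p"
  defines "N \<equiv> real (Suc n) + real k * lam"
  shows "N * angular (dunkl_comp y (Suc n)) p
      + (\<Sum>j<2*k. kappa (int j) * angular (dunkl_comp y (Suc n)) (rfl (int j) p))
    = ((\<i> * p) \<bullet> y) * dunkl_comp y n p + (p \<bullet> y) * angular (dunkl_comp y n) p
      + (\<Sum>j<2*k. kappa (int j) * ((\<i> * p + \<i> * rfl (int j) p) \<bullet> y) * dunkl_comp y n (rfl (int j) p))"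
proof -
  let ?e = "dunkl_comp y (Suc n)"
  have diff_rfl: "(\<lambda>p. ?e (rfl (int j) p)) differentiable (at p)" for j
    by (intro differentiable_rfl differentiable_dunkl_comp)
  have diff_term: "(\<lambda>p. (- kappa (int j)) * ?e (rfl (int j) p)) differentiable (at p)" for j
    by (rule differentiable_mult[OF differentiable_const diff_rfl])
  have diff_self: "(\<lambda>p. N * ?e p) differentiable (at p)"
    by (rule differentiable_mult[OF differentiable_const differentiable_dunkl_comp])
  have "(\<lambda>p. N * ?e p + (\<Sum>j<2*k. (- kappa (int j)) * ?e (rfl (int j) p))) = (\<lambda>p. (p \<bullet> y) * dunkl_comp y n p)"
    using dunkl_comp_rec[of n y] by (simp add: N_def refl_diff_eq fun_eq_iff sum_negf algebra_simps)
  then have "angular (\<lambda>p. N * ?e p + (\<Sum>j<2*k. (- kappa (int j)) * ?e (rfl (int j) p))) p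
      = angular (\<lambda>p. (p \<bullet> y) * dunkl_comp y n p) p" by (rule arg_cong)
  moreover have "angular (\<lambda>p. N * ?e p + (\<Sum>j<2*k. (- kappa (int j)) * ?e (rfl (int j) p))) p
      = angular (\<lambda>p. N * ?e p) p + (\<Sum>j<2*k. angular (\<lambda>p. (- kappa (int j)) * ?e (rfl (int j) p)) p)"
    using diff_term diff_self
    by (subst dunkl_op_add) (auto intro!: differentiable_sum simp: dunkl_op_sum)
  moreover have "angular (\<lambda>p. (- kappa (int j)) * ?e (rfl (int j) p)) p
      = kappa (int j) * angular ?e (rfl (int j) p)" for j
    by (simp only: dunkl_op_cmult[OF diff_rfl] angular_rfl[OF differentiable_dunkl_comp] minus_mult_minus)
  moreover have "\<i> * p - rfl j (\<i> * p) = \<i> * p + \<i> * rfl j p" for j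
    by (simp add: rfl_def)
  ultimately show ?thesis
    by (simp only: dunkl_op_cmult[OF differentiable_dunkl_comp]
        dunkl_op_inner_mult[OF p differentiable_dunkl_comp])
qed

lemma angular_dunkl_comp_step:
  assumes prev: "\<And>p. dih_regular k p \<Longrightarrow> (p \<bullet> y) * angular (dunkl_comp y n) p
      = ((\<i> * p) \<bullet> y) * (real n * dunkl_comp y n p + refl_diff (dunkl_comp y n) p)"
    and x: "dih_regular k x"
  shows "angular (dunkl_comp y (Suc n)) x = ((\<i> * x) \<bullet> y) * dunkl_comp y n x"
proof -
  define m where "m p = angular (dunkl_comp y (Suc n)) p - ((\<i> * p) \<bullet> y) * dunkl_comp y n p" for p
  have "m x = 0"
  proof (rule shifted_refl_sum_eq_0_imp_eq_0[where n = "real (Suc n)"])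
    fix p assume "p \<in> orbit x"
    then have p: "dih_regular k p" by (rule dih_regular_orbit[OF x])
    show "(real (Suc n) + real k * lam) * m p + (\<Sum>j<2*k. kappa (int j) * m (rfl (int j) p)) = 0"
      using angular_dunkl_comp_rec[OF p, of n y] prev[OF p]
      by (simp add: m_def refl_diff_eq inner_add_left ring_distribs sum.distrib sum_subtractf
          sum_distrib_left mult_ac)
  qed simp
  then show ?thesis by (simp add: m_def)
qed

lemma angular_dunkl_comp:
  "dih_regular k x \<Longrightarrow> angular (dunkl_comp y (Suc n)) x = ((\<i> * x) \<bullet> y) * dunkl_comp y n x"
proof (induction n arbitrary: x)
  case 0
  then show ?case
    by (intro angular_dunkl_comp_step) (simp_all add: dunkl_op_const refl_diff_def)
next
  case (Suc n)
  show ?case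
    by (rule angular_dunkl_comp_step[OF _ Suc.prems]) (simp only: dunkl_comp_rec Suc.IH mult.left_commute)
qed

lemma dunkl_op_dunkl_comp_Suc:
  assumes x: "dih_regular k x"
  shows "dunkl_op k a b e (dunkl_comp y (Suc n)) x = (e \<bullet> y) * dunkl_comp y n x"
proof -
  let ?T = "\<lambda>e. dunkl_op k a b e (dunkl_comp y (Suc n)) x"
  note lin = linear_dunkl_op[OF differentiable_dunkl_comp, of y "Suc n" x]
  have "x ^ (2 * k) \<noteq> 0" using x by (auto simp: dih_regular_iff_Im_power)
  then have "x \<noteq> 0" by auto
  then obtain s t where e: "e = s *\<^sub>R x + t *\<^sub>R (\<i> * x)"
  proof (intro that[of "Re (e / x)" "Im (e / x)"])
    have "e = complex_of_real (Re (e / x)) * x + complex_of_real (Im (e / x)) * (\<i> * x)"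
      using complex_eq[of "e / x"] \<open>x \<noteq> 0\<close> by (simp add: field_simps)
    then show "e = Re (e / x) *\<^sub>R x + Im (e / x) *\<^sub>R (\<i> * x)"
      by (simp only: scaleR_conv_of_real)
  qed
  have "?T x = (x \<bullet> y) * dunkl_comp y n x"
    unfolding dunkl_op_radial[OF x] frechet_derivative_dunkl_comp_self by (rule dunkl_comp_rec)
  moreover have "?T (\<i> * x) = ((\<i> * x) \<bullet> y) * dunkl_comp y n x"
    by (rule angular_dunkl_comp[OF x])
  ultimately show ?thesis
    by (simp add: e linear_add[OF lin] linear_scale[OF lin] inner_add_left algebra_simps)
qed

definition dunkl_series :: "complex \<Rightarrow> complex \<Rightarrow> real" where
  "dunkl_series y x = (\<Sum>n. dunkl_comp y n x)"

lemma summable_dunkl_comp: "summable (\<lambda>n. dunkl_comp y n x)"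
proof (rule summable_comparison_test[OF _ summable_exp[of "5 * (cmod x * cmod y)"]])
  show "\<exists>N. \<forall>n\<ge>N. norm (dunkl_comp y n x) \<le> inverse (fact n) * (5 * (cmod x * cmod y)) ^ n"
    using abs_dunkl_comp_le[of y _ x] by (simp add: field_simps)
qed

lemma dunkl_series_sums: "(\<lambda>n. dunkl_comp y n x) sums dunkl_series y x"
  unfolding dunkl_series_def by (rule summable_sums[OF summable_dunkl_comp])

lemma dunkl_series_has_derivative:
  shows "summable (\<lambda>n. frechet_derivative (dunkl_comp y n) (at x) h)"
    and "(dunkl_series y has_derivative (\<lambda>h. \<Sum>n. frechet_derivative (dunkl_comp y n) (at x) h)) (at x)"
proof -
  define r where "r = cmod x + 1"
  define M where "M n = real n * (5 * (r * cmod y)) ^ n / fact n" for n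
  have M: "summable M"
  proof (subst summable_Suc_iff[symmetric])
    have "M (Suc n) = (5 * (r * cmod y)) * (inverse (fact n) * (5 * (r * cmod y)) ^ n)" for n
      unfolding M_def by (simp add: divide_inverse fact_Suc del: of_nat_Suc)
    then show "summable (\<lambda>n. M (Suc n))"
      by (simp only: summable_mult summable_exp)
  qed
  have "deriv_bound (dunkl_comp y n) p (M n)" if "p \<in> ball 0 r" for n p
    unfolding M_def using that by (intro deriv_bound_dunkl_comp) (auto simp: r_def)
  note termwise = has_derivative_suminf_M_test[OF convex_ball open_ball _ M this summable_dunkl_comp]
  have x: "x \<in> ball 0 r" by (simp add: r_def)
  show "summable (\<lambda>n. frechet_derivative (dunkl_comp y n) (at x) h)"
    by (rule termwise(1)[OF x])
  show "(dunkl_series y has_derivative (\<lambda>h. \<Sum>n. frechet_derivative (dunkl_comp y n) (at x) h)) (at x)"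
    unfolding dunkl_series_def[abs_def] by (rule termwise(2)[OF x])
qed

lemma dunkl_op_dunkl_series:
  assumes x: "dih_regular k x"
  shows "dunkl_op k a b e (dunkl_series y) x = (e \<bullet> y) * dunkl_series y x"
proof -
  have "(\<lambda>n. frechet_derivative (dunkl_comp y n) (at x) e) sums frechet_derivative (dunkl_series y) (at x) e"
    unfolding frechet_derivative_at[OF dunkl_series_has_derivative(2), symmetric]
    by (rule summable_sums[OF dunkl_series_has_derivative(1)])
  then have "(\<lambda>n. dunkl_op k a b e (dunkl_comp y n) x) sums dunkl_op k a b e (dunkl_series y) x"
    unfolding dunkl_op_eq
    by (intro sums_add sums_sum sums_divide sums_mult sums_diff dunkl_series_sums)
  moreover have "dunkl_op k a b e (dunkl_comp y 0) x = 0" by (simp add: dunkl_op_const)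
  ultimately have "(\<lambda>n. (e \<bullet> y) * dunkl_comp y n x) sums dunkl_op k a b e (dunkl_series y) x"
    using sums_Suc_iff[of "\<lambda>n. dunkl_op k a b e (dunkl_comp y n) x"]
    by (simp add: dunkl_op_dunkl_comp_Suc[OF x])
  moreover have "(\<lambda>n. (e \<bullet> y) * dunkl_comp y n x) sums ((e \<bullet> y) * dunkl_series y x)"
    by (intro sums_mult dunkl_series_sums)
  ultimately show ?thesis by (rule sums_unique2)
qed

lemma dunkl_kernel_eq_dunkl_series: "dunkl_kernel k a b x y = dunkl_series y x"
proof (rule dunkl_kernel_eqI)
  show "dunkl_series y 0 = 1"
    unfolding dunkl_series_def dunkl_comp_at_0 by (subst suminf_finite[of "{0}"]) auto
  show "dunkl_eigen y (dunkl_series y)"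
    unfolding dunkl_eigen_def using dunkl_series_has_derivative(2)
    by (auto simp: dunkl_op_dunkl_series intro: differentiableI)
qed

end

section \<open>The measures on the interval and on the square\<close>

definition nu_measure :: "real \<Rightarrow> real measure" where
  "nu_measure a = density lborel (\<lambda>u. ennreal (indicator {-1..1} u * nu_density a u))"

lemma nu_density_measurable [measurable]: "nu_density a \<in> borel_measurable borel"
  unfolding nu_density_def[abs_def] by measurable

lemma nu_density_nonneg: "a > 0 \<Longrightarrow> 0 \<le> nu_density a u"
  by (simp add: nu_density_def)

lemma nu_density_uminus: "nu_density a (- u) = nu_density a u"
  by (simp add: nu_density_def)

lemma sets_nu_measure [measurable_cong, simp]: "sets (nu_measure a) = sets borel"
  by (simp add: nu_measure_def)

lemma space_nu_measure [simp]: "space (nu_measure a) = UNIV"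
  by (simp add: nu_measure_def)

lemma one_minus_square_powr_has_integral:
  fixes a :: real
  assumes "a > 0"
  shows "((\<lambda>u. (1 - u\<^sup>2) powr (a - 1)) has_integral 2 * 4 powr (a - 1) * Beta a a) {-1..1}"
proof -
  let ?h = "\<lambda>u :: real. (1/2) *\<^sub>R u + 1/2"
  have "((\<lambda>u. ?h u powr (a - 1) * (1 - ?h u) powr (a - 1)) has_integral (Beta a a /\<^sub>R (1/2) ^ DIM(real)))
      (cbox ((0 - 1/2) /\<^sub>R (1/2)) ((1 - 1/2) /\<^sub>R (1/2)))"
    using has_integral_Beta_real[OF assms assms] by (intro has_integral_affinity') auto
  then have "((\<lambda>u. ?h u powr (a - 1) * (1 - ?h u) powr (a - 1)) has_integral (2 * Beta a a)) {-1..1}"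
    by (simp add: mult.commute)
  then have scaled: "((\<lambda>u. 4 powr (a - 1) * (?h u powr (a - 1) * (1 - ?h u) powr (a - 1)))
      has_integral (4 powr (a - 1) * (2 * Beta a a))) {-1..1}"
    by (rule has_integral_mult_right)
  have "4 powr (a - 1) * (?h u powr (a - 1) * (1 - ?h u) powr (a - 1)) = (1 - u\<^sup>2) powr (a - 1)"
    if "u \<in> {-1..1}" for u
  proof -
    have "4 powr (a - 1) * (?h u powr (a - 1) * (1 - ?h u) powr (a - 1))
        = (4 * (?h u * (1 - ?h u))) powr (a - 1)"
      using that by (subst powr_mult, simp, simp, subst powr_mult) auto
    also have "4 * (?h u * (1 - ?h u)) = 1 - u\<^sup>2"
      by (simp add: field_simps power2_eq_square)
    finally show ?thesis .
  qed
  from has_integral_eq[OF this scaled] show ?thesis by (simp add: mult_ac)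
qed

lemma Gamma_legendre_duplication_real:
  assumes "a > 0"
  shows "Gamma a * Gamma (a + 1/2) = exp ((1 - 2 * a) * ln 2) * sqrt pi * Gamma (2 * a :: real)"
proof -
  have "complex_of_real a \<notin> \<int>\<^sub>\<le>\<^sub>0" "complex_of_real a + 1/2 \<notin> \<int>\<^sub>\<le>\<^sub>0"
    using assms by (auto elim!: nonpos_Ints_cases simp: complex_eq_iff)
  then have "complex_of_real (Gamma a * Gamma (a + 1/2))
      = complex_of_real (exp ((1 - 2 * a) * ln 2) * sqrt pi * Gamma (2 * a))"
    using Gamma_legendre_duplication[of "complex_of_real a"]
    by (simp add: Gamma_complex_of_real[symmetric] exp_of_real[symmetric])
  then show ?thesis by (simp only: of_real_eq_iff)
qed

lemma nu_density_has_integral: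
  assumes a: "a > 0"
  shows "(nu_density a has_integral 1) {-1..1}"
proof -
  define K where "K = Gamma (a + 1/2) / (sqrt pi * Gamma a)"
  have pos: "Gamma a > 0" "Gamma (2 * a) > 0" "sqrt pi > 0" using a by auto
  have "(4::real) powr (a - 1) * (2 * exp ((1 - 2 * a) * ln 2))
      = exp ((a - 1) * (2 * ln 2)) * (exp (ln 2) * exp ((1 - 2 * a) * ln 2))"
    using ln_realpow[of 2 2] by (simp add: powr_def)
  also have "\<dots> = 1"
    by (simp add: exp_add[symmetric] del: exp_ln) (simp add: algebra_simps)
  finally have power_of_2: "(4::real) powr (a - 1) * (2 * exp ((1 - 2 * a) * ln 2)) = 1" .
  have "K * (2 * 4 powr (a - 1) * Beta a a)
      = (Gamma a * Gamma (a + 1/2)) * 4 powr (a - 1) * 2 / (sqrt pi * Gamma (2 * a))"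
    using pos by (simp add: K_def Beta_def field_simps)
  also have "\<dots> = (4::real) powr (a - 1) * (2 * exp ((1 - 2 * a) * ln 2))"
    unfolding Gamma_legendre_duplication_real[OF a] using pos by (simp add: field_simps)
  finally have total: "K * (2 * 4 powr (a - 1) * Beta a a) = 1" using power_of_2 by simp
  show ?thesis
    using has_integral_mult_right[OF one_minus_square_powr_has_integral[OF a], of K]
    unfolding total unfolding nu_density_def[abs_def] K_def .
qed

lemma prob_space_nu_measure:
  assumes a: "a > 0"
  shows "prob_space (nu_measure a)"
proof
  have "emeasure (nu_measure a) UNIV = (\<integral>\<^sup>+u. ennreal (indicator {-1..1} u * nu_density a u) \<partial>lborel)"
    by (simp add: nu_measure_def emeasure_density)
  also have "\<dots> = 1"
    using nn_integral_has_integral_lebesgue[OF _ nu_density_has_integral[OF a]] nu_density_nonneg[OF a]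
    by simp
  finally show "emeasure (nu_measure a) (space (nu_measure a)) = 1" by simp
qed

lemma AE_nu_measure: "AE u in nu_measure a. u \<in> {-1..1}"
  unfolding nu_measure_def by (subst AE_density) (auto simp: indicator_def)

lemma LINT_nu_measure:
  fixes f :: "real \<Rightarrow> real"
  assumes a: "a > 0" and [measurable]: "f \<in> borel_measurable borel"
  shows "(LINT u|nu_measure a. f u) = (LINT u:{-1..1}|lborel. nu_density a u * f u)"
  unfolding nu_measure_def set_lebesgue_integral_def using nu_density_nonneg[OF a]
  by (subst integral_density) (auto simp: mult_ac)

lemma distr_nu_measure_uminus: "distr (nu_measure a) borel uminus = nu_measure a"
proof -
  let ?f = "\<lambda>u. ennreal (indicator {-1..1} u * nu_density a u)"
  have "nu_measure a = density (distr lborel borel uminus) ?f"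
    by (simp add: nu_measure_def lborel_distr_uminus)
  also have "\<dots> = distr (density lborel (\<lambda>u. ?f (- u))) borel uminus"
    by (subst density_distr) (auto simp: comp_def)
  also have "(\<lambda>u. ?f (- u)) = ?f"
    by (auto simp: nu_density_uminus indicator_def fun_eq_iff)
  finally show ?thesis by (simp add: nu_measure_def)
qed

lemma integrable_nu_measure:
  fixes f :: "real \<Rightarrow> real"
  assumes a: "a > 0" and f: "f \<in> borel_measurable borel" "continuous_on {-1..1} f"
  shows "integrable (nu_measure a) f"
proof -
  interpret prob_space "nu_measure a" by (rule prob_space_nu_measure[OF a])
  have "bounded (f ` {-1..1})" using f(2) by (intro compact_imp_bounded compact_continuous_image) auto
  then obtain C where C: "\<forall>y\<in>f ` {-1..1}. norm y \<le> C" unfolding bounded_iff by blast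
  show ?thesis
  proof (rule integrable_const_bound)
    show "AE u in nu_measure a. norm (f u) \<le> C"
      using AE_nu_measure[of a] by (rule eventually_mono) (use C in auto)
  qed (use f(1) in simp)
qed

lemma nu_measure_by_parts:
  fixes f f' :: "real \<Rightarrow> real"
  assumes a: "a > 0" and [measurable]: "f \<in> borel_measurable borel" "f' \<in> borel_measurable borel"
    and deriv: "\<And>u. u \<in> {-1..1} \<Longrightarrow> (f has_real_derivative f' u) (at u)"
    and cont': "continuous_on {-1..1} f'"
  shows "(LINT u|nu_measure a. - 2 * a * u * f u + (1 - u\<^sup>2) * f' u) = 0"
proof -
  define K where "K = Gamma (a + 1/2) / (sqrt pi * Gamma a)"
  define g where "g u = - 2 * a * u * f u + (1 - u\<^sup>2) * f' u" for u
  have [measurable]: "g \<in> borel_measurable borel" unfolding g_def[abs_def] by measurable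
  have cont: "continuous_on {-1..1} f"
    using deriv by (meson DERIV_continuous_on has_field_derivative_at_within)
  have "integrable (nu_measure a) g"
    by (rule integrable_nu_measure[OF a]) (auto simp: g_def intro!: continuous_intros cont cont')
  then have "set_integrable lborel {-1..1} (\<lambda>u. nu_density a u * g u)"
    unfolding nu_measure_def set_integrable_def using nu_density_nonneg[OF a]
    by (subst (asm) integrable_density) (auto simp: mult_ac)
  then have lborel: "(LINT u:{-1..1}|lborel. nu_density a u * g u)
      = integral {-1..1} (\<lambda>u. nu_density a u * g u)"
    by (rule set_borel_integral_eq_integral(2))
  have "((\<lambda>u. nu_density a u * g u) has_integral
      (K * ((1 - 1\<^sup>2) powr a * f 1) - K * ((1 - (-1)\<^sup>2) powr a * f (-1)))) {-1..1}"
  proof (rule fundamental_theorem_of_calculus_interior)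
    have "continuous_on {-1..1} (\<lambda>u::real. (1 - u\<^sup>2) powr a)"
      using a by (intro continuous_on_powr') (auto intro!: continuous_intros simp: abs_square_le_1 abs_le_iff)
    then show "continuous_on {-1..1} (\<lambda>u. K * ((1 - u\<^sup>2) powr a * f u))"
      by (intro continuous_on_mult continuous_on_const cont)
    fix u :: real assume u: "u \<in> {-1<..<1}"
    then have pos: "1 - u\<^sup>2 > 0" by (simp add: abs_square_less_1 abs_less_iff)
    have "((\<lambda>u. K * ((1 - u\<^sup>2) powr a * f u)) has_real_derivative
        K * ((a * (1 - u\<^sup>2) powr (a - 1) * (- (2 * u))) * f u + (1 - u\<^sup>2) powr a * f' u)) (at u)"
      using pos u deriv[of u]
      by (auto intro!: derivative_eq_intros simp: powr_diff field_simps)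
    also have "(1 - u\<^sup>2) powr a = (1 - u\<^sup>2) powr (a - 1) * (1 - u\<^sup>2)"
      using pos by (simp add: powr_diff)
    also have "K * ((a * (1 - u\<^sup>2) powr (a - 1) * (- (2 * u))) * f u
          + (1 - u\<^sup>2) powr (a - 1) * (1 - u\<^sup>2) * f' u)
        = nu_density a u * g u"
      unfolding nu_density_def K_def[symmetric] g_def by (simp add: algebra_simps)
    finally show "((\<lambda>u. K * ((1 - u\<^sup>2) powr a * f u)) has_vector_derivative nu_density a u * g u) (at u)"
      by (simp add: has_real_derivative_iff_has_vector_derivative)
  qed simp
  then have "integral {-1..1} (\<lambda>u. nu_density a u * g u) = 0"
    by (simp add: integral_unique)
  then show ?thesis using lborel LINT_nu_measure[OF a, of g] by (simp add: g_def)
qed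

definition nu_pair :: "real \<Rightarrow> real \<Rightarrow> (real \<times> real) measure" where
  "nu_pair a b = nu_measure a \<Otimes>\<^sub>M nu_measure b"

abbreviation square :: "(real \<times> real) set" where
  "square \<equiv> {-1..1} \<times> {-1..1}"

lemma sets_nu_pair [measurable_cong, simp]: "sets (nu_pair a b) = sets (borel \<Otimes>\<^sub>M borel)"
  unfolding nu_pair_def by (rule sets_pair_measure_cong) simp_all

lemma space_nu_pair [simp]: "space (nu_pair a b) = UNIV"
  by (simp add: nu_pair_def space_pair_measure)

context multiplicity
begin

sublocale NA: prob_space "nu_measure a" by (rule prob_space_nu_measure[OF a])
sublocale NB: prob_space "nu_measure b" by (rule prob_space_nu_measure[OF b])
sublocale NAB: pair_prob_space "nu_measure a" "nu_measure b" ..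
sublocale NP: prob_space "nu_pair a b"
  unfolding nu_pair_def by (rule NAB.prob_space_axioms)

lemma AE_nu_pair: "AE q in nu_pair a b. q \<in> square"
  unfolding nu_pair_def
proof (rule NAB.AE_pair_measure)
  have "square \<in> sets (nu_measure a \<Otimes>\<^sub>M nu_measure b)" by (intro pair_measureI) auto
  then show "{q \<in> space (nu_measure a \<Otimes>\<^sub>M nu_measure b). q \<in> square} \<in> sets (nu_measure a \<Otimes>\<^sub>M nu_measure b)"
    by (simp add: space_pair_measure)
  show "AE u in nu_measure a. AE v in nu_measure b. (u, v) \<in> square"
    using AE_nu_measure[of a]
    by eventually_elim (use AE_nu_measure[of b] in \<open>eventually_elim, auto\<close>)
qed

lemma integrable_nu_pair:
  fixes f :: "real \<times> real \<Rightarrow> real"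
  assumes f: "f \<in> borel_measurable (borel \<Otimes>\<^sub>M borel)" "continuous_on square f"
  shows "integrable (nu_pair a b) f"
proof -
  have "bounded (f ` square)"
    using f(2) by (intro compact_imp_bounded compact_continuous_image compact_Times) auto
  then obtain C where C: "\<forall>y\<in>f ` square. norm y \<le> C" unfolding bounded_iff by blast
  show ?thesis
  proof (rule NP.integrable_const_bound)
    show "AE q in nu_pair a b. norm (f q) \<le> C"
      using AE_nu_pair by (rule eventually_mono) (use C in auto)
  qed (use f(1) in simp)
qed

lemma LINT_nu_pair_cong:
  fixes f g :: "real \<times> real \<Rightarrow> real"
  assumes "f \<in> borel_measurable (borel \<Otimes>\<^sub>M borel)" "g \<in> borel_measurable (borel \<Otimes>\<^sub>M borel)"
    and "\<And>q. q \<in> square \<Longrightarrow> f q = g q"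
  shows "(LINT q|nu_pair a b. f q) = (LINT q|nu_pair a b. g q)"
  using AE_nu_pair assms by (intro integral_cong_AE) (auto elim!: eventually_mono)

lemma LINT_nu_pair_sign:
  fixes f :: "real \<times> real \<Rightarrow> real"
  assumes e: "e \<in> {1, -1}" and d: "d \<in> {1, -1}" and [measurable]: "f \<in> borel_measurable (borel \<Otimes>\<^sub>M borel)"
  shows "(LINT q|nu_pair a b. f (e * fst q, d * snd q)) = (LINT q|nu_pair a b. f q)"
proof -
  have sign: "distr (nu_measure a) borel ((*) e) = nu_measure a" if "e \<in> {1, -1}" for a e
  proof -
    have "(*) e = (if e = 1 then (\<lambda>u. u) else uminus)" using that by (auto simp: fun_eq_iff)
    then show ?thesis by (simp add: distr_nu_measure_uminus distr_id2)
  qed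
  have "nu_pair a b = distr (nu_measure a) borel ((*) e) \<Otimes>\<^sub>M distr (nu_measure b) borel ((*) d)"
    unfolding sign[OF e] sign[OF d] nu_pair_def ..
  also have "\<dots> = distr (nu_pair a b) (borel \<Otimes>\<^sub>M borel) (\<lambda>(u, v). (e * u, d * v))"
    unfolding nu_pair_def using sign[OF d] NB.sigma_finite_measure_axioms
    by (intro pair_measure_distr) auto
  finally have "(LINT q|nu_pair a b. f q)
      = (LINT q|distr (nu_pair a b) (borel \<Otimes>\<^sub>M borel) (\<lambda>(u, v). (e * u, d * v)). f q)"
    by (rule arg_cong)
  also have "\<dots> = (LINT q|nu_pair a b. f (e * fst q, d * snd q))"
    by (subst integral_distr) (auto simp: case_prod_beta')
  finally show ?thesis ..
qed

lemma nu_pair_by_parts_fst: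
  fixes f f' :: "real \<times> real \<Rightarrow> real"
  assumes [measurable]: "f \<in> borel_measurable (borel \<Otimes>\<^sub>M borel)" "f' \<in> borel_measurable (borel \<Otimes>\<^sub>M borel)"
    and cont: "continuous_on square f" "continuous_on square f'"
    and deriv: "\<And>u v. (u, v) \<in> square \<Longrightarrow> ((\<lambda>u. f (u, v)) has_real_derivative f' (u, v)) (at u)"
  shows "has_bochner_integral (nu_pair a b) (\<lambda>q. - 2 * a * fst q * f q + (1 - (fst q)\<^sup>2) * f' q) 0"
proof -
  define F where "F q = - 2 * a * fst q * f q + (1 - (fst q)\<^sup>2) * f' q" for q
  have [measurable]: "F \<in> borel_measurable (borel \<Otimes>\<^sub>M borel)" unfolding F_def[abs_def] by measurable
  have int: "integrable (nu_pair a b) F"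
    by (rule integrable_nu_pair) (auto simp: F_def intro!: continuous_intros cont)
  then have "integrable (nu_measure a \<Otimes>\<^sub>M nu_measure b) (\<lambda>(u, v). F (u, v))"
    by (simp add: nu_pair_def case_prod_eta)
  from NAB.integral_snd[OF this]
  have "(LINT q|nu_pair a b. F q) = (LINT v|nu_measure b. LINT u|nu_measure a. F (u, v))"
    by (simp add: nu_pair_def case_prod_eta)
  also have "\<dots> = (LINT v|nu_measure b. 0)"
  proof (rule integral_cong_AE)
    show "AE v in nu_measure b. (LINT u|nu_measure a. F (u, v)) = 0"
      using AE_nu_measure[of b]
    proof (rule eventually_mono)
      fix v :: real assume v: "v \<in> {-1..1}"
      have "continuous_on {-1..1} (\<lambda>u. f' (u, v))"
        using v by (intro continuous_on_compose2[OF cont(2)] continuous_intros) auto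
      then have "(LINT u|nu_measure a. - 2 * a * u * f (u, v) + (1 - u\<^sup>2) * f' (u, v)) = 0"
        using v deriv by (intro nu_measure_by_parts[OF a]) auto
      then show "(LINT u|nu_measure a. F (u, v)) = 0" by (simp add: F_def)
    qed
  qed (use NAB.borel_measurable_lebesgue_integral in measurable)
  finally have "has_bochner_integral (nu_pair a b) F 0" using int by (simp add: has_bochner_integral_iff)
  then show ?thesis unfolding F_def[abs_def] .
qed

lemma LINT_nu_pair:
  fixes h :: "real \<times> real \<Rightarrow> real"
  assumes h [measurable]: "h \<in> borel_measurable (borel \<Otimes>\<^sub>M borel)" and int: "integrable (nu_pair a b) h"
  shows "(LINT q|nu_pair a b. h q)
    = (LINT u:{-1..1}|lborel. LINT v:{-1..1}|lborel. nu_density a u * nu_density b v * h (u, v))"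
proof -
  have "(\<lambda>(u, v). h (u, v)) \<in> borel_measurable (borel \<Otimes>\<^sub>M nu_measure b)"
    using h by (simp add: case_prod_eta cong: measurable_cong_sets sets_pair_measure_cong)
  then have [measurable]: "(\<lambda>u. LINT v|nu_measure b. h (u, v)) \<in> borel_measurable borel"
    by (rule NB.borel_measurable_lebesgue_integral)
  have "(LINT q|nu_pair a b. h q) = (LINT u|nu_measure a. LINT v|nu_measure b. h (u, v))"
    using NAB.integral_fst'[of h] int by (simp add: nu_pair_def)
  also have "\<dots> = (LINT u:{-1..1}|lborel. nu_density a u * (LINT v|nu_measure b. h (u, v)))"
    by (rule LINT_nu_measure[OF a]) measurable
  also have "(\<lambda>u. LINT v|nu_measure b. h (u, v)) = (\<lambda>u. LINT v:{-1..1}|lborel. nu_density b v * h (u, v))"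
    by (intro ext LINT_nu_measure[OF b]) measurable
  finally show ?thesis by (simp add: mult.assoc)
qed

end

lemma nu_pair_swap:
  fixes f :: "real \<times> real \<Rightarrow> real"
  assumes "a > 0" "b > 0" and [measurable]: "f \<in> borel_measurable (borel \<Otimes>\<^sub>M borel)"
  shows "(LINT q|nu_pair b a. f (prod.swap q)) = (LINT q|nu_pair a b. f q)"
proof -
  interpret multiplicity a b by unfold_locales (use assms in auto)
  show ?thesis
    unfolding nu_pair_def using NAB.integral_product_swap[of f]
    by (simp add: prod.swap_def case_prod_beta')
qed

lemma (in multiplicity) nu_pair_by_parts_snd:
  fixes f f' :: "real \<times> real \<Rightarrow> real"
  assumes [measurable]: "f \<in> borel_measurable (borel \<Otimes>\<^sub>M borel)" "f' \<in> borel_measurable (borel \<Otimes>\<^sub>M borel)"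
    and cont: "continuous_on square f" "continuous_on square f'"
    and deriv: "\<And>u v. (u, v) \<in> square \<Longrightarrow> ((\<lambda>v. f (u, v)) has_real_derivative f' (u, v)) (at v)"
  shows "has_bochner_integral (nu_pair a b) (\<lambda>q. - 2 * b * snd q * f q + (1 - (snd q)\<^sup>2) * f' q) 0"
proof -
  interpret swapped: multiplicity b a by unfold_locales (rule a b)+
  have swap: "(\<lambda>q. g (prod.swap q)) \<in> borel_measurable (borel \<Otimes>\<^sub>M borel)"
    if "g \<in> borel_measurable (borel \<Otimes>\<^sub>M borel)" for g :: "real \<times> real \<Rightarrow> real"
    using measurable_compose[OF measurable_pair_swap' that] by (simp add: prod.swap_def case_prod_beta')
  have "integrable (nu_pair a b) (\<lambda>q. - 2 * b * snd q * f q + (1 - (snd q)\<^sup>2) * f' q)"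
    by (rule integrable_nu_pair) (auto intro!: continuous_intros cont)
  moreover have "has_bochner_integral (nu_pair b a)
      (\<lambda>q. - 2 * b * fst q * f (prod.swap q) + (1 - (fst q)\<^sup>2) * f' (prod.swap q)) 0"
    using deriv
    by (intro swapped.nu_pair_by_parts_fst swap continuous_on_compose2[OF cont(1)]
        continuous_on_compose2[OF cont(2)] continuous_on_swap) auto
  ultimately show ?thesis
    using nu_pair_swap[OF a b, of "\<lambda>q. - 2 * b * snd q * f q + (1 - (snd q)\<^sup>2) * f' q"]
    by (simp add: has_bochner_integral_iff)
qed

section \<open>The Poisson kernel of the Klein four-group\<close>

lemma tendsto_LINT_dominated:
  fixes s :: "'b :: first_countable_topology \<Rightarrow> 'x \<Rightarrow> real"
  assumes f: "f \<in> borel_measurable M" and g: "integrable M g"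
    and meas: "\<forall>\<^sub>F h in at c. s h \<in> borel_measurable M"
    and bound: "\<forall>\<^sub>F h in at c. AE w in M. norm (s h w) \<le> g w"
    and lim: "AE w in M. ((\<lambda>h. s h w) \<longlongrightarrow> f w) (at c)"
  shows "((\<lambda>h. LINT w|M. s h w) \<longlongrightarrow> (LINT w|M. f w)) (at c)"
  unfolding tendsto_at_iff_sequentially
proof (intro allI impI)
  fix X :: "nat \<Rightarrow> 'b"
  assume "\<forall>i. X i \<in> UNIV - {c}" "X \<longlonglongrightarrow> c"
  then have X: "filterlim X (at c) sequentially" by (simp add: filterlim_at)
  have "\<forall>\<^sub>F i in sequentially. s (X i) \<in> borel_measurable M \<and> (AE w in M. norm (s (X i) w) \<le> g w)"
    using eventually_conj[OF meas bound] X by (rule eventually_compose_filterlim)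
  then obtain N where N: "\<And>i. i \<ge> N \<Longrightarrow> s (X i) \<in> borel_measurable M \<and> (AE w in M. norm (s (X i) w) \<le> g w)"
    unfolding eventually_sequentially by blast
  have "(\<lambda>i. LINT w|M. s (X (i + N)) w) \<longlonglongrightarrow> (LINT w|M. f w)"
  proof (rule integral_dominated_convergence[OF f _ g])
    show "AE w in M. (\<lambda>i. s (X (i + N)) w) \<longlonglongrightarrow> f w"
      using lim
    proof eventually_elim
      case (elim w)
      then show ?case by (intro LIMSEQ_ignore_initial_segment[OF filterlim_compose[OF _ X]])
    qed
  qed (use N in auto)
  then show "((\<lambda>h. LINT w|M. s h w) \<circ> X) \<longlonglongrightarrow> (LINT w|M. f w)"
    unfolding comp_def by (rule LIMSEQ_offset)
qed

lemma has_real_derivative_LINT: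
  fixes f f' :: "real \<Rightarrow> 'x \<Rightarrow> real"
  assumes d: "d > 0" and g: "integrable M g"
    and int: "\<And>R. \<bar>R - R0\<bar> < d \<Longrightarrow> integrable M (f R)"
    and f': "f' R0 \<in> borel_measurable M"
    and deriv: "AE w in M. \<forall>R. \<bar>R - R0\<bar> < d \<longrightarrow>
      ((\<lambda>R. f R w) has_real_derivative f' R w) (at R) \<and> \<bar>f' R w\<bar> \<le> g w"
  shows "((\<lambda>R. LINT w|M. f R w) has_real_derivative (LINT w|M. f' R0 w)) (at R0)"
proof -
  let ?q = "\<lambda>h w. (f (R0 + h) w - f R0 w) / h"
  have near: "\<forall>\<^sub>F h in at 0. h \<noteq> 0 \<and> \<bar>h\<bar> < d"
    using d by (auto simp: eventually_at intro!: exI[of _ d])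
  have int_0: "integrable M (f R0)" using d by (intro int) simp
  have "((\<lambda>h. LINT w|M. ?q h w) \<longlongrightarrow> (LINT w|M. f' R0 w)) (at 0)"
  proof (rule tendsto_LINT_dominated[OF f' g])
    show "\<forall>\<^sub>F h in at 0. ?q h \<in> borel_measurable M"
      using near
    proof eventually_elim
      case (elim h)
      then have "integrable M (f (R0 + h))" by (intro int) simp
      then show ?case using int_0 by measurable
    qed
    show "AE w in M. (\<lambda>h. ?q h w) \<midarrow>0\<rightarrow> f' R0 w"
      using deriv by eventually_elim (use d in \<open>simp add: DERIV_def\<close>)
    show "\<forall>\<^sub>F h in at 0. AE w in M. norm (?q h w) \<le> g w"
      using near
    proof eventually_elim
      case h: (elim h)
      show ?case
        using deriv
      proof eventually_elim
        case (elim w)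
        have "norm (f (R0 + h) w - f R0 w) \<le> g w * norm (R0 + h - R0)"
        proof (rule field_differentiable_bound[where S = "ball R0 d"])
          fix R assume "R \<in> ball R0 d"
          then have "\<bar>R - R0\<bar> < d" by (simp add: dist_real_def abs_minus_commute)
          with elim have "((\<lambda>R. f R w) has_real_derivative f' R w) (at R)" "\<bar>f' R w\<bar> \<le> g w" by blast+
          then show "((\<lambda>R. f R w) has_field_derivative f' R w) (at R within ball R0 d)" "norm (f' R w) \<le> g w"
            by (simp_all add: has_field_derivative_at_within)
        qed (use h d in \<open>auto simp: dist_real_def\<close>)
        then show ?case using h by (simp add: abs_divide divide_le_eq)
      qed
    qed
  qed
  moreover have "\<forall>\<^sub>F h in at 0. (LINT w|M. ?q h w) = ((LINT w|M. f (R0 + h) w) - (LINT w|M. f R0 w)) / h"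
    using near by eventually_elim (simp add: int int_0)
  ultimately show ?thesis unfolding DERIV_def by (rule Lim_transform_eventually)
qed

definition xi_inner :: "complex \<Rightarrow> complex \<Rightarrow> real \<times> real \<Rightarrow> real" where
  "xi_inner X Y q = snd q * (Re X * Re Y) + fst q * (Im X * Im Y)"

lemma xi_inner_measurable [measurable]: "xi_inner X Y \<in> borel_measurable (borel \<Otimes>\<^sub>M borel)"
  unfolding xi_inner_def[abs_def] by measurable

lemma abs_xi_inner_le:
  assumes "q \<in> square"
  shows "\<bar>xi_inner X Y q\<bar> \<le> cmod X * cmod Y"
proof -
  have "\<bar>snd q * (Re X * Re Y)\<bar> \<le> \<bar>Re X\<bar> * \<bar>Re Y\<bar>" "\<bar>fst q * (Im X * Im Y)\<bar> \<le> \<bar>Im X\<bar> * \<bar>Im Y\<bar>"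
    using assms by (auto simp: abs_mult mult_left_le_one_le)
  then have "\<bar>xi_inner X Y q\<bar> \<le> Complex \<bar>Re X\<bar> \<bar>Im X\<bar> \<bullet> Complex \<bar>Re Y\<bar> \<bar>Im Y\<bar>"
    unfolding xi_inner_def inner_complex_def complex.sel by linarith
  also have "\<dots> \<le> cmod X * cmod Y"
    using norm_cauchy_schwarz[of "Complex \<bar>Re X\<bar> \<bar>Im X\<bar>" "Complex \<bar>Re Y\<bar> \<bar>Im Y\<bar>"]
    by (simp add: cmod_def)
  finally show ?thesis .
qed

lemma abs_xi_inner_le_1:
  assumes "q \<in> square" "cmod X \<le> 1" "cmod Y \<le> 1"
  shows "\<bar>xi_inner X Y q\<bar> \<le> 1"
  using abs_xi_inner_le[OF assms(1), of X Y] mult_mono[OF assms(2,3)] by simp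

definition xi_denom :: "complex \<Rightarrow> complex \<Rightarrow> real \<Rightarrow> real \<times> real \<Rightarrow> real" where
  "xi_denom X Y R q = poisson_denom R (xi_inner X Y q)"

lemma xi_denom_measurable [measurable]: "xi_denom X Y R \<in> borel_measurable (borel \<Otimes>\<^sub>M borel)"
  unfolding xi_denom_def[abs_def] poisson_denom_def by measurable

lemma xi_denom_pos:
  assumes "q \<in> square" "cmod X \<le> 1" "cmod Y \<le> 1" "\<bar>R\<bar> < 1"
  shows "0 < xi_denom X Y R q"
  unfolding xi_denom_def using abs_xi_inner_le_1[OF assms(1-3)] assms(4) by (rule poisson_denom_pos)

lemma continuous_on_xi_inner [continuous_intros]:
  "continuous_on S f \<Longrightarrow> continuous_on S (\<lambda>q. xi_inner X Y (f q))"
  unfolding xi_inner_def by (intro continuous_intros)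

lemma continuous_on_xi_denom_powr [continuous_intros]:
  assumes "cmod X \<le> 1" "cmod Y \<le> 1" "\<bar>R\<bar> < 1"
  shows "continuous_on square (\<lambda>q. xi_denom X Y R q powr e)"
proof -
  have "continuous_on square (xi_denom X Y R)"
    unfolding xi_denom_def[abs_def] poisson_denom_def by (intro continuous_intros)
  then show ?thesis
    using xi_denom_pos[OF _ assms]
    by (intro continuous_on_powr continuous_on_const) (auto simp: less_imp_neq[symmetric])
qed

context multiplicity
begin

definition gegenbauer_int :: "(real \<times> real \<Rightarrow> real) \<Rightarrow> complex \<Rightarrow> complex \<Rightarrow> real \<Rightarrow> real" where
  "gegenbauer_int g X Y R = (LINT q|nu_pair a b. g q * xi_denom X Y R q powr (- lam - 1))"

text \<open>Up to an elementary factor, \<open>poisson_int X Y R\<close> is Dunkl's Poisson kernel of $I_2$ with multiplicities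
  $(\alpha, \beta)$.\<close>

definition poisson_int :: "complex \<Rightarrow> complex \<Rightarrow> real \<Rightarrow> real" where
  "poisson_int = gegenbauer_int (\<lambda>q. (1 + fst q) * (1 + snd q))"

lemma gegenbauer_int_sign:
  assumes e: "e \<in> {1, -1}" and d: "d \<in> {1, -1}" and [measurable]: "g \<in> borel_measurable (borel \<Otimes>\<^sub>M borel)"
  shows "gegenbauer_int g (Complex (d * Re X) (e * Im X)) Y R
    = gegenbauer_int (\<lambda>q. g (e * fst q, d * snd q)) X Y R"
proof -
  let ?f = "\<lambda>q. g q * xi_denom (Complex (d * Re X) (e * Im X)) Y R q powr (- lam - 1)"
  have "xi_denom (Complex (d * Re X) (e * Im X)) Y R (e * fst q, d * snd q) = xi_denom X Y R q" for q
    using e d by (auto simp: xi_denom_def xi_inner_def)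
  moreover have "(LINT q|nu_pair a b. ?f q) = (LINT q|nu_pair a b. ?f (e * fst q, d * snd q))"
    by (rule LINT_nu_pair_sign[OF e d, symmetric]) measurable
  ultimately show ?thesis by (simp add: gegenbauer_int_def)
qed

lemma poisson_int_flip:
  shows "poisson_int (cnj X) Y R = gegenbauer_int (\<lambda>q. (1 - fst q) * (1 + snd q)) X Y R"
    and "poisson_int (- cnj X) Y R = gegenbauer_int (\<lambda>q. (1 + fst q) * (1 - snd q)) X Y R"
    and "poisson_int (- X) Y R = gegenbauer_int (\<lambda>q. (1 - fst q) * (1 - snd q)) X Y R"
proof -
  have flipped: "Complex (Re X) (- Im X) = cnj X" "Complex (- Re X) (Im X) = - cnj X"
    "Complex (- Re X) (- Im X) = - X" by (simp_all add: complex_eq_iff)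
  let ?g = "\<lambda>q :: real \<times> real. (1 + fst q) * (1 + snd q)"
  show "poisson_int (cnj X) Y R = gegenbauer_int (\<lambda>q. (1 - fst q) * (1 + snd q)) X Y R"
    using gegenbauer_int_sign[of "-1" 1 ?g X Y R] by (simp add: poisson_int_def flipped)
  show "poisson_int (- cnj X) Y R = gegenbauer_int (\<lambda>q. (1 + fst q) * (1 - snd q)) X Y R"
    using gegenbauer_int_sign[of 1 "-1" ?g X Y R] by (simp add: poisson_int_def flipped)
  show "poisson_int (- X) Y R = gegenbauer_int (\<lambda>q. (1 - fst q) * (1 - snd q)) X Y R"
    using gegenbauer_int_sign[of "-1" "-1" ?g X Y R] by (simp add: poisson_int_def flipped)
qed

lemma poisson_int_commute: "poisson_int X Y R = poisson_int Y X R"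
  by (simp add: poisson_int_def gegenbauer_int_def xi_denom_def xi_inner_def mult.commute)

lemma integrable_gegenbauer:
  assumes "cmod X \<le> 1" "cmod Y \<le> 1" "\<bar>R\<bar> < 1"
    and g [measurable]: "g \<in> borel_measurable (borel \<Otimes>\<^sub>M borel)" and "continuous_on square g"
  shows "integrable (nu_pair a b) (\<lambda>q. g q * xi_denom X Y R q powr e)"
  using assms by (intro integrable_nu_pair continuous_intros) measurable

lemma sum_poisson_int:
  assumes "cmod X \<le> 1" "cmod Y \<le> 1" "\<bar>R\<bar> < 1"
  shows "poisson_int X Y R + poisson_int (- X) Y R + poisson_int (cnj X) Y R + poisson_int (- cnj X) Y R
    = 4 * gegenbauer_int (\<lambda>_. 1) X Y R"
proof -
  let ?w = "\<lambda>e d q :: real \<times> real. (1 + e * fst q) * (1 + d * snd q)"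
  let ?Q = "\<lambda>q. xi_denom X Y R q powr (- lam - 1)"
  have int: "integrable (nu_pair a b) (\<lambda>q. ?w e d q * ?Q q)" for e d
    using assms by (intro integrable_gegenbauer continuous_intros) measurable
  have "poisson_int X Y R + poisson_int (- X) Y R + poisson_int (cnj X) Y R + poisson_int (- cnj X) Y R
    = (LINT q|nu_pair a b. ?w 1 1 q * ?Q q) + (LINT q|nu_pair a b. ?w (-1) (-1) q * ?Q q)
      + (LINT q|nu_pair a b. ?w (-1) 1 q * ?Q q) + (LINT q|nu_pair a b. ?w 1 (-1) q * ?Q q)"
    unfolding poisson_int_flip[of X Y R] by (simp add: poisson_int_def gegenbauer_int_def)
  also have "\<dots> = (LINT q|nu_pair a b. ?w 1 1 q * ?Q q + ?w (-1) (-1) q * ?Q q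
      + ?w (-1) 1 q * ?Q q + ?w 1 (-1) q * ?Q q)"
    by (simp only: Bochner_Integration.integral_add Bochner_Integration.integrable_add int)
  also have "\<dots> = (LINT q|nu_pair a b. 4 * (1 * ?Q q))"
    by (rule Bochner_Integration.integral_cong) (simp_all add: algebra_simps)
  finally show ?thesis by (simp add: gegenbauer_int_def)
qed

lemma poisson_int_0:
  assumes "cmod X \<le> 1" "cmod Y \<le> 1"
  shows "poisson_int X Y 0 = 1"
proof -
  have denom_0: "xi_denom X Y 0 q = 1" for X Y q by (simp add: xi_denom_def poisson_denom_def)
  have "gegenbauer_int (\<lambda>_. 1) X Y 0 = 1"
    by (simp add: gegenbauer_int_def denom_0 NP.prob_space[simplified])
  moreover have "poisson_int (- X) Y 0 = poisson_int X Y 0" "poisson_int (cnj X) Y 0 = poisson_int X Y 0"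
    "poisson_int (- cnj X) Y 0 = poisson_int X Y 0"
    by (simp_all add: poisson_int_def gegenbauer_int_def denom_0)
  ultimately show ?thesis using sum_poisson_int[OF assms, of 0] by simp
qed

lemma xi_denom_powr_deriv_radius:
  assumes "q \<in> square" "cmod X \<le> 1" "cmod Y \<le> 1" "\<bar>R\<bar> < 1"
  shows "((\<lambda>R. xi_denom X Y R q powr (- lam - 1)) has_real_derivative
    (- lam - 1) * xi_denom X Y R q powr (- lam - 2) * (2 * R - 2 * xi_inner X Y q)) (at R)"
proof -
  have exponent: "- lam - 1 - of_nat 1 = - lam - 2" by simp
  have "((\<lambda>R. xi_denom X Y R q) has_real_derivative 2 * R - 2 * xi_inner X Y q) (at R)"
    unfolding xi_denom_def poisson_denom_def by (auto intro!: derivative_eq_intros)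
  from DERIV_fun_powr[OF this xi_denom_pos[OF assms], of "- lam - 1"] show ?thesis
    unfolding exponent .
qed

lemma gegenbauer_int_deriv:
  assumes XY: "cmod X \<le> 1" "cmod Y \<le> 1" and R: "\<bar>R\<bar> < 1"
    and g [measurable]: "g \<in> borel_measurable (borel \<Otimes>\<^sub>M borel)" and cont: "continuous_on square g"
  shows "(gegenbauer_int g X Y has_real_derivative (LINT q|nu_pair a b.
     g q * ((- lam - 1) * xi_denom X Y R q powr (- lam - 2) * (2 * R - 2 * xi_inner X Y q)))) (at R)"
  unfolding gegenbauer_int_def
proof (rule has_real_derivative_LINT)
  define r where "r = (1 + \<bar>R\<bar>) / 2"
  define d where "d = (1 - \<bar>R\<bar>) / 2"
  show "d > 0" using R by (simp add: d_def)
  have near: "\<bar>S\<bar> \<le> r" "r < 1" "\<bar>S\<bar> < 1" if "\<bar>S - R\<bar> < d" for S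
    using that R abs_triangle_ineq[of "S - R" R] by (auto simp: d_def r_def)
  let ?C = "(lam + 1) * ((1 - r)\<^sup>2) powr (- lam - 2) * 4"
  show "integrable (nu_pair a b) (\<lambda>q. \<bar>g q\<bar> * ?C)"
    using cont by (intro integrable_mult_left integrable_abs integrable_nu_pair g)
  show "integrable (nu_pair a b) (\<lambda>q. g q * xi_denom X Y S q powr (- lam - 1))" if "\<bar>S - R\<bar> < d" for S
    using XY near[OF that] g cont by (intro integrable_gegenbauer)
  show "(\<lambda>q. g q * ((- lam - 1) * xi_denom X Y R q powr (- lam - 2) * (2 * R - 2 * xi_inner X Y q)))
      \<in> borel_measurable (nu_pair a b)"
    by measurable
  show "AE q in nu_pair a b. \<forall>S. \<bar>S - R\<bar> < d \<longrightarrow>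
      ((\<lambda>R. g q * xi_denom X Y R q powr (- lam - 1)) has_real_derivative
        g q * ((- lam - 1) * xi_denom X Y S q powr (- lam - 2) * (2 * S - 2 * xi_inner X Y q))) (at S) \<and>
      \<bar>g q * ((- lam - 1) * xi_denom X Y S q powr (- lam - 2) * (2 * S - 2 * xi_inner X Y q))\<bar> \<le> \<bar>g q\<bar> * ?C"
    using AE_nu_pair
  proof (rule eventually_mono, intro allI impI conjI)
    fix q S assume q: "q \<in> square" and "\<bar>S - R\<bar> < d"
    note near = near[OF this(2)] and xi = abs_xi_inner_le_1[OF q XY]
    show "((\<lambda>R. g q * xi_denom X Y R q powr (- lam - 1)) has_real_derivative
        g q * ((- lam - 1) * xi_denom X Y S q powr (- lam - 2) * (2 * S - 2 * xi_inner X Y q))) (at S)"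
      by (rule DERIV_cmult[OF xi_denom_powr_deriv_radius[OF q XY near(3)]])
    have "(1 - r)\<^sup>2 \<le> (1 - \<bar>S\<bar>)\<^sup>2" using near by (intro power_mono) auto
    also have "\<dots> \<le> xi_denom X Y S q" unfolding xi_denom_def by (rule poisson_denom_lower[OF xi])
    finally have "xi_denom X Y S q powr (- lam - 2) \<le> ((1 - r)\<^sup>2) powr (- lam - 2)"
      using near lam_pos by (intro powr_mono2') auto
    moreover have "\<bar>2 * S - 2 * xi_inner X Y q\<bar> \<le> 4" "\<bar>- lam - 1\<bar> \<le> lam + 1"
      using xi near lam_pos by auto
    ultimately show "\<bar>g q * ((- lam - 1) * xi_denom X Y S q powr (- lam - 2) * (2 * S - 2 * xi_inner X Y q))\<bar>
        \<le> \<bar>g q\<bar> * ?C"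
      unfolding abs_mult using lam_pos by (intro mult_left_mono mult_mono mult_nonneg_nonneg) auto
  qed
qed

end

lemma poisson_radial_identity:
  fixes a b p s u v R P :: real
  defines "x \<equiv> v * p + u * s"
  defines "D \<equiv> poisson_denom R x" and "N \<equiv> poisson_denom R (p + s)" and "l \<equiv> a + b"
  shows "(l * N + R * (2 * R - 2 * (p + s))) * ((1 + u) * (1 + v) * (D * P))
      + R * N * ((1 + u) * (1 + v) * ((- l - 1) * P * (2 * R - 2 * x)))
    = (1 - R\<^sup>2) * (a * ((1 - u) * (1 + v) * (D * P)) + b * ((1 + u) * (1 - v) * (D * P))
      - (- 2 * a * u * ((1 + v) * (D * P)) + (1 - u\<^sup>2) * ((1 + v) * ((l + 1) * (2 * R * s) * P)))
      - (- 2 * b * v * ((1 + u) * (D * P)) + (1 - v\<^sup>2) * ((1 + u) * ((l + 1) * (2 * R * p) * P))))"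
  unfolding D_def N_def l_def x_def poisson_denom_def by algebra

context multiplicity
begin

lemma xi_denom_powr_deriv:
  assumes q: "(u, v) \<in> square" and XY: "cmod X \<le> 1" "cmod Y \<le> 1" and R: "\<bar>R\<bar> < 1"
  shows "((\<lambda>u. xi_denom X Y R (u, v) powr (- lam - 1)) has_real_derivative
      (lam + 1) * (2 * R * (Im X * Im Y)) * xi_denom X Y R (u, v) powr (- lam - 2)) (at u)"
    and "((\<lambda>v. xi_denom X Y R (u, v) powr (- lam - 1)) has_real_derivative
      (lam + 1) * (2 * R * (Re X * Re Y)) * xi_denom X Y R (u, v) powr (- lam - 2)) (at v)"
proof -
  note pos = xi_denom_pos[OF q XY R]
  have exponent: "- lam - 1 - of_nat 1 = - lam - 2" by simp
  have swap_sign: "(- lam - 1) * P * (- 2 * R * c) = (lam + 1) * (2 * R * c) * P" for P c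
    by (simp add: algebra_simps)
  have "((\<lambda>u. xi_denom X Y R (u, v)) has_real_derivative - 2 * R * (Im X * Im Y)) (at u)"
    unfolding xi_denom_def xi_inner_def poisson_denom_def by (auto intro!: derivative_eq_intros)
  from DERIV_fun_powr[OF this pos, of "- lam - 1"]
  show "((\<lambda>u. xi_denom X Y R (u, v) powr (- lam - 1)) has_real_derivative
      (lam + 1) * (2 * R * (Im X * Im Y)) * xi_denom X Y R (u, v) powr (- lam - 2)) (at u)"
    unfolding exponent swap_sign .
  have "((\<lambda>v. xi_denom X Y R (u, v)) has_real_derivative - 2 * R * (Re X * Re Y)) (at v)"
    unfolding xi_denom_def xi_inner_def poisson_denom_def by (auto intro!: derivative_eq_intros)
  from DERIV_fun_powr[OF this pos, of "- lam - 1"]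
  show "((\<lambda>v. xi_denom X Y R (u, v) powr (- lam - 1)) has_real_derivative
      (lam + 1) * (2 * R * (Re X * Re Y)) * xi_denom X Y R (u, v) powr (- lam - 2)) (at v)"
    unfolding exponent swap_sign .
qed

lemma gegenbauer_by_parts:
  assumes XY: "cmod X \<le> 1" "cmod Y \<le> 1" and R: "\<bar>R\<bar> < 1"
  defines "P \<equiv> \<lambda>q. xi_denom X Y R q powr (- lam - 2)" and "Q \<equiv> \<lambda>q. xi_denom X Y R q powr (- lam - 1)"
  shows "has_bochner_integral (nu_pair a b) (\<lambda>q. - 2 * a * fst q * ((1 + snd q) * Q q)
      + (1 - (fst q)\<^sup>2) * ((1 + snd q) * ((lam + 1) * (2 * R * (Im X * Im Y)) * P q))) 0"
    and "has_bochner_integral (nu_pair a b) (\<lambda>q. - 2 * b * snd q * ((1 + fst q) * Q q)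
      + (1 - (snd q)\<^sup>2) * ((1 + fst q) * ((lam + 1) * (2 * R * (Re X * Re Y)) * P q))) 0"
proof -
  have [measurable]: "P \<in> borel_measurable (borel \<Otimes>\<^sub>M borel)" "Q \<in> borel_measurable (borel \<Otimes>\<^sub>M borel)"
    unfolding P_def Q_def by measurable
  have [continuous_intros]: "continuous_on square P" "continuous_on square Q"
    unfolding P_def Q_def by (intro continuous_intros XY R)+
  have deriv: "((\<lambda>u. Q (u, v)) has_real_derivative (lam + 1) * (2 * R * (Im X * Im Y)) * P (u, v)) (at u)"
    "((\<lambda>v. Q (u, v)) has_real_derivative (lam + 1) * (2 * R * (Re X * Re Y)) * P (u, v)) (at v)"
    if "(u, v) \<in> square" for u v
    unfolding P_def Q_def using xi_denom_powr_deriv[OF that XY R] .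
  show "has_bochner_integral (nu_pair a b) (\<lambda>q. - 2 * a * fst q * ((1 + snd q) * Q q)
      + (1 - (fst q)\<^sup>2) * ((1 + snd q) * ((lam + 1) * (2 * R * (Im X * Im Y)) * P q))) 0"
  proof (rule nu_pair_by_parts_fst)
    show "continuous_on square (\<lambda>q. (1 + snd q) * Q q)"
      "continuous_on square (\<lambda>q. (1 + snd q) * ((lam + 1) * (2 * R * (Im X * Im Y)) * P q))"
      by (intro continuous_intros)+
    show "((\<lambda>u. (1 + snd (u, v)) * Q (u, v)) has_real_derivative
        (1 + snd (u, v)) * ((lam + 1) * (2 * R * (Im X * Im Y)) * P (u, v))) (at u)"
      if "(u, v) \<in> square" for u v
      unfolding snd_conv by (rule DERIV_cmult[OF deriv(1)[OF that]])
  qed measurable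
  show "has_bochner_integral (nu_pair a b) (\<lambda>q. - 2 * b * snd q * ((1 + fst q) * Q q)
      + (1 - (snd q)\<^sup>2) * ((1 + fst q) * ((lam + 1) * (2 * R * (Re X * Re Y)) * P q))) 0"
  proof (rule nu_pair_by_parts_snd)
    show "continuous_on square (\<lambda>q. (1 + fst q) * Q q)"
      "continuous_on square (\<lambda>q. (1 + fst q) * ((lam + 1) * (2 * R * (Re X * Re Y)) * P q))"
      by (intro continuous_intros)+
    show "((\<lambda>v. (1 + fst (u, v)) * Q (u, v)) has_real_derivative
        (1 + fst (u, v)) * ((lam + 1) * (2 * R * (Re X * Re Y)) * P (u, v))) (at v)"
      if "(u, v) \<in> square" for u v
      unfolding fst_conv by (rule DERIV_cmult[OF deriv(2)[OF that]])
  qed measurable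
qed

lemma has_bochner_integral_poisson_int:
  assumes XY: "cmod X \<le> 1" "cmod Y \<le> 1" and R: "\<bar>R\<bar> < 1"
  defines "Q \<equiv> \<lambda>q. xi_denom X Y R q powr (- lam - 1)"
  shows "has_bochner_integral (nu_pair a b) (\<lambda>q. (1 + fst q) * (1 + snd q) * Q q) (poisson_int X Y R)"
    and "has_bochner_integral (nu_pair a b) (\<lambda>q. (1 - fst q) * (1 + snd q) * Q q) (poisson_int (cnj X) Y R)"
    and "has_bochner_integral (nu_pair a b) (\<lambda>q. (1 + fst q) * (1 - snd q) * Q q) (poisson_int (- cnj X) Y R)"
proof -
  have weighted: "has_bochner_integral (nu_pair a b) (\<lambda>q. h q * Q q) (gegenbauer_int h X Y R)"
    if "h \<in> borel_measurable (borel \<Otimes>\<^sub>M borel)" "continuous_on square h" for h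
    unfolding Q_def gegenbauer_int_def
    by (intro has_bochner_integral_integrable integrable_gegenbauer XY R that)
  show "has_bochner_integral (nu_pair a b) (\<lambda>q. (1 + fst q) * (1 + snd q) * Q q) (poisson_int X Y R)"
    "has_bochner_integral (nu_pair a b) (\<lambda>q. (1 - fst q) * (1 + snd q) * Q q) (poisson_int (cnj X) Y R)"
    "has_bochner_integral (nu_pair a b) (\<lambda>q. (1 + fst q) * (1 - snd q) * Q q) (poisson_int (- cnj X) Y R)"
    unfolding poisson_int_flip[of X] unfolding poisson_int_def
    by (rule weighted, measurable, intro continuous_intros)+
qed

text \<open>The radial Dunkl equation of $I_2$: up to the two exact derivatives that \<open>gegenbauer_by_parts\<close> integrates
  to $0$, the two sides agree under the integral.\<close>

lemma poisson_int_radial_integrated: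
  assumes XY: "cmod X \<le> 1" "cmod Y \<le> 1" and R: "\<bar>R\<bar> < 1"
  defines "N \<equiv> poisson_denom R (X \<bullet> Y)"
  shows "(lam * N + R * (2 * R - 2 * (X \<bullet> Y))) * poisson_int X Y R
      + R * N * (LINT q|nu_pair a b. (1 + fst q) * (1 + snd q)
        * ((- lam - 1) * xi_denom X Y R q powr (- lam - 2) * (2 * R - 2 * xi_inner X Y q)))
    = (1 - R\<^sup>2) * (a * poisson_int (cnj X) Y R + b * poisson_int (- cnj X) Y R)"
proof -
  define P Q where "P q = xi_denom X Y R q powr (- lam - 2)"
    and "Q q = xi_denom X Y R q powr (- lam - 1)" for q
  define g dQ :: "real \<times> real \<Rightarrow> real"
    where "g q = (1 + fst q) * (1 + snd q)" and "dQ q = (- lam - 1) * P q * (2 * R - 2 * xi_inner X Y q)" for q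
  define U V where "U q = - 2 * a * fst q * ((1 + snd q) * Q q)
      + (1 - (fst q)\<^sup>2) * ((1 + snd q) * ((lam + 1) * (2 * R * (Im X * Im Y)) * P q))"
    and "V q = - 2 * b * snd q * ((1 + fst q) * Q q)
      + (1 - (snd q)\<^sup>2) * ((1 + fst q) * ((lam + 1) * (2 * R * (Re X * Re Y)) * P q))" for q
  have [measurable]: "P \<in> borel_measurable (borel \<Otimes>\<^sub>M borel)" "Q \<in> borel_measurable (borel \<Otimes>\<^sub>M borel)"
    unfolding P_def[abs_def] Q_def[abs_def] by measurable
  have [continuous_intros]: "continuous_on square P" "continuous_on square Q"
    unfolding P_def[abs_def] Q_def[abs_def] by (intro continuous_intros XY R)+
  have int_weights: "has_bochner_integral (nu_pair a b) (\<lambda>q. g q * Q q) (poisson_int X Y R)"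
    "has_bochner_integral (nu_pair a b) (\<lambda>q. (1 - fst q) * (1 + snd q) * Q q) (poisson_int (cnj X) Y R)"
    "has_bochner_integral (nu_pair a b) (\<lambda>q. (1 + fst q) * (1 - snd q) * Q q) (poisson_int (- cnj X) Y R)"
    unfolding g_def Q_def by (rule has_bochner_integral_poisson_int[OF XY R])+
  have int_dQ: "has_bochner_integral (nu_pair a b) (\<lambda>q. g q * dQ q) (LINT q|nu_pair a b. g q * dQ q)"
    unfolding g_def dQ_def
    by (intro has_bochner_integral_integrable integrable_nu_pair) (measurable, intro continuous_intros)
  define lhs rhs where "lhs q = (lam * N + R * (2 * R - 2 * (X \<bullet> Y))) * (g q * Q q) + R * N * (g q * dQ q)"
    and "rhs q = (1 - R\<^sup>2) * (a * ((1 - fst q) * (1 + snd q) * Q q) + b * ((1 + fst q) * (1 - snd q) * Q q)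
      - U q - V q)" for q
  have left: "has_bochner_integral (nu_pair a b) lhs ((lam * N + R * (2 * R - 2 * (X \<bullet> Y))) * poisson_int X Y R
      + R * N * (LINT q|nu_pair a b. g q * dQ q))"
    unfolding lhs_def[abs_def]
    by (intro has_bochner_integral_add has_bochner_integral_mult_right int_weights int_dQ)
  have right: "has_bochner_integral (nu_pair a b) rhs
      ((1 - R\<^sup>2) * (a * poisson_int (cnj X) Y R + b * poisson_int (- cnj X) Y R - 0 - 0))"
    unfolding rhs_def[abs_def] U_def V_def
    by (intro has_bochner_integral_diff has_bochner_integral_add has_bochner_integral_mult_right
        int_weights gegenbauer_by_parts[OF XY R, folded P_def Q_def])
  have "(LINT q|nu_pair a b. lhs q) = (LINT q|nu_pair a b. rhs q)"
  proof (rule LINT_nu_pair_cong)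
    fix q assume q: "q \<in> square"
    have "Q q = xi_denom X Y R q * P q"
      unfolding P_def Q_def using xi_denom_pos[OF q XY R] by (subst powr_mult_base) auto
    then show "lhs q = rhs q"
      unfolding lhs_def rhs_def N_def g_def dQ_def U_def V_def xi_denom_def xi_inner_def inner_complex_def
      by (simp only: poisson_radial_identity)
  qed (unfold lhs_def rhs_def g_def dQ_def U_def V_def, measurable)
  then show ?thesis
    unfolding has_bochner_integral_integral_eq[OF left] has_bochner_integral_integral_eq[OF right]
    unfolding g_def dQ_def P_def by (simp only: diff_zero)
qed

lemma poisson_int_radial:
  assumes XY: "cmod X \<le> 1" "cmod Y \<le> 1" and R: "\<bar>R\<bar> < 1"
  defines "N \<equiv> \<lambda>R. poisson_denom R (X \<bullet> Y)"
  shows "\<exists>D. ((\<lambda>R. N R * poisson_int X Y R) has_real_derivative D) (at R) \<and>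
    lam * (N R * poisson_int X Y R) + R * D
      = (1 - R\<^sup>2) * (a * poisson_int (cnj X) Y R + b * poisson_int (- cnj X) Y R)"
proof -
  define I' where "I' = (LINT q|nu_pair a b. (1 + fst q) * (1 + snd q)
    * ((- lam - 1) * xi_denom X Y R q powr (- lam - 2) * (2 * R - 2 * xi_inner X Y q)))"
  define N' where "N' = 2 * R - 2 * (X \<bullet> Y)"
  have "(poisson_int X Y has_real_derivative I') (at R)"
    unfolding poisson_int_def I'_def
    by (rule gegenbauer_int_deriv[OF XY R]) (measurable, intro continuous_intros)
  then have "((\<lambda>R. N R * poisson_int X Y R) has_real_derivative N' * poisson_int X Y R + N R * I') (at R)"
    unfolding N_def N'_def poisson_denom_def by (auto intro!: derivative_eq_intros)
  moreover have "lam * (N R * poisson_int X Y R) + R * (N' * poisson_int X Y R + N R * I')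
      = (1 - R\<^sup>2) * (a * poisson_int (cnj X) Y R + b * poisson_int (- cnj X) Y R)"
  proof -
    have "lam * (N R * poisson_int X Y R) + R * (N' * poisson_int X Y R + N R * I')
        = (lam * N R + R * N') * poisson_int X Y R + R * N R * I'"
      by (simp only: distrib_left distrib_right mult_ac add_ac)
    also have "\<dots> = (1 - R\<^sup>2) * (a * poisson_int (cnj X) Y R + b * poisson_int (- cnj X) Y R)"
      unfolding N_def N'_def I'_def by (rule poisson_int_radial_integrated[OF XY R])
    finally show ?thesis .
  qed
  ultimately show ?thesis by blast
qed

end

section \<open>The generating function in closed form\<close>

context dihedral
begin

lemma abs_power_k_less_1: "\<bar>t\<bar> < 1 \<Longrightarrow> \<bar>t ^ k\<bar> < (1 :: real)"
  by (simp add: power_abs power_less_one_iff)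

lemma norm_power_k: "cmod x = 1 \<Longrightarrow> cmod (x ^ k) \<le> 1"
  by (simp add: norm_power)

text \<open>The variable \<open>t\<close> is the Poisson radius $\rho$, and \<open>poisson_scale t\<close> $= 2\rho/(1+\rho^2)$ is the argument
  of the generating function.\<close>

definition closed_num :: "complex \<Rightarrow> complex \<Rightarrow> real \<Rightarrow> real" where
  "closed_num y x t = (1 + t\<^sup>2) powr (real k * lam)
     * (poisson_denom (t ^ k) (x ^ k \<bullet> y ^ k) * poisson_int (x ^ k) (y ^ k) (t ^ k))"

definition closed_form :: "complex \<Rightarrow> real \<Rightarrow> complex \<Rightarrow> real" where
  "closed_form y t x = closed_num y x t / (1 - poisson_scale t * (x \<bullet> y))"

definition closed_factor :: "real \<Rightarrow> real" where
  "closed_factor t = (1 + t\<^sup>2) powr (real k * lam) * (real k * ((1 + t\<^sup>2) * (1 - (t ^ k)\<^sup>2) / (1 - t\<^sup>2)))"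

lemma closed_form_commute: "closed_form y t x = closed_form x t y"
  by (simp add: closed_form_def closed_num_def poisson_int_commute[of "x ^ k"] inner_commute)

lemma poisson_scale_inner_less_1:
  assumes "cmod x = 1" "cmod y = 1" "\<bar>t\<bar> < 1"
  shows "1 - poisson_scale t * (x \<bullet> y) > 0"
  using Cauchy_Schwarz_ineq2[of x y] assms by (intro one_minus_poisson_scale_pos) auto

lemma closed_form_0:
  assumes "cmod x = 1" "cmod y = 1"
  shows "closed_form y 0 x = 1"
  using assms by (simp add: closed_form_def closed_num_def poisson_scale_def poisson_denom_def
      power_0_left poisson_int_0[OF norm_power_k norm_power_k])

lemma sum_closed_form_rot:
  assumes x: "cmod x = 1" and y: "cmod y = 1" and t: "\<bar>t\<bar> < 1"
  shows "(\<Sum>i<k. closed_form y t (rot (2 * int i) x)) = closed_factor t * poisson_int (x ^ k) (y ^ k) (t ^ k)"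
proof -
  let ?u = "x * cnj y" and ?w = "\<lambda>i. cis (2 * pi * real i / real k)"
  let ?N = "poisson_denom (t ^ k) (x ^ k \<bullet> y ^ k)"
  have u: "cmod ?u = 1" using x y by (simp add: norm_mult)
  have u_power: "Re (?u ^ k) = x ^ k \<bullet> y ^ k" by (simp add: power_mult_distrib inner_eq_Re)
  then have "\<bar>x ^ k \<bullet> y ^ k\<bar> \<le> 1" using abs_Re_le_1[of "?u ^ k"] u by (simp add: norm_power)
  then have N: "?N > 0" using abs_power_k_less_1[OF t] by (rule poisson_denom_pos)
  have "rot (2 * int i) x \<bullet> y = Re (?u * ?w i)" for i
    unfolding inner_eq_Re rot_def zeta_even by (simp only: mult.assoc mult.commute[of "cnj y"])
  then have "closed_form y t (rot (2 * int i) x)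
      = closed_num y x t * (1 / (1 - poisson_scale t * Re (?u * ?w i)))" for i
    by (simp add: closed_form_def closed_num_def rot_power)
  then have "(\<Sum>i<k. closed_form y t (rot (2 * int i) x))
      = closed_num y x t * (\<Sum>i<k. 1 / (1 - poisson_scale t * Re (?u * ?w i)))"
    by (simp only: sum_distrib_left)
  also have "\<dots> = closed_factor t * poisson_int (x ^ k) (y ^ k) (t ^ k)"
    unfolding sum_inverse_one_minus_poisson_scale[OF k_pos(1) u t] u_power
    using N by (simp add: closed_num_def closed_factor_def)
  finally show ?thesis .
qed

lemma sum_closed_form_cosets:
  assumes x: "cmod x = 1" and y: "cmod y = 1" and t: "\<bar>t\<bar> < 1"
  shows "(\<Sum>i<k. closed_form y t (rot (2 * int i + 1) x))
      = closed_factor t * poisson_int (- (x ^ k)) (y ^ k) (t ^ k)"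
    and "(\<Sum>i<k. closed_form y t (rfl (2 * int i) x))
      = closed_factor t * poisson_int (cnj (x ^ k)) (y ^ k) (t ^ k)"
    and "(\<Sum>i<k. closed_form y t (rfl (2 * int i + 1) x))
      = closed_factor t * poisson_int (- cnj (x ^ k)) (y ^ k) (t ^ k)"
  using sum_closed_form_rot[of "rot 1 x" y t] sum_closed_form_rot[of "rfl 0 x" y t]
    sum_closed_form_rot[of "rfl 1 x" y t] x y t
  by (simp_all add: rot_rot rot_rfl rot_power rfl_power del: complex_cnj_power)

lemma sum_kappa_closed_form_rfl:
  assumes "cmod x = 1" "cmod y = 1" "\<bar>t\<bar> < 1"
  shows "(\<Sum>j<2*k. kappa (int j) * closed_form y t (rfl (int j) x)) = closed_factor t *
    (a * poisson_int (cnj (x ^ k)) (y ^ k) (t ^ k) + b * poisson_int (- cnj (x ^ k)) (y ^ k) (t ^ k))"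
proof -
  have "(\<Sum>j<2*k. kappa (int j) * closed_form y t (rfl (int j) x))
      = a * (\<Sum>i<k. closed_form y t (rfl (2 * int i) x)) + b * (\<Sum>i<k. closed_form y t (rfl (2 * int i + 1) x))"
    using sum_even_odd[of "\<lambda>j. kappa j * closed_form y t (rfl j x)" k]
    by (simp add: kappa_def sum.distrib sum_distrib_left)
  then show ?thesis unfolding sum_closed_form_cosets[OF assms] by (simp add: algebra_simps)
qed

lemma orbit_sum_closed_form:
  assumes x: "cmod x = 1" and y: "cmod y = 1" and t: "\<bar>t\<bar> < 1"
  shows "orbit_sum (closed_form y t) x = 4 * (closed_factor t * gegenbauer_int (\<lambda>_. 1) (x ^ k) (y ^ k) (t ^ k))"
proof -
  let ?P = "\<lambda>X. poisson_int X (y ^ k) (t ^ k)"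
  have "orbit_sum (closed_form y t) x
      = closed_factor t * (?P (x ^ k) + ?P (- (x ^ k)) + ?P (cnj (x ^ k)) + ?P (- cnj (x ^ k)))"
    using sum_even_odd[of "\<lambda>j. closed_form y t (rot j x) + closed_form y t (rfl j x)" k]
      sum_closed_form_rot[OF assms] sum_closed_form_cosets[OF assms]
    by (simp add: orbit_sum_def sum.distrib algebra_simps del: complex_cnj_power)
  then show ?thesis
    unfolding sum_poisson_int[OF norm_power_k[OF x] norm_power_k[OF y] abs_power_k_less_1[OF t]] by simp
qed

lemma closed_num_has_derivative:
  assumes x: "cmod x = 1" and y: "cmod y = 1" and t: "\<bar>t\<bar> < 1"
  shows "\<exists>D. (closed_num y x has_real_derivative D) (at t) \<and>
    t * (1 + t\<^sup>2) * D + real k * lam * (1 - t\<^sup>2) * closed_num y x t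
      = (1 - t\<^sup>2) * (\<Sum>j<2*k. kappa (int j) * closed_form y t (rfl (int j) x))"
proof -
  define W where "W t = (1 + t\<^sup>2) powr (real k * lam)" for t :: real
  define H where "H R = poisson_denom R (x ^ k \<bullet> y ^ k) * poisson_int (x ^ k) (y ^ k) R" for R
  define rhs where "rhs = a * poisson_int (cnj (x ^ k)) (y ^ k) (t ^ k)
    + b * poisson_int (- cnj (x ^ k)) (y ^ k) (t ^ k)"
  obtain H' where H': "(H has_real_derivative H') (at (t ^ k))"
    and radial: "lam * H (t ^ k) + t ^ k * H' = (1 - (t ^ k)\<^sup>2) * rhs"
    using poisson_int_radial[OF norm_power_k[OF x] norm_power_k[OF y] abs_power_k_less_1[OF t]]
    unfolding H_def[abs_def] rhs_def by blast
  have pos: "1 + t\<^sup>2 > 0" by (rule one_plus_square_pos)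
  have t_power: "t * t ^ (k - 1) = t ^ k" using k_pos(1) by (cases k) simp_all
  define D where "D = real k * lam * (2 * t) * W t / (1 + t\<^sup>2) * H (t ^ k) + H' * (real k * t ^ (k - 1)) * W t"
  have "(W has_real_derivative real k * lam * (2 * t) * W t / (1 + t\<^sup>2)) (at t)"
    unfolding W_def[abs_def] using pos by (auto intro!: derivative_eq_intros simp: powr_diff)
  moreover have "((\<lambda>t. t ^ k) has_real_derivative real k * t ^ (k - 1)) (at t)"
    by (auto intro!: derivative_eq_intros)
  note DERIV_chain2[OF H' this]
  ultimately have "((\<lambda>t. W t * H (t ^ k)) has_real_derivative D) (at t)"
    unfolding D_def by (rule DERIV_mult)
  moreover have num: "closed_num y x = (\<lambda>t. W t * H (t ^ k))"
    by (simp add: closed_num_def W_def H_def fun_eq_iff)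
  moreover have "t * (1 + t\<^sup>2) * D + real k * lam * (1 - t\<^sup>2) * (W t * H (t ^ k))
      = (1 - t\<^sup>2) * (closed_factor t * rhs)"
  proof -
    have "t * (1 + t\<^sup>2) * D = real k * lam * 2 * t\<^sup>2 * W t * H (t ^ k)
        + (1 + t\<^sup>2) * H' * real k * (t * t ^ (k - 1)) * W t"
      using pos by (simp add: D_def field_simps power2_eq_square)
    then have "t * (1 + t\<^sup>2) * D + real k * lam * (1 - t\<^sup>2) * (W t * H (t ^ k))
        = W t * real k * (1 + t\<^sup>2) * (lam * H (t ^ k) + t ^ k * H')"
      unfolding t_power by (simp add: algebra_simps)
    also have "\<dots> = (1 - t\<^sup>2) * (closed_factor t * rhs)"
      unfolding radial using t by (simp add: closed_factor_def W_def abs_square_eq_1)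
    finally show ?thesis .
  qed
  ultimately show ?thesis
    unfolding sum_kappa_closed_form_rfl[OF assms] rhs_def num by blast
qed

lemma closed_form_has_derivative:
  assumes x: "cmod x = 1" and y: "cmod y = 1" and t: "\<bar>t\<bar> < 1"
  shows "\<exists>D. ((\<lambda>t. closed_form y t x) has_real_derivative D) (at t) \<and>
    t * (1 + t\<^sup>2) * ((1 - poisson_scale t * (x \<bullet> y)) * D) = (1 - t\<^sup>2) *
      ((real k * lam + 1) * poisson_scale t * (x \<bullet> y) * closed_form y t x - refl_diff (closed_form y t) x)"
proof -
  obtain D where D: "(closed_num y x has_real_derivative D) (at t)"
    and num_eq: "t * (1 + t\<^sup>2) * D + real k * lam * (1 - t\<^sup>2) * closed_num y x t
      = (1 - t\<^sup>2) * (\<Sum>j<2*k. kappa (int j) * closed_form y t (rfl (int j) x))"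
    using closed_num_has_derivative[OF assms] by blast
  define w where "w = 1 - poisson_scale t * (x \<bullet> y)"
  define S where "S = closed_form y t x"
  have w: "w > 0" unfolding w_def by (rule poisson_scale_inner_less_1[OF assms])
  have num: "closed_num y x t = w * S" using w by (simp add: S_def closed_form_def w_def)
  have "((\<lambda>t. closed_form y t x) has_real_derivative
      (D * w - closed_num y x t * (- (poisson_scale' t * (x \<bullet> y)))) / (w * w)) (at t)"
    unfolding closed_form_def w_def using w[unfolded w_def]
    by (auto intro!: derivative_eq_intros D poisson_scale_has_derivative)
  also have "(D * w - closed_num y x t * (- (poisson_scale' t * (x \<bullet> y)))) / (w * w)
      = (D + poisson_scale' t * (x \<bullet> y) * S) / w"
    unfolding num using w by (simp add: field_simps)
  finally have deriv: "((\<lambda>t. closed_form y t x) has_real_derivative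
      (D + poisson_scale' t * (x \<bullet> y) * S) / w) (at t)" .
  have "w * ((D + poisson_scale' t * (x \<bullet> y) * S) / w) = D + poisson_scale' t * (x \<bullet> y) * S"
    using w by simp
  then have "t * (1 + t\<^sup>2) * (w * ((D + poisson_scale' t * (x \<bullet> y) * S) / w))
      = t * (1 + t\<^sup>2) * D + t * (1 + t\<^sup>2) * poisson_scale' t * ((x \<bullet> y) * S)"
    by (simp only: distrib_left mult.assoc)
  also have "t * (1 + t\<^sup>2) * D
      = (1 - t\<^sup>2) * ((\<Sum>j<2*k. kappa (int j) * closed_form y t (rfl (int j) x)) - real k * lam * (w * S))"
    using num_eq unfolding num by (simp add: algebra_simps)
  also have "\<dots> + t * (1 + t\<^sup>2) * poisson_scale' t * ((x \<bullet> y) * S)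
      = (1 - t\<^sup>2) * ((real k * lam + 1) * poisson_scale t * (x \<bullet> y) * S - refl_diff (closed_form y t) x)"
    unfolding poisson_scale'_eq refl_diff_eq S_def[symmetric] w_def by (simp add: algebra_simps)
  finally show ?thesis using deriv unfolding w_def S_def by blast
qed

end

section \<open>The generating function as a power series\<close>

lemma pochhammer_binomial_sums:
  fixes z q :: real
  assumes "\<bar>z\<bar> < 1"
  shows "(\<lambda>n. pochhammer q n / fact n * z ^ n) sums (1 - z) powr (- q)"
proof -
  have "((- q) gchoose n) * (- z) ^ n = pochhammer q n / fact n * z ^ n" for n
    by (cases "even n") (simp_all add: gbinomial_pochhammer)
  then show ?thesis using gen_binomial_real[of "- z" "- q"] assms by simp
qed

definition radial_rate :: "real \<Rightarrow> real" where
  "radial_rate t = (1 - t\<^sup>2) / (t * (1 + t\<^sup>2))"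

lemma radial_rate_nonneg: "0 < t \<Longrightarrow> t \<le> 1 \<Longrightarrow> 0 \<le> radial_rate t"
  unfolding radial_rate_def by (simp add: abs_square_le_1)

lemma eq_radial_rate_mult:
  assumes t: "0 < t" and eq: "t * (1 + t\<^sup>2) * u = (1 - t\<^sup>2) * v"
  shows "u = radial_rate t * v"
proof -
  have "t * (1 + t\<^sup>2) \<noteq> 0" using t one_plus_square_pos[of t] by simp
  with eq show ?thesis by (simp add: radial_rate_def eq_divide_eq mult.commute)
qed

lemma radial_growth_le:
  assumes t: "0 < t" "t \<le> 1" and c: "\<bar>c\<bar> \<le> 1" and G: "1 \<le> 2 * G"
  shows "- (poisson_scale' t * c) + 2 * (radial_rate t * (G * poisson_scale t * c)) \<le> 2 * (2 * G - 1)"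
proof -
  have "poisson_scale' t = radial_rate t * poisson_scale t"
    by (rule eq_radial_rate_mult[OF t(1) poisson_scale'_eq])
  then have "- (poisson_scale' t * c) + 2 * (radial_rate t * (G * poisson_scale t * c))
      = poisson_scale' t * ((2 * G - 1) * c)"
    by (simp add: algebra_simps)
  also have "\<dots> \<le> poisson_scale' t * (2 * G - 1)"
  proof (rule mult_left_mono)
    show "(2 * G - 1) * c \<le> 2 * G - 1" using c G by (intro mult_left_le) auto
    show "0 \<le> poisson_scale' t" using t by (intro poisson_scale'_bounds(1)) auto
  qed
  also have "\<dots> \<le> 2 * (2 * G - 1)"
    using t G by (intro mult_right_mono poisson_scale'_bounds(2)) auto
  finally show ?thesis .
qed

context dihedral
begin

abbreviation gen_order :: real where "gen_order \<equiv> real k * lam + 1"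

lemma gen_order_ge_1: "gen_order \<ge> 1"
  using lam_pos by simp

definition gen_coeff :: "complex \<Rightarrow> nat \<Rightarrow> complex \<Rightarrow> real" where
  "gen_coeff y n x = pochhammer gen_order n * dunkl_comp y n x"

definition gen_series :: "complex \<Rightarrow> real \<Rightarrow> complex \<Rightarrow> real" where
  "gen_series y r x = (\<Sum>n. gen_coeff y n x * r ^ n)"

lemma abs_gen_coeff_le:
  assumes "cmod x = 1" "cmod y = 1"
  shows "\<bar>gen_coeff y n x\<bar> \<le> pochhammer gen_order n / fact n * 5 ^ n"
proof -
  have "0 \<le> pochhammer gen_order n" using gen_order_ge_1 by (intro pochhammer_nonneg) simp
  moreover have "\<bar>dunkl_comp y n x\<bar> \<le> 5 ^ n / fact n" using abs_dunkl_comp_le[of y n x] assms by simp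
  ultimately have "pochhammer gen_order n * \<bar>dunkl_comp y n x\<bar> \<le> pochhammer gen_order n * (5 ^ n / fact n)"
    by (rule mult_left_mono[rotated])
  with \<open>0 \<le> pochhammer gen_order n\<close> show ?thesis by (simp add: gen_coeff_def abs_mult)
qed

lemma gen_series_sums:
  assumes x: "cmod x = 1" and y: "cmod y = 1" and r: "\<bar>r\<bar> < 1/5"
  shows "(\<lambda>n. gen_coeff y n x * r ^ n) sums gen_series y r x"
proof -
  have "summable (\<lambda>n. pochhammer gen_order n / fact n * (5 * \<bar>r\<bar>) ^ n)"
    using pochhammer_binomial_sums[of "5 * \<bar>r\<bar>" gen_order] r by (auto simp: sums_iff)
  then have "summable (\<lambda>n. gen_coeff y n x * r ^ n)"
  proof (rule summable_comparison_test[rotated], intro exI allI impI)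
    fix n
    show "norm (gen_coeff y n x * r ^ n) \<le> pochhammer gen_order n / fact n * (5 * \<bar>r\<bar>) ^ n"
      using mult_right_mono[OF abs_gen_coeff_le[OF x y, of n], of "\<bar>r\<bar> ^ n"]
      by (simp add: abs_mult power_abs power_mult_distrib mult_ac)
  qed
  then show ?thesis unfolding gen_series_def by (rule summable_sums)
qed

lemma gen_series_0:
  assumes "cmod x = 1" "cmod y = 1"
  shows "gen_series y 0 x = 1"
  using sums_unique2[OF gen_series_sums[OF assms, of 0] powser_sums_zero] by (simp add: gen_coeff_def)

lemma gen_coeff_rec:
  "real (Suc n) * gen_coeff y (Suc n) x + refl_diff (gen_coeff y (Suc n)) x
    = (gen_order + real n) * (x \<bullet> y) * gen_coeff y n x"
proof -
  have "real (Suc n) * gen_coeff y (Suc n) x + refl_diff (gen_coeff y (Suc n)) x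
      = pochhammer gen_order (Suc n)
        * (real (Suc n) * dunkl_comp y (Suc n) x + refl_diff (dunkl_comp y (Suc n)) x)"
    unfolding gen_coeff_def[abs_def] refl_diff_cmult by (simp only: algebra_simps)
  then show ?thesis
    unfolding dunkl_comp_rec gen_coeff_def by (simp only: pochhammer_Suc mult_ac)
qed

lemma gen_series_refl_diff_sums:
  assumes "cmod x = 1" "cmod y = 1" "\<bar>r\<bar> < 1/5"
  shows "(\<lambda>n. refl_diff (gen_coeff y (Suc n)) x * r ^ Suc n) sums refl_diff (gen_series y r) x"
proof -
  have "(\<lambda>n. \<Sum>j<2*k. kappa (int j) * (gen_coeff y n x * r ^ n - gen_coeff y n (rfl (int j) x) * r ^ n))
      sums refl_diff (gen_series y r) x"
    unfolding refl_diff_def using assms by (intro sums_sum sums_mult sums_diff gen_series_sums) auto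
  then have "(\<lambda>n. refl_diff (gen_coeff y n) x * r ^ n) sums refl_diff (gen_series y r) x"
    by (simp only: refl_diff_def sum_distrib_right left_diff_distrib mult.assoc)
  moreover have "refl_diff (gen_coeff y 0) x = 0" by (simp add: refl_diff_def gen_coeff_def)
  ultimately show ?thesis by (subst sums_Suc_iff) simp
qed

lemma gen_series_has_derivative:
  assumes x: "cmod x = 1" and y: "cmod y = 1" and r: "\<bar>r\<bar> < 1/5"
  shows "\<exists>D. ((\<lambda>r. gen_series y r x) has_real_derivative D) (at r) \<and>
    r * ((1 - r * (x \<bullet> y)) * D) = gen_order * r * (x \<bullet> y) * gen_series y r x - refl_diff (gen_series y r) x"
proof -
  define D where "D = (\<Sum>n. diffs (\<lambda>n. gen_coeff y n x) n * r ^ n)"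
  have summable: "summable (\<lambda>n. gen_coeff y n x * q ^ n)" if "norm q < 1/5" for q
    using that by (intro sums_summable[OF gen_series_sums[OF x y]]) simp
  have r': "norm r < 1/5" using r by simp
  have deriv: "((\<lambda>r. gen_series y r x) has_real_derivative D) (at r)"
    unfolding gen_series_def D_def by (rule termdiffs_strong'[OF summable r'])
  have D_sums: "(\<lambda>n. real (Suc n) * gen_coeff y (Suc n) x * r ^ n) sums D"
    using summable_sums[OF termdiff_converges[OF r' summable]] by (simp only: D_def diffs_def)
  have rD_sums: "(\<lambda>n. real n * gen_coeff y n x * r ^ n) sums (r * D)"
  proof -
    have "(\<lambda>n. real (Suc n) * gen_coeff y (Suc n) x * r ^ Suc n) sums (r * D)"
      using sums_mult[OF D_sums, of r] by (simp add: mult_ac)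
    then show ?thesis
      using sums_Suc_iff[of "\<lambda>n. real n * gen_coeff y n x * r ^ n" "r * D"] by simp
  qed
  have left: "(\<lambda>n. r * (real (Suc n) * gen_coeff y (Suc n) x * r ^ n)
      + refl_diff (gen_coeff y (Suc n)) x * r ^ Suc n)
      sums (r * D + refl_diff (gen_series y r) x)"
    by (intro sums_add sums_mult D_sums gen_series_refl_diff_sums assms)
  have right: "(\<lambda>n. (r * (x \<bullet> y)) * (gen_order * (gen_coeff y n x * r ^ n) + real n * gen_coeff y n x * r ^ n))
      sums ((r * (x \<bullet> y)) * (gen_order * gen_series y r x + r * D))"
    by (intro sums_mult sums_add rD_sums gen_series_sums[OF assms])
  have "r * (real (Suc n) * gen_coeff y (Suc n) x * r ^ n) + refl_diff (gen_coeff y (Suc n)) x * r ^ Suc n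
      = (r * (x \<bullet> y)) * (gen_order * (gen_coeff y n x * r ^ n) + real n * gen_coeff y n x * r ^ n)" for n
  proof -
    have "r * (real (Suc n) * gen_coeff y (Suc n) x * r ^ n) + refl_diff (gen_coeff y (Suc n)) x * r ^ Suc n
      = (real (Suc n) * gen_coeff y (Suc n) x + refl_diff (gen_coeff y (Suc n)) x) * r ^ Suc n"
      by (simp only: power_Suc ring_distribs mult_ac)
    then show ?thesis unfolding gen_coeff_rec by (simp add: algebra_simps)
  qed
  with left right have "r * D + refl_diff (gen_series y r) x
      = (r * (x \<bullet> y)) * (gen_order * gen_series y r x + r * D)"
    by (simp add: sums_unique2)
  then have "r * ((1 - r * (x \<bullet> y)) * D)
      = gen_order * r * (x \<bullet> y) * gen_series y r x - refl_diff (gen_series y r) x"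
    by (simp add: algebra_simps)
  with deriv show ?thesis by blast
qed

definition gen_defect :: "complex \<Rightarrow> real \<Rightarrow> complex \<Rightarrow> real" where
  "gen_defect y t x = gen_series y (poisson_scale t) x - closed_form y t x"

lemma gen_defect_0: "cmod x = 1 \<Longrightarrow> cmod y = 1 \<Longrightarrow> gen_defect y 0 x = 0"
  by (simp add: gen_defect_def poisson_scale_def gen_series_0 closed_form_0)

lemma gen_defect_has_derivative:
  assumes x: "cmod x = 1" and y: "cmod y = 1" and t: "\<bar>t\<bar> < 1/10"
  shows "\<exists>D. ((\<lambda>t. gen_defect y t x) has_real_derivative D) (at t) \<and>
    t * (1 + t\<^sup>2) * ((1 - poisson_scale t * (x \<bullet> y)) * D)
      = (1 - t\<^sup>2) * (gen_order * poisson_scale t * (x \<bullet> y) * gen_defect y t x - refl_diff (gen_defect y t) x)"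
proof -
  let ?r = "poisson_scale t" and ?r' = "poisson_scale' t"
  let ?w = "1 - ?r * (x \<bullet> y)"
  have r: "\<bar>?r\<bar> < 1/5" using abs_poisson_scale_le[of t] t by linarith
  obtain D where D: "((\<lambda>r. gen_series y r x) has_real_derivative D) (at ?r)"
    and series_eq: "?r * (?w * D)
      = gen_order * ?r * (x \<bullet> y) * gen_series y ?r x - refl_diff (gen_series y ?r) x"
    using gen_series_has_derivative[OF x y r] by blast
  obtain D' where D': "((\<lambda>t. closed_form y t x) has_real_derivative D') (at t)"
    and closed_eq: "t * (1 + t\<^sup>2) * (?w * D')
      = (1 - t\<^sup>2) * (gen_order * ?r * (x \<bullet> y) * closed_form y t x - refl_diff (closed_form y t) x)"
    using closed_form_has_derivative[OF x y, of t] t by auto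
  have "((\<lambda>t. gen_defect y t x) has_real_derivative D * ?r' - D') (at t)"
    unfolding gen_defect_def
    by (intro DERIV_diff D' DERIV_chain2[where f = "\<lambda>r. gen_series y r x" and g = poisson_scale]
        D poisson_scale_has_derivative)
  moreover have "t * (1 + t\<^sup>2) * (?w * (D * ?r' - D'))
      = (1 - t\<^sup>2) * (gen_order * ?r * (x \<bullet> y) * gen_defect y t x - refl_diff (gen_defect y t) x)"
  proof -
    have "t * (1 + t\<^sup>2) * (?w * (D * ?r' - D')) = (t * (1 + t\<^sup>2) * ?r') * (?w * D) - t * (1 + t\<^sup>2) * (?w * D')"
      by (simp only: right_diff_distrib mult_ac)
    also have "\<dots> = (1 - t\<^sup>2) * (?r * (?w * D)) - t * (1 + t\<^sup>2) * (?w * D')"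
      unfolding poisson_scale'_eq by (simp only: mult_ac)
    finally show ?thesis
      unfolding series_eq closed_eq gen_defect_def[abs_def] refl_diff_diff by (simp add: algebra_simps)
  qed
  ultimately show ?thesis by blast
qed

lemma gen_defect_radial_system:
  assumes x: "cmod x = 1" and y: "cmod y = 1" and t: "0 < t" "t < 1/10"
  defines "D \<equiv> deriv (\<lambda>t. gen_defect y t x) t"
  shows "((\<lambda>t. gen_defect y t x) has_real_derivative D) (at t)"
    and "(1 - poisson_scale t * (x \<bullet> y)) * D
      = radial_rate t * (gen_order * poisson_scale t * (x \<bullet> y)) * gen_defect y t x
        - radial_rate t * refl_diff (gen_defect y t) x"
proof -
  obtain D' where D': "((\<lambda>t. gen_defect y t x) has_real_derivative D') (at t)"
    and system: "t * (1 + t\<^sup>2) * ((1 - poisson_scale t * (x \<bullet> y)) * D') = (1 - t\<^sup>2) *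
      (gen_order * poisson_scale t * (x \<bullet> y) * gen_defect y t x - refl_diff (gen_defect y t) x)"
    using gen_defect_has_derivative[OF x y, of t] t by auto
  have "D = D'" unfolding D_def using D' by (rule DERIV_imp_deriv)
  then show "((\<lambda>t. gen_defect y t x) has_real_derivative D) (at t)" using D' by simp
  show "(1 - poisson_scale t * (x \<bullet> y)) * D
      = radial_rate t * (gen_order * poisson_scale t * (x \<bullet> y)) * gen_defect y t x
        - radial_rate t * refl_diff (gen_defect y t) x"
    using eq_radial_rate_mult[OF t(1) system] \<open>D = D'\<close> by (simp add: right_diff_distrib)
qed

lemma continuous_on_gen_defect:
  assumes "cmod x = 1" "cmod y = 1" "t < 1/10"
  shows "continuous_on {0..t} (\<lambda>s. gen_defect y s x)"
proof (intro continuous_at_imp_continuous_on ballI)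
  fix s assume "s \<in> {0..t}"
  then have "\<bar>s\<bar> < 1/10" using assms(3) by simp
  then show "isCont (\<lambda>s. gen_defect y s x) s"
    using gen_defect_has_derivative[OF assms(1,2)] DERIV_isCont by blast
qed

lemma gen_series_eq_closed_form:
  assumes x: "cmod x = 1" and y: "cmod y = 1" and t: "0 \<le> t" "t < 1/10"
  shows "gen_series y (poisson_scale t) x = closed_form y t x"
proof -
  let ?F = "gen_defect y" and ?w = "\<lambda>t p. 1 - poisson_scale t * (p \<bullet> y)"
  have p: "cmod p = 1" if "p \<in> orbit x" for p using norm_orbit[OF that] x by simp
  have inner: "\<bar>p \<bullet> y\<bar> \<le> 1" if "p \<in> orbit x" for p
    using Cauchy_Schwarz_ineq2[of p y] p[OF that] y by simp
  have "?F t x = 0"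
  proof (rule radial_system_eq_0[where F = ?F and F' = "\<lambda>s p. deriv (\<lambda>s. ?F s p) s" and w = ?w
      and w' = "\<lambda>s p. - (poisson_scale' s * (p \<bullet> y))" and e = radial_rate
      and g = "\<lambda>s p. radial_rate s * (gen_order * poisson_scale s * (p \<bullet> y))"
      and C = "2 * (2 * gen_order - 1)" and d = "1/2"])
    show "0 \<le> 2 * (2 * gen_order - 1)" using gen_order_ge_1 by simp
    show "continuous_on {0..t} (\<lambda>s. ?F s q)" if "q \<in> orbit x" for q
      by (rule continuous_on_gen_defect[OF p[OF that] y t(2)])
    show "continuous_on {0..t} (\<lambda>s. ?w s p)" for p
      by (intro continuous_intros continuous_at_imp_continuous_on ballI
          DERIV_isCont[OF poisson_scale_has_derivative])
    show "?F 0 q = 0" if "q \<in> orbit x" for q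
      using p[OF that] y by (rule gen_defect_0)
    show "1/2 \<le> ?w s q" if s: "0 \<le> s" "s \<le> t" and q: "q \<in> orbit x" for s q
      using poisson_scale_mult_le[OF inner[OF q], of s] s t by simp
    show "((\<lambda>s. ?F s q) has_real_derivative deriv (\<lambda>s. ?F s q) s) (at s)"
      "?w s q * deriv (\<lambda>s. ?F s q) s = radial_rate s * (gen_order * poisson_scale s * (q \<bullet> y)) * ?F s q
        - radial_rate s * refl_diff (?F s) q" if "0 < s" "s < t" "q \<in> orbit x" for s q
      using gen_defect_radial_system[OF p[OF that(3)] y that(1)] that(2) t by auto
    show "((\<lambda>s. ?w s p) has_real_derivative - (poisson_scale' s * (p \<bullet> y))) (at s)" for s p
      by (auto intro!: derivative_eq_intros poisson_scale_has_derivative)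
    show "0 \<le> radial_rate s" if "0 < s" "s < t" for s
      using that t by (intro radial_rate_nonneg) auto
    show "- (poisson_scale' s * (q \<bullet> y)) + 2 * (radial_rate s * (gen_order * poisson_scale s * (q \<bullet> y)))
        \<le> 2 * (2 * gen_order - 1)" if s: "0 < s" "s < t" and q: "q \<in> orbit x" for s q
      using s t inner[OF q] gen_order_ge_1 by (intro radial_growth_le) auto
  qed (use t in auto)
  then show ?thesis by (simp add: gen_defect_def)
qed

end

section \<open>The Dirichlet distribution on the simplex\<close>

lemma emeasure_lborel_scale_vimage:
  fixes r :: real
  assumes r: "r > 0" and A: "A \<in> sets borel"
  shows "ennreal r * emeasure lborel ((*) r -` A) = emeasure lborel A"
proof -
  have "emeasure lborel A = emeasure (density (distr lborel borel ((*) r)) (\<lambda>_. ennreal \<bar>r\<bar>)) A"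
    using lborel_distr_mult'[of r] r by simp
  also have "\<dots> = ennreal r * emeasure lborel ((*) r -` A)"
    using r A by (simp add: emeasure_density nn_integral_cmult emeasure_distr)
  finally show ?thesis ..
qed

lemma PiM_lborel_scale:
  assumes I: "finite I" and r: "r > 0"
  shows "PiM I (\<lambda>_. lborel) = density (distr (PiM I (\<lambda>_. lborel)) (PiM I (\<lambda>_. lborel)) (\<lambda>x. \<lambda>i\<in>I. r * x i))
    (\<lambda>_. ennreal (r ^ card I))" (is "?M = ?D")
proof -
  interpret product_sigma_finite "\<lambda>_. lborel :: real measure" by standard
  have scale [measurable]: "(\<lambda>x. \<lambda>i\<in>I. r * x i) \<in> ?M \<rightarrow>\<^sub>M ?M" by measurable
  have "?D = ?M"
  proof (rule PiM_eqI[OF I])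
    fix A :: "'a \<Rightarrow> real set" assume A: "\<And>i. i \<in> I \<Longrightarrow> A i \<in> sets lborel"
    then have box: "Pi\<^sub>E I A \<in> sets ?M" using I by (intro sets_PiM_I_finite) auto
    have preimage: "(\<lambda>x. \<lambda>i\<in>I. r * x i) -` Pi\<^sub>E I A \<inter> space ?M = Pi\<^sub>E I (\<lambda>i. (*) r -` A i)"
      by (auto simp: space_PiM PiE_iff)
    have vimage: "(*) r -` A i \<in> sets lborel" if "i \<in> I" for i
      using measurable_sets[of "(*) r" borel borel "A i"] A[OF that] by simp
    have "emeasure ?D (Pi\<^sub>E I A) = ennreal (r ^ card I) * emeasure ?M (Pi\<^sub>E I (\<lambda>i. (*) r -` A i))"
      using box by (simp add: emeasure_density nn_integral_cmult emeasure_distr[OF scale] preimage)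
    also have "\<dots> = (\<Prod>i\<in>I. ennreal r * emeasure lborel ((*) r -` A i))"
      using r vimage by (subst emeasure_PiM[OF I]) (auto simp: prod.distrib ennreal_power)
    also have "\<dots> = (\<Prod>i\<in>I. emeasure lborel (A i))"
      using A r by (intro prod.cong refl emeasure_lborel_scale_vimage) auto
    finally show "emeasure ?D (Pi\<^sub>E I A) = (\<Prod>i\<in>I. emeasure lborel (A i))" .
  qed simp
  then show ?thesis ..
qed

lemma nn_integral_PiM_lborel_scale:
  assumes I: "finite I" and r: "r > 0" and [measurable]: "f \<in> borel_measurable (PiM I (\<lambda>_. lborel))"
  shows "(\<integral>\<^sup>+x. f x \<partial>PiM I (\<lambda>_. lborel))
    = ennreal (r ^ card I) * (\<integral>\<^sup>+x. f (\<lambda>i\<in>I. r * x i) \<partial>PiM I (\<lambda>_. lborel))"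
  by (subst PiM_lborel_scale[OF I r])
    (simp add: nn_integral_density nn_integral_distr nn_integral_cmult)

lemma simplex_ext_measurable [measurable]:
  "(\<lambda>t. simplex_ext n t j) \<in> borel_measurable (PiM {1..n} (\<lambda>_. lborel))" if "j \<le> n"
proof (cases "j = 0")
  case False
  then have "j \<in> {1..n}" using that by auto
  then show ?thesis using False by (simp add: simplex_ext_def)
qed (simp add: simplex_ext_def)

lemma unit_simplex_measurable [measurable]: "unit_simplex n \<in> sets (PiM {1..n} (\<lambda>_. lborel))"
proof -
  have "unit_simplex n = {t \<in> space (PiM {1..n} (\<lambda>_. lborel :: real measure)).
      (\<forall>j\<in>{1..n}. 0 < t j) \<and> (\<Sum>j=1..n. t j) < 1}"
    by (auto simp: unit_simplex_def space_PiM)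
  then show ?thesis by simp
qed

lemma prod_lessThan_Suc_eq_atLeast1: "(\<Prod>j<Suc n. g j) = g 0 * (\<Prod>j=1..n. g j)"
  for g :: "nat \<Rightarrow> 'a :: comm_monoid_mult"
  by (simp add: prod.atLeast1_atMost_eq prod.lessThan_Suc_shift del: prod.lessThan_Suc)

lemma sum_simplex_ext: "(\<Sum>j<Suc n. simplex_ext n t j) = 1"
proof -
  have "(\<Sum>j<Suc n. simplex_ext n t j) = simplex_ext n t 0 + (\<Sum>j=1..n. simplex_ext n t j)"
    by (simp add: sum.atLeast1_atMost_eq sum.lessThan_Suc_shift del: sum.lessThan_Suc)
  also have "(\<Sum>j=1..n. simplex_ext n t j) = (\<Sum>j=1..n. t j)"
    by (intro sum.cong) (auto simp: simplex_ext_def)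
  finally show ?thesis by (simp add: simplex_ext_def)
qed

lemma simplex_ext_pos: "t \<in> unit_simplex n \<Longrightarrow> j \<le> n \<Longrightarrow> 0 < simplex_ext n t j"
  by (auto simp: unit_simplex_def simplex_ext_def)

lemma orthant_prod_eq_simplex_prod:
  fixes f :: "nat \<Rightarrow> real \<Rightarrow> ennreal"
  assumes f: "\<And>j y. y \<le> 0 \<Longrightarrow> f j y = 0" and t: "t \<in> {1..n} \<rightarrow>\<^sub>E UNIV" and r: "r > 0"
  shows "f 0 (r - (\<Sum>j=1..n. r * t j)) * (\<Prod>j=1..n. f j (r * t j))
    = indicator (unit_simplex n) t * (\<Prod>j<Suc n. f j (r * simplex_ext n t j))"
proof -
  have "f 0 (r * simplex_ext n t 0) = f 0 (r - (\<Sum>j=1..n. r * t j))"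
    by (simp add: simplex_ext_def right_diff_distrib sum_distrib_left)
  moreover have "(\<Prod>j=1..n. f j (r * simplex_ext n t j)) = (\<Prod>j=1..n. f j (r * t j))"
    by (intro prod.cong) (auto simp: simplex_ext_def)
  ultimately have prod_eq: "(\<Prod>j<Suc n. f j (r * simplex_ext n t j))
      = f 0 (r - (\<Sum>j=1..n. r * t j)) * (\<Prod>j=1..n. f j (r * t j))"
    by (simp only: prod_lessThan_Suc_eq_atLeast1)
  show ?thesis
  proof (cases "t \<in> unit_simplex n")
    case False
    then consider j where "j \<in> {1..n}" "r * t j \<le> 0" | "r * simplex_ext n t 0 \<le> 0"
      using t r by (auto simp: unit_simplex_def simplex_ext_def mult_le_0_iff not_less)
    then have "(\<Prod>j<Suc n. f j (r * simplex_ext n t j)) = 0"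
    proof cases
      case (1 j)
      then show ?thesis using f[of "r * t j" j]
        by (intro prod_zero bexI[of _ j]) (auto simp: simplex_ext_def)
    next
      case 2
      then show ?thesis using f by (intro prod_zero bexI[of _ 0]) auto
    qed
    then show ?thesis using False by (simp only: prod_eq) simp
  qed (simp only: prod_eq, simp)
qed

lemma orthant_prod_eq_0:
  fixes f :: "nat \<Rightarrow> real \<Rightarrow> ennreal"
  assumes f: "\<And>j y. y \<le> 0 \<Longrightarrow> f j y = 0" and r: "r \<le> 0"
  shows "f 0 (r - (\<Sum>j=1..n. x j)) * (\<Prod>j=1..n. f j (x j)) = 0"
proof (cases "\<forall>j\<in>{1..n}. 0 < x j")
  case True
  then have "0 \<le> (\<Sum>j=1..n. x j)" by (intro sum_nonneg) (simp add: less_imp_le)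
  with r show ?thesis by (simp add: f)
next
  case False
  then obtain j where "j \<in> {1..n}" "x j \<le> 0" by (auto simp: not_less)
  then have "(\<Prod>j=1..n. f j (x j)) = 0" using f by (intro prod_zero bexI[of _ j]) auto
  then show ?thesis by simp
qed

lemma nn_integral_orthant_slice:
  fixes f :: "nat \<Rightarrow> real \<Rightarrow> ennreal"
  assumes [measurable]: "\<And>j. f j \<in> borel_measurable borel" and f: "\<And>j y. y \<le> 0 \<Longrightarrow> f j y = 0"
  shows "(\<integral>\<^sup>+x. f 0 (r - (\<Sum>j=1..n. x j)) * (\<Prod>j=1..n. f j (x j)) \<partial>PiM {1..n} (\<lambda>_. lborel))
    = (\<integral>\<^sup>+t. indicator (unit_simplex n) t * (indicator {0<..} r * (ennreal (r ^ n) *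
        (\<Prod>j<Suc n. f j (r * simplex_ext n t j)))) \<partial>PiM {1..n} (\<lambda>_. lborel))"
    (is "(\<integral>\<^sup>+x. ?G x \<partial>?X) = (\<integral>\<^sup>+t. indicator (unit_simplex n) t * ?H t \<partial>?X)")
proof (cases "r > 0")
  case True
  have "(\<integral>\<^sup>+x. ?G x \<partial>?X)
      = ennreal (r ^ card {1..n}) * (\<integral>\<^sup>+t. ?G (\<lambda>i\<in>{1..n}. r * t i) \<partial>?X)"
    by (rule nn_integral_PiM_lborel_scale) (use True in \<open>simp_all, measurable\<close>)
  also have "\<dots> = ennreal (r ^ n)
      * (\<integral>\<^sup>+t. indicator (unit_simplex n) t * (\<Prod>j<Suc n. f j (r * simplex_ext n t j)) \<partial>?X)"
  proof -
    have "?G (\<lambda>i\<in>{1..n}. r * t i) = indicator (unit_simplex n) t * (\<Prod>j<Suc n. f j (r * simplex_ext n t j))"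
      if "t \<in> space ?X" for t
      using that True by (subst orthant_prod_eq_simplex_prod[OF f, symmetric]) (simp_all add: space_PiM)
    then show ?thesis by (simp only: card_atLeastAtMost diff_Suc_1 cong: nn_integral_cong)
  qed
  also have "\<dots> = (\<integral>\<^sup>+t. indicator (unit_simplex n) t * ?H t \<partial>?X)"
    using True by (subst nn_integral_cmult[symmetric], measurable)
      (simp add: mult_ac del: prod.lessThan_Suc)
  finally show ?thesis .
next
  case False
  then have "(\<integral>\<^sup>+x. ?G x \<partial>?X) = (\<integral>\<^sup>+x. 0 \<partial>?X)"
    by (intro nn_integral_cong orthant_prod_eq_0 f) auto
  also have "\<dots> = (\<integral>\<^sup>+t. indicator (unit_simplex n) t * ?H t \<partial>?X)" using False by simp
  finally show ?thesis .
qed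

text \<open>Polar coordinates $x = r t$ on the orthant, with $r$ the sum of the coordinates.\<close>

lemma prod_nn_integral_eq_simplex_polar:
  fixes f :: "nat \<Rightarrow> real \<Rightarrow> ennreal"
  assumes meas [measurable]: "\<And>j. f j \<in> borel_measurable borel" and f: "\<And>j y. y \<le> 0 \<Longrightarrow> f j y = 0"
  shows "(\<Prod>j<Suc n. \<integral>\<^sup>+y. f j y \<partial>lborel)
    = (\<integral>\<^sup>+t. indicator (unit_simplex n) t * (\<integral>\<^sup>+r. indicator {0<..} r * (ennreal (r ^ n) *
        (\<Prod>j<Suc n. f j (r * simplex_ext n t j))) \<partial>lborel) \<partial>PiM {1..n} (\<lambda>_. lborel))"
proof -
  interpret product_sigma_finite "\<lambda>_. lborel :: real measure" by standard
  let ?X = "PiM {1..n} (\<lambda>_. lborel :: real measure)"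
  interpret X: sigma_finite_measure ?X by (rule sigma_finite) simp
  interpret XL: pair_sigma_finite ?X "lborel :: real measure" by standard
  let ?G = "\<lambda>r x. f 0 (r - (\<Sum>j=1..n. x j)) * (\<Prod>j=1..n. f j (x j))"
  let ?H = "\<lambda>r t. indicator {0<..} r * (ennreal (r ^ n) * (\<Prod>j<Suc n. f j (r * simplex_ext n t j)))"
  have slice: "(\<integral>\<^sup>+x. ?G r x \<partial>?X) = (\<integral>\<^sup>+t. indicator (unit_simplex n) t * ?H r t \<partial>?X)" for r
    by (rule nn_integral_orthant_slice[OF meas f])
  have "(\<Prod>j<Suc n. \<integral>\<^sup>+y. f j y \<partial>lborel) = (\<integral>\<^sup>+y. f 0 y \<partial>lborel) * (\<integral>\<^sup>+x. (\<Prod>j=1..n. f j (x j)) \<partial>?X)"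
    unfolding prod_lessThan_Suc_eq_atLeast1 by (subst product_nn_integral_prod) auto
  also have "\<dots> = (\<integral>\<^sup>+x. (\<integral>\<^sup>+y. f 0 y * (\<Prod>j=1..n. f j (x j)) \<partial>lborel) \<partial>?X)"
    by (simp add: nn_integral_cmult nn_integral_multc)
  also have "\<dots> = (\<integral>\<^sup>+x. (\<integral>\<^sup>+r. ?G r x \<partial>lborel) \<partial>?X)"
  proof (rule nn_integral_cong)
    fix x
    show "(\<integral>\<^sup>+y. f 0 y * (\<Prod>j=1..n. f j (x j)) \<partial>lborel) = (\<integral>\<^sup>+r. ?G r x \<partial>lborel)"
      by (subst nn_integral_real_affine[where c = 1 and t = "- (\<Sum>j=1..n. x j)"]) auto
  qed
  also have "\<dots> = (\<integral>\<^sup>+r. (\<integral>\<^sup>+x. ?G r x \<partial>?X) \<partial>lborel)"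
    by (rule XL.Fubini'[symmetric]) measurable
  also have "\<dots> = (\<integral>\<^sup>+t. (\<integral>\<^sup>+r. indicator (unit_simplex n) t * ?H r t \<partial>lborel) \<partial>?X)"
    unfolding slice by (rule XL.Fubini') measurable
  also have "\<dots> = (\<integral>\<^sup>+t. indicator (unit_simplex n) t * (\<integral>\<^sup>+r. ?H r t \<partial>lborel) \<partial>?X)"
    by (intro nn_integral_cong nn_integral_cmult) measurable
  finally show ?thesis .
qed

definition gamma_kernel :: "real \<Rightarrow> real \<Rightarrow> real \<Rightarrow> real" where
  "gamma_kernel s c y = indicator {0<..} y * (y powr (s - 1) * exp (- (c * y)))"

lemma gamma_kernel_measurable [measurable]: "gamma_kernel s c \<in> borel_measurable borel"
  unfolding gamma_kernel_def[abs_def] by measurable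

lemma gamma_kernel_nonneg: "0 \<le> gamma_kernel s c y"
  by (simp add: gamma_kernel_def)

lemma nn_integral_gamma_kernel:
  assumes s: "s > 0" and c: "c > 0"
  shows "(\<integral>\<^sup>+y. ennreal (gamma_kernel s c y) \<partial>lborel) = ennreal (Gamma s * c powr (- s))"
proof -
  have "(\<integral>\<^sup>+y. ennreal (gamma_kernel s c y) \<partial>lborel)
      = ennreal (1 / c) * (\<integral>\<^sup>+y. ennreal (gamma_kernel s c (y / c)) \<partial>lborel)"
    using c by (subst nn_integral_real_affine[where c = "1 / c" and t = 0]) (auto simp: abs_divide)
  also have "(\<integral>\<^sup>+y. ennreal (gamma_kernel s c (y / c)) \<partial>lborel)
      = (\<integral>\<^sup>+y. ennreal (c powr (1 - s)) * ennreal (indicator {0..} y * y powr (s - 1) / exp y) \<partial>lborel)"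
    using c
    by (intro nn_integral_cong)
      (auto simp: gamma_kernel_def indicator_def powr_divide powr_diff exp_minus field_simps
        zero_less_divide_iff ennreal_mult'[symmetric])
  also have "\<dots> = ennreal (c powr (1 - s)) * ennreal (Gamma s)"
    using s by (subst nn_integral_cmult) (auto simp: Gamma_conv_nn_integral_real)
  also have "ennreal (1 / c) * (ennreal (c powr (1 - s)) * ennreal (Gamma s))
      = ennreal (Gamma s * c powr (- s))"
    using c s by (simp add: ennreal_mult[symmetric] powr_diff powr_minus field_simps)
  finally show ?thesis .
qed

lemma prod_gamma_kernel_simplex:
  assumes t: "t \<in> unit_simplex n" and r: "r > 0"
  shows "r ^ n * (\<Prod>j<Suc n. gamma_kernel (s j) (c j) (r * simplex_ext n t j))
    = (\<Prod>j<Suc n. simplex_ext n t j powr (s j - 1))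
      * gamma_kernel (\<Sum>j<Suc n. s j) (\<Sum>j<Suc n. c j * simplex_ext n t j) r"
proof -
  let ?A = "\<Sum>j<Suc n. s j" and ?W = "\<Prod>j<Suc n. simplex_ext n t j powr (s j - 1)"
  have "(\<Prod>j<Suc n. gamma_kernel (s j) (c j) (r * simplex_ext n t j))
      = (\<Prod>j<Suc n. r powr (s j - 1) * simplex_ext n t j powr (s j - 1) * exp (- (c j * simplex_ext n t j * r)))"
    using simplex_ext_pos[OF t] r
    by (intro prod.cong) (auto simp: gamma_kernel_def powr_mult mult_ac less_Suc_eq_le)
  also have "\<dots> = (\<Prod>j<Suc n. r powr (s j - 1)) * ?W * (\<Prod>j<Suc n. exp (- (c j * simplex_ext n t j * r)))"
    by (simp only: prod.distrib)
  also have "(\<Prod>j<Suc n. exp (- (c j * simplex_ext n t j * r)))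
      = exp (- ((\<Sum>j<Suc n. c j * simplex_ext n t j) * r))"
    by (simp only: exp_sum[symmetric] finite_lessThan sum_negf sum_distrib_right)
  also have "(\<Prod>j<Suc n. r powr (s j - 1)) = r powr (\<Sum>j<Suc n. s j - 1)"
    using r by (simp only: powr_sum)
  also have "(\<Sum>j<Suc n. s j - 1) = ?A - 1 - real n"
    by (simp add: sum_subtractf)
  finally have "r ^ n * (\<Prod>j<Suc n. gamma_kernel (s j) (c j) (r * simplex_ext n t j))
      = ?W * ((r ^ n * r powr (?A - 1 - real n)) * exp (- ((\<Sum>j<Suc n. c j * simplex_ext n t j) * r)))"
    by (simp only: mult_ac)
  also have "r ^ n * r powr (?A - 1 - real n) = r powr (?A - 1)"
    using r by (simp add: powr_realpow[symmetric] powr_add[symmetric] del: sum.lessThan_Suc)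
  finally show ?thesis
    using r by (simp add: gamma_kernel_def del: prod.lessThan_Suc sum.lessThan_Suc)
qed

lemma nn_integral_prod_gamma_kernel_ray:
  fixes s c :: "nat \<Rightarrow> real"
  assumes s: "\<And>j. j \<le> n \<Longrightarrow> s j > 0" and c: "\<And>j. j \<le> n \<Longrightarrow> c j > 0" and t: "t \<in> unit_simplex n"
  defines "A \<equiv> \<Sum>j<Suc n. s j"
  shows "(\<integral>\<^sup>+r. indicator {0<..} r * (ennreal (r ^ n) *
        (\<Prod>j<Suc n. ennreal (gamma_kernel (s j) (c j) (r * simplex_ext n t j)))) \<partial>lborel)
    = ennreal (Gamma A) * ennreal ((\<Prod>j<Suc n. simplex_ext n t j powr (s j - 1))
        * (\<Sum>j<Suc n. c j * simplex_ext n t j) powr (- A))"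
proof -
  define W where "W = (\<Prod>j<Suc n. simplex_ext n t j powr (s j - 1))"
  define S where "S = (\<Sum>j<Suc n. c j * simplex_ext n t j)"
  have A: "A > 0" unfolding A_def by (intro sum_pos) (use s in auto)
  have S: "S > 0"
    unfolding S_def by (intro sum_pos) (use c simplex_ext_pos[OF t] in \<open>auto simp: less_Suc_eq_le\<close>)
  have W: "W \<ge> 0" unfolding W_def by (simp add: prod_nonneg)
  have "indicator {0<..} r
        * (ennreal (r ^ n) * (\<Prod>j<Suc n. ennreal (gamma_kernel (s j) (c j) (r * simplex_ext n t j))))
      = ennreal W * ennreal (gamma_kernel A S r)" for r
  proof (cases "r > 0")
    case True
    have "ennreal (r ^ n) * (\<Prod>j<Suc n. ennreal (gamma_kernel (s j) (c j) (r * simplex_ext n t j)))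
        = ennreal (r ^ n * (\<Prod>j<Suc n. gamma_kernel (s j) (c j) (r * simplex_ext n t j)))"
      using True by (simp only: prod_ennreal gamma_kernel_nonneg ennreal_mult' zero_le_power less_imp_le)
    also have "\<dots> = ennreal W * ennreal (gamma_kernel A S r)"
      unfolding prod_gamma_kernel_simplex[OF t True] using W
      by (simp only: W_def A_def S_def ennreal_mult')
    finally show ?thesis using True by simp
  qed (simp add: gamma_kernel_def)
  then have "(\<integral>\<^sup>+r. indicator {0<..} r * (ennreal (r ^ n) *
        (\<Prod>j<Suc n. ennreal (gamma_kernel (s j) (c j) (r * simplex_ext n t j)))) \<partial>lborel)
      = (\<integral>\<^sup>+r. ennreal W * ennreal (gamma_kernel A S r) \<partial>lborel)"
    by (simp only:)
  also have "\<dots> = ennreal W * ennreal (Gamma A * S powr (- A))"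
    by (subst nn_integral_cmult) (simp_all add: nn_integral_gamma_kernel[OF A S])
  finally show ?thesis
    using A W unfolding W_def S_def
    by (simp add: ennreal_mult[symmetric] mult_ac del: prod.lessThan_Suc sum.lessThan_Suc)
qed

text \<open>The Feynman parametrization: polar coordinates in a product of Gamma integrals.\<close>

lemma nn_integral_simplex_feynman:
  fixes s c :: "nat \<Rightarrow> real"
  assumes s: "\<And>j. j \<le> n \<Longrightarrow> s j > 0" and c: "\<And>j. j \<le> n \<Longrightarrow> c j > 0"
  defines "A \<equiv> \<Sum>j<Suc n. s j"
  shows "(\<integral>\<^sup>+t. ennreal (indicator (unit_simplex n) t * ((\<Prod>j<Suc n. simplex_ext n t j powr (s j - 1))
      * (\<Sum>j<Suc n. c j * simplex_ext n t j) powr (- A))) \<partial>PiM {1..n} (\<lambda>_. lborel))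
    = ennreal ((\<Prod>j<Suc n. Gamma (s j) * c j powr (- s j)) / Gamma A)"
proof -
  let ?X = "PiM {1..n} (\<lambda>_. lborel :: real measure)"
  let ?f = "\<lambda>t. (\<Prod>j<Suc n. simplex_ext n t j powr (s j - 1)) * (\<Sum>j<Suc n. c j * simplex_ext n t j) powr (- A)"
  have A: "A > 0" unfolding A_def by (intro sum_pos) (use s in auto)
  have "ennreal (\<Prod>j<Suc n. Gamma (s j) * c j powr (- s j))
      = (\<Prod>j<Suc n. \<integral>\<^sup>+y. ennreal (gamma_kernel (s j) (c j) y) \<partial>lborel)"
    using s c
    by (subst prod_ennreal[symmetric]) (auto simp: nn_integral_gamma_kernel less_Suc_eq_le intro!: prod.cong)
  also have "\<dots> = (\<integral>\<^sup>+t. indicator (unit_simplex n) t * (ennreal (Gamma A) * ennreal (?f t)) \<partial>?X)"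
  proof (subst prod_nn_integral_eq_simplex_polar)
    show "ennreal (gamma_kernel (s j) (c j) y) = 0" if "y \<le> 0" for j y
      using that by (simp add: gamma_kernel_def)
  next
    show "(\<integral>\<^sup>+t. indicator (unit_simplex n) t * (\<integral>\<^sup>+r. indicator {0<..} r * (ennreal (r ^ n) *
          (\<Prod>j<Suc n. ennreal (gamma_kernel (s j) (c j) (r * simplex_ext n t j)))) \<partial>lborel) \<partial>?X)
        = (\<integral>\<^sup>+t. indicator (unit_simplex n) t * (ennreal (Gamma A) * ennreal (?f t)) \<partial>?X)"
      unfolding A_def using nn_integral_prod_gamma_kernel_ray[OF s c]
      by (intro nn_integral_cong) (simp split: split_indicator del: prod.lessThan_Suc sum.lessThan_Suc)
  qed measurable
  also have "\<dots> = ennreal (Gamma A) * (\<integral>\<^sup>+t. ennreal (indicator (unit_simplex n) t * ?f t) \<partial>?X)"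
    by (subst nn_integral_cmult[symmetric], measurable) (auto simp: indicator_def intro!: nn_integral_cong)
  finally have product: "ennreal (\<Prod>j<Suc n. Gamma (s j) * c j powr (- s j)) = \<dots>" .
  have "(\<integral>\<^sup>+t. ennreal (indicator (unit_simplex n) t * ?f t) \<partial>?X)
      = ennreal (1 / Gamma A) * ennreal (\<Prod>j<Suc n. Gamma (s j) * c j powr (- s j))"
    unfolding product using Gamma_real_pos[OF A] by (simp add: mult.assoc[symmetric] ennreal_mult[symmetric])
  also have "\<dots> = ennreal ((\<Prod>j<Suc n. Gamma (s j) * c j powr (- s j)) / Gamma A)"
    using A by (simp add: ennreal_mult'[symmetric])
  finally show ?thesis .
qed

definition dirichlet_density :: "nat \<Rightarrow> real \<Rightarrow> (nat \<Rightarrow> real) \<Rightarrow> real" where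
  "dirichlet_density n l t = Gamma (real (Suc n) * l) / Gamma l ^ Suc n
     * (indicator (unit_simplex n) t * (\<Prod>j<Suc n. simplex_ext n t j powr (l - 1)))"

definition dirichlet :: "nat \<Rightarrow> real \<Rightarrow> (nat \<Rightarrow> real) measure" where
  "dirichlet n l = density (PiM {1..n} (\<lambda>_. lborel)) (\<lambda>t. ennreal (dirichlet_density n l t))"

lemma dirichlet_density_measurable [measurable]:
  "dirichlet_density n l \<in> borel_measurable (PiM {1..n} (\<lambda>_. lborel))"
  unfolding dirichlet_density_def[abs_def] by measurable

lemma dirichlet_density_nonneg: "l > 0 \<Longrightarrow> 0 \<le> dirichlet_density n l t"
  by (simp add: dirichlet_density_def prod_nonneg del: prod.lessThan_Suc of_nat_Suc)

lemma sets_dirichlet [measurable_cong, simp]: "sets (dirichlet n l) = sets (PiM {1..n} (\<lambda>_. lborel))"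
  by (simp add: dirichlet_def)

lemma AE_dirichlet: "AE t in dirichlet n l. t \<in> unit_simplex n"
proof -
  have "0 < ennreal (dirichlet_density n l t) \<longrightarrow> t \<in> unit_simplex n" for t
    by (auto simp: dirichlet_density_def indicator_def)
  then show ?thesis unfolding dirichlet_def by (subst AE_density, measurable)
qed

lemma prod_Gamma_powr_raise_one:
  fixes l :: real and c :: "nat \<Rightarrow> real"
  assumes l: "l > 0" and c: "\<And>j. j < m \<Longrightarrow> c j > 0" and i: "i < m"
  defines "s \<equiv> \<lambda>j. l + (if j = i then 1 else 0)"
  shows "(\<Prod>j<m. Gamma (s j) * c j powr (- s j)) = Gamma l ^ m * (\<Prod>j<m. c j) powr (- l) * (l / c i)"
proof -
  have Gamma_Suc: "Gamma (l + 1) = l * Gamma l"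
    using l by (intro Gamma_plus1) (auto elim!: nonpos_Ints_cases)
  have "Gamma (s j) * c j powr (- s j) = (Gamma l * c j powr (- l)) * (if j = i then l / c j else 1)"
    if "j < m" for j
    using c[OF that] by (cases "j = i") (simp_all add: s_def Gamma_Suc powr_diff)
  then have "(\<Prod>j<m. Gamma (s j) * c j powr (- s j))
      = (\<Prod>j<m. (Gamma l * c j powr (- l)) * (if j = i then l / c j else 1))"
    by (intro prod.cong) auto
  then show ?thesis
    using i by (simp add: prod.distrib prod.delta prod_powr_distrib)
qed

lemma dirichlet_density_mult_simplex_ext:
  assumes i: "i \<le> n"
  shows "dirichlet_density n l t * (simplex_ext n t i * h) = Gamma (real (Suc n) * l) / Gamma l ^ Suc n *
    (indicator (unit_simplex n) t *
      ((\<Prod>j<Suc n. simplex_ext n t j powr (l + (if j = i then 1 else 0) - 1)) * h))"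
proof (cases "t \<in> unit_simplex n")
  case True
  have "(\<Prod>j<Suc n. simplex_ext n t j powr (l + (if j = i then 1 else 0) - 1))
      = (\<Prod>j<Suc n. simplex_ext n t j powr (l - 1) * (if j = i then simplex_ext n t j else 1))"
  proof (intro prod.cong refl)
    fix j assume "j \<in> {..<Suc n}"
    then have "simplex_ext n t j > 0" by (intro simplex_ext_pos[OF True]) simp
    then show "simplex_ext n t j powr (l + (if j = i then 1 else 0) - 1)
        = simplex_ext n t j powr (l - 1) * (if j = i then simplex_ext n t j else 1)"
      by (cases "j = i") (simp_all add: powr_diff powr_add)
  qed
  also have "\<dots> = (\<Prod>j<Suc n. simplex_ext n t j powr (l - 1)) * simplex_ext n t i"
    using i by (simp add: prod.distrib prod.delta del: prod.lessThan_Suc)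
  finally show ?thesis
    by (simp only: dirichlet_density_def mult_ac)
qed (simp add: dirichlet_density_def)

lemma nn_integral_dirichlet_simplex_ext:
  assumes l: "l > 0" and c: "\<And>j. j \<le> n \<Longrightarrow> c j > 0" and i: "i \<le> n"
  defines "K \<equiv> real (Suc n) * l"
  shows "(\<integral>\<^sup>+t. ennreal (simplex_ext n t i
      * (\<Sum>j<Suc n. c j * simplex_ext n t j) powr (- (K + 1))) \<partial>dirichlet n l)
    = ennreal ((\<Prod>j<Suc n. c j) powr (- l) * ((1 / c i) / real (Suc n)))"
proof -
  let ?S = "\<lambda>t. \<Sum>j<Suc n. c j * simplex_ext n t j" and ?C = "Gamma K / Gamma l ^ Suc n"
  let ?s = "\<lambda>j. l + (if j = i then 1 else 0)"
  have K: "K > 0" using l by (simp add: K_def)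
  have C: "?C > 0" using l K by simp
  have i': "i < Suc n" using i by simp
  have sum_s: "(\<Sum>j<Suc n. ?s j) = K + 1"
    using i' by (simp add: sum.distrib K_def del: sum.lessThan_Suc)
  have density: "ennreal (dirichlet_density n l t) * ennreal (simplex_ext n t i * ?S t powr (- (K + 1)))
      = ennreal ?C * ennreal (indicator (unit_simplex n) t *
          ((\<Prod>j<Suc n. simplex_ext n t j powr (?s j - 1)) * ?S t powr (- (\<Sum>j<Suc n. ?s j))))" for t
    unfolding sum_s
    by (simp only: ennreal_mult'[symmetric] less_imp_le[OF C] dirichlet_density_nonneg[OF l]
        dirichlet_density_mult_simplex_ext[OF i, of l, folded K_def])
  have "(\<integral>\<^sup>+t. ennreal (simplex_ext n t i * ?S t powr (- (K + 1))) \<partial>dirichlet n l)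
      = ennreal ?C * ennreal ((\<Prod>j<Suc n. Gamma (?s j) * c j powr (- ?s j)) / Gamma (\<Sum>j<Suc n. ?s j))"
    unfolding dirichlet_def
  proof (subst nn_integral_density)
    have "?s j > 0" for j using l by simp
    then show "(\<integral>\<^sup>+t. ennreal (dirichlet_density n l t) * ennreal (simplex_ext n t i * ?S t powr (- (K + 1)))
          \<partial>PiM {1..n} (\<lambda>_. lborel))
        = ennreal ?C * ennreal ((\<Prod>j<Suc n. Gamma (?s j) * c j powr (- ?s j)) / Gamma (\<Sum>j<Suc n. ?s j))"
      unfolding density using c
      by (subst nn_integral_cmult, measurable) (subst nn_integral_simplex_feynman, auto)
  qed (use simplex_ext_measurable[OF i] in measurable)
  also have "(\<Prod>j<Suc n. Gamma (?s j) * c j powr (- ?s j))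
      = Gamma l ^ Suc n * (\<Prod>j<Suc n. c j) powr (- l) * (l / c i)"
    by (rule prod_Gamma_powr_raise_one) (use l c i' in auto)
  also have "Gamma (\<Sum>j<Suc n. ?s j) = K * Gamma K"
    unfolding sum_s using K by (subst Gamma_plus1) auto
  also have "ennreal ?C * ennreal (Gamma l ^ Suc n * (\<Prod>j<Suc n. c j) powr (- l) * (l / c i) / (K * Gamma K))
      = ennreal ((\<Prod>j<Suc n. c j) powr (- l) * ((1 / c i) / real (Suc n)))"
    using l C less_imp_neq[OF Gamma_real_pos[OF l]] less_imp_neq[OF Gamma_real_pos[OF K]]
    by (simp add: ennreal_mult'[symmetric] K_def del: of_nat_Suc prod.lessThan_Suc)
  finally show ?thesis .
qed

lemma nn_integral_dirichlet_feynman: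
  assumes l: "l > 0" and c: "\<And>j. j \<le> n \<Longrightarrow> c j > 0"
  shows "(\<integral>\<^sup>+t. ennreal ((\<Sum>j<Suc n. c j * simplex_ext n t j) powr (- (real (Suc n) * l + 1))) \<partial>dirichlet n l)
    = ennreal ((\<Prod>j<Suc n. c j) powr (- l) * ((\<Sum>j<Suc n. 1 / c j) / real (Suc n)))"
proof -
  let ?h = "\<lambda>t. (\<Sum>j<Suc n. c j * simplex_ext n t j) powr (- (real (Suc n) * l + 1))"
  let ?term = "\<lambda>i. (\<Prod>j<Suc n. c j) powr (- l) * ((1 / c i) / real (Suc n))"
  have "(\<integral>\<^sup>+t. ennreal (?h t) \<partial>dirichlet n l)
      = (\<integral>\<^sup>+t. (\<Sum>i<Suc n. ennreal (simplex_ext n t i * ?h t)) \<partial>dirichlet n l)"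
  proof (rule nn_integral_cong_AE)
    show "AE t in dirichlet n l. ennreal (?h t) = (\<Sum>i<Suc n. ennreal (simplex_ext n t i * ?h t))"
      using AE_dirichlet
    proof eventually_elim
      case (elim t)
      have "(\<Sum>i<Suc n. ennreal (simplex_ext n t i * ?h t)) = ennreal (\<Sum>i<Suc n. simplex_ext n t i * ?h t)"
        using simplex_ext_pos[OF elim]
        by (intro sum_ennreal mult_nonneg_nonneg) (auto simp: less_Suc_eq_le less_imp_le)
      then show ?case by (simp only: sum_distrib_right[symmetric] sum_simplex_ext mult_1)
    qed
  qed
  also have "\<dots> = (\<Sum>i<Suc n. \<integral>\<^sup>+t. ennreal (simplex_ext n t i * ?h t) \<partial>dirichlet n l)"
  proof (rule nn_integral_sum)
    fix i assume "i \<in> {..<Suc n}"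
    then have "i \<le> n" by simp
    note [measurable] = simplex_ext_measurable[OF this]
    show "(\<lambda>t. ennreal (simplex_ext n t i * ?h t)) \<in> borel_measurable (dirichlet n l)" by measurable
  qed
  also have "\<dots> = (\<Sum>i<Suc n. ennreal (?term i))"
    by (intro sum.cong refl nn_integral_dirichlet_simplex_ext l c) auto
  also have "\<dots> = ennreal (\<Sum>i<Suc n. ?term i)"
    using c
    by (intro sum_ennreal mult_nonneg_nonneg divide_nonneg_nonneg) (auto simp: less_Suc_eq_le less_imp_le)
  finally show ?thesis by (simp only: sum_distrib_left sum_divide_distrib)
qed

lemma prob_space_dirichlet:
  assumes "l > 0"
  shows "prob_space (dirichlet n l)"
proof
  have "emeasure (dirichlet n l) (space (dirichlet n l))
      = (\<integral>\<^sup>+t. ennreal ((\<Sum>j<Suc n. 1 * simplex_ext n t j) powr (- (real (Suc n) * l + 1))) \<partial>dirichlet n l)"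
    by (simp only: mult_1 sum_simplex_ext powr_one_eq_one ennreal_1) simp
  also have "\<dots> = 1"
    using nn_integral_dirichlet_feynman[OF assms, of n "\<lambda>_. 1"] by (simp del: sum.lessThan_Suc)
  finally show "emeasure (dirichlet n l) (space (dirichlet n l)) = 1" .
qed

lemma LINT_dirichlet:
  fixes f :: "(nat \<Rightarrow> real) \<Rightarrow> real"
  assumes l: "l > 0" and f: "f \<in> borel_measurable (PiM {1..n} (\<lambda>_. lborel))"
  shows "(LINT t|dirichlet n l. f t) = Gamma (real (Suc n) * l) / Gamma l ^ Suc n
    * (LINT t:unit_simplex n|PiM {1..n} (\<lambda>_. lborel). f t * (\<Prod>j<Suc n. simplex_ext n t j powr (l - 1)))"
proof -
  have "(LINT t|dirichlet n l. f t) = (LINT t|PiM {1..n} (\<lambda>_. lborel). dirichlet_density n l t *\<^sub>R f t)"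
    unfolding dirichlet_def
    by (rule integral_density[OF f dirichlet_density_measurable]) (simp add: dirichlet_density_nonneg l)
  then show ?thesis
    unfolding set_lebesgue_integral_def dirichlet_density_def
    by (simp only: real_scaleR_def mult.assoc integral_mult_right_zero[symmetric]) (simp only: mult_ac)
qed

lemma LINT_dirichlet_feynman:
  assumes l: "l > 0" and c: "\<And>j. j \<le> n \<Longrightarrow> c j > 0"
  shows "(LINT t|dirichlet n l. (\<Sum>j<Suc n. c j * simplex_ext n t j) powr (- (real (Suc n) * l + 1)))
    = (\<Prod>j<Suc n. c j) powr (- l) * ((\<Sum>j<Suc n. 1 / c j) / real (Suc n))"
proof -
  have "(\<lambda>t. (\<Sum>j<Suc n. c j * simplex_ext n t j) powr (- (real (Suc n) * l + 1)))
      \<in> borel_measurable (dirichlet n l)"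
    by measurable
  moreover have "0 \<le> (\<Sum>j<Suc n. 1 / c j)"
    using c by (intro sum_nonneg) (simp add: less_Suc_eq_le less_imp_le)
  ultimately show ?thesis
    using nn_integral_dirichlet_feynman[OF assms]
    by (subst integral_eq_nn_integral) (auto simp del: sum.lessThan_Suc prod.lessThan_Suc)
qed

section \<open>Moments of the integral representation\<close>

lemma borel_measurable_arccos [measurable]: "arccos \<in> borel_measurable borel"
proof -
  have "(\<lambda>x. 0 \<le> x \<and> x \<le> pi \<and> cos x = y) = (\<lambda>x. False)" if "y \<notin> {-1..1}" for y
    using that by (auto simp: fun_eq_iff)
  then have "arccos y = (THE x. False)" if "y \<notin> {-1..1}" for y
    unfolding arccos_def using that by (intro arg_cong[where f = The])
  then have "arccos = (\<lambda>y. indicator {-1..1} y *\<^sub>R arccos y + indicator (- {-1..1}) y * (THE x. False))"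
    by (auto simp: fun_eq_iff indicator_def)
  moreover have "\<dots> \<in> borel_measurable borel"
    by (intro borel_measurable_add borel_measurable_times borel_measurable_indicator
        borel_measurable_continuous_on_indicator continuous_on_arccos') auto
  ultimately show ?thesis by simp
qed

lemma (in finite_measure) powser_LINT_sums:
  fixes c :: "nat \<Rightarrow> real" and L :: "'a \<Rightarrow> real"
  assumes [measurable]: "L \<in> borel_measurable M" "f \<in> borel_measurable borel"
    and bound: "AE w in M. \<bar>L w\<bar> \<le> 1" and c: "summable (\<lambda>n. \<bar>c n\<bar>)"
    and f: "\<And>l. \<bar>l\<bar> \<le> 1 \<Longrightarrow> (\<lambda>n. c n * l ^ n) sums f l"
  shows "(\<lambda>n. c n * (LINT w|M. L w ^ n)) sums (LINT w|M. f (L w))"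
proof -
  have term_le: "norm (c n * l ^ n) \<le> \<bar>c n\<bar>" if "\<bar>l\<bar> \<le> 1" for n l
    using that by (simp add: abs_mult power_abs mult_left_le power_le_one)
  have AE_term_le: "AE w in M. norm (c n * L w ^ n) \<le> \<bar>c n\<bar>" for n
    using bound by eventually_elim (rule term_le)
  have int: "integrable M (\<lambda>w. c n * L w ^ n)" for n
    by (rule integrable_const_bound[OF AE_term_le]) measurable
  have "(\<lambda>n. LINT w|M. c n * L w ^ n) sums (LINT w|M. (\<Sum>n. c n * L w ^ n))"
  proof (rule sums_integral[OF int])
    show "AE w in M. summable (\<lambda>n. norm (c n * L w ^ n))"
      using bound
    proof eventually_elim
      case (elim w)
      show ?case by (rule summable_comparison_test[OF _ c]) (use term_le[OF elim] in auto)
    qed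
    have "norm (LINT w|M. norm (c n * L w ^ n)) \<le> \<bar>c n\<bar> * measure M (space M)" for n
      using integral_mono_AE[OF integrable_norm[OF int] _ AE_term_le, of n] by (simp add: mult.commute)
    then show "summable (\<lambda>n. LINT w|M. norm (c n * L w ^ n))"
      by (intro summable_comparison_test[OF _ summable_mult2[OF c, of "measure M (space M)"]]) auto
  qed
  also have "(LINT w|M. (\<Sum>n. c n * L w ^ n)) = (LINT w|M. f (L w))"
  proof (rule integral_cong_AE)
    show "AE w in M. (\<Sum>n. c n * L w ^ n) = f (L w)"
      using bound by eventually_elim (rule sums_unique[OF f, symmetric])
  qed measurable
  finally show ?thesis by simp
qed

lemma powser_coeffs_eqI:
  fixes c d :: "nat \<Rightarrow> real"
  assumes R: "R > 0"
    and f: "\<And>x. \<bar>x\<bar> < R \<Longrightarrow> (\<lambda>n. c n * x ^ n) sums f x"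
    and g: "\<And>x. \<bar>x\<bar> < R \<Longrightarrow> (\<lambda>n. d n * x ^ n) sums g x"
    and agree: "\<And>e. e > 0 \<Longrightarrow> \<exists>x. 0 < x \<and> x \<le> e \<and> f x = g x"
  shows "c n = d n"
proof (rule ccontr)
  assume "c n \<noteq> d n"
  define h where "h m = (case m of 0 \<Rightarrow> 0 | Suc m \<Rightarrow> c m - d m)" for m
  have "h (Suc n) \<noteq> 0" using \<open>c n \<noteq> d n\<close> by (simp add: h_def)
  have "(\<lambda>m. h m * x ^ m) sums (x * (f x - g x))" if "\<bar>x\<bar> < R" for x
  proof (rule sums_Suc_imp)
    show "(\<lambda>m. h (Suc m) * x ^ Suc m) sums (x * (f x - g x))"
      using sums_mult[OF sums_diff[OF f[OF that] g[OF that]], of x]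
      by (simp add: h_def algebra_simps)
  qed (simp add: h_def)
  then obtain s where s: "s > 0" "\<And>z. z \<in> cball 0 s - {0} \<Longrightarrow> z * (f z - g z) \<noteq> 0"
    using powser_0_nonzero[of R 0 h "\<lambda>x. x * (f x - g x)" "Suc n"] R \<open>h (Suc n) \<noteq> 0\<close> by auto
  obtain x where "0 < x" "x \<le> s" "f x = g x" using agree[OF s(1)] by blast
  with s(2)[of x] show False by auto
qed

context dihedral
begin

definition phase :: "real \<Rightarrow> (nat \<Rightarrow> real) \<Rightarrow> real" where
  "phase q s = (\<Sum>j<k. cos ((q - 2 * real j * pi) / real k) * simplex_ext (k - 1) s j)"

lemma phase_measurable [measurable (raw)]:
  assumes [measurable]: "f \<in> borel_measurable M" "g \<in> M \<rightarrow>\<^sub>M PiM {1..k - 1} (\<lambda>_. lborel)"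
  shows "(\<lambda>w. phase (f w) (g w)) \<in> borel_measurable M"
  unfolding phase_def
proof (intro borel_measurable_sum borel_measurable_times)
  fix j assume "j \<in> {..<k}"
  then have "j \<le> k - 1" by auto
  then show "(\<lambda>w. simplex_ext (k - 1) (g w) j) \<in> borel_measurable M"
    by (intro measurable_compose[OF assms(2) simplex_ext_measurable])
qed measurable

lemma abs_phase_le_1:
  assumes "s \<in> unit_simplex (k - 1)"
  shows "\<bar>phase q s\<bar> \<le> 1"
proof -
  have "0 \<le> simplex_ext (k - 1) s j" if "j < k" for j
    using simplex_ext_pos[OF assms, of j] that by (simp add: less_imp_le)
  then have "\<bar>phase q s\<bar> \<le> (\<Sum>j<k. simplex_ext (k - 1) s j)"
    unfolding phase_def
    by (intro order.trans[OF sum_abs] sum_mono) (auto simp: abs_mult mult_left_le_one_le)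
  also have "\<dots> = 1" using sum_simplex_ext[of "k - 1" s] by simp
  finally show ?thesis .
qed

text \<open>The sum and the product over the $k$ angles are both given by the Poisson denominator at the
  $k$-th power, so the Feynman formula collapses to a single power.\<close>

lemma LINT_dirichlet_phase:
  assumes t: "\<bar>t\<bar> < 1"
  shows "(LINT s|dirichlet (k - 1) lam. (1 - poisson_scale t * phase q s) powr (- gen_order))
    = closed_factor t / real k * poisson_denom (t ^ k) (cos q) powr (- lam - 1)"
proof -
  define u where "u = cis (- q / real k)"
  define c where "c j = 1 - poisson_scale t * Re (u * cis (2 * pi * real j / real k))" for j
  define P where "P = poisson_denom (t ^ k) (cos q)"
  have u: "cmod u = 1" by (simp add: u_def)
  have u_power: "Re (u ^ k) = cos q" by (simp add: u_def Complex.DeMoivre)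
  have Suc: "Suc (k - 1) = k" by simp
  have P: "P > 0"
    unfolding P_def using abs_power_k_less_1[OF t] by (intro poisson_denom_pos) simp
  have c_pos: "c j > 0" for j
    unfolding c_def using u t by (intro one_minus_poisson_scale_pos abs_Re_le_1) (auto simp: norm_mult)
  have "Re (u * cis (2 * pi * real j / real k)) = cos ((q - 2 * real j * pi) / real k)" for j
  proof -
    have "- q / real k + 2 * pi * real j / real k = - ((q - 2 * real j * pi) / real k)"
      by (simp add: field_simps)
    then show ?thesis by (simp only: u_def cis_mult cis.sel cos_minus)
  qed
  then have "(\<Sum>j<k. c j * simplex_ext (k - 1) s j)
      = (\<Sum>j<k. simplex_ext (k - 1) s j) - poisson_scale t * phase q s" for s
    by (simp add: c_def phase_def left_diff_distrib sum_subtractf sum_distrib_left mult.assoc)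
  then have "1 - poisson_scale t * phase q s = (\<Sum>j<k. c j * simplex_ext (k - 1) s j)" for s
    using sum_simplex_ext[of "k - 1" s] unfolding Suc by simp
  then have "(LINT s|dirichlet (k - 1) lam. (1 - poisson_scale t * phase q s) powr (- gen_order))
      = (\<Prod>j<k. c j) powr (- lam) * ((\<Sum>j<k. 1 / c j) / real k)"
    using LINT_dirichlet_feynman[OF lam_pos c_pos, of "k - 1"] unfolding Suc by simp
  also have "(\<Prod>j<k. c j) powr (- lam) = (1 + t\<^sup>2) powr (real k * lam) * P powr (- lam)"
  proof -
    have "(P / (1 + t\<^sup>2) ^ k) powr (- l) = (1 + t\<^sup>2) powr (real k * l) * P powr (- l)" for l
      using P one_plus_square_pos[of t]
      by (simp add: powr_divide powr_minus powr_realpow[symmetric] powr_powr field_simps)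
    then show ?thesis
      unfolding c_def prod_one_minus_poisson_scale[OF k_pos(1) u] u_power P_def[symmetric] .
  qed
  also have "(\<Sum>j<k. 1 / c j) / real k = (1 + t\<^sup>2) * (1 - (t ^ k)\<^sup>2) / ((1 - t\<^sup>2) * P)"
    unfolding c_def sum_inverse_one_minus_poisson_scale[OF k_pos(1) u t] u_power P_def[symmetric] by simp
  also have "(1 + t\<^sup>2) powr (real k * lam) * P powr (- lam) * ((1 + t\<^sup>2) * (1 - (t ^ k)\<^sup>2) / ((1 - t\<^sup>2) * P))
      = closed_factor t / real k * P powr (- lam - 1)"
    using P by (simp add: closed_factor_def powr_diff mult_ac)
  finally show ?thesis unfolding P_def .
qed

sublocale DIR: prob_space "dirichlet (k - 1) lam" by (rule prob_space_dirichlet[OF lam_pos])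
sublocale REP: pair_prob_space "nu_pair a b" "dirichlet (k - 1) lam" ..

abbreviation rep_measure :: "((real \<times> real) \<times> (nat \<Rightarrow> real)) measure" where
  "rep_measure \<equiv> nu_pair a b \<Otimes>\<^sub>M dirichlet (k - 1) lam"

definition xi_angle :: "complex \<Rightarrow> complex \<Rightarrow> real \<times> real \<Rightarrow> real" where
  "xi_angle x y q = arccos (xi_inner (x ^ k) (y ^ k) q)"

lemma xi_angle_measurable [measurable]: "xi_angle x y \<in> borel_measurable (borel \<Otimes>\<^sub>M borel)"
  unfolding xi_angle_def[abs_def] by measurable

definition rep_phase :: "complex \<Rightarrow> complex \<Rightarrow> (real \<times> real) \<times> (nat \<Rightarrow> real) \<Rightarrow> real" where
  "rep_phase x y X = phase (xi_angle x y (fst X)) (snd X)"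

lemma rep_phase_measurable [measurable]: "rep_phase x y \<in> borel_measurable rep_measure"
proof -
  have "(\<lambda>X. xi_angle x y (fst X)) \<in> borel_measurable rep_measure"
    by (rule measurable_compose[OF measurable_fst]) simp
  moreover have "snd \<in> rep_measure \<rightarrow>\<^sub>M PiM {1..k - 1} (\<lambda>_. lborel)"
    using measurable_snd[of "nu_pair a b" "dirichlet (k - 1) lam"] by (simp cong: measurable_cong_sets)
  ultimately show ?thesis unfolding rep_phase_def[abs_def] by (rule phase_measurable)
qed

lemma AE_abs_rep_phase_le_1: "AE X in rep_measure. \<bar>rep_phase x y X\<bar> \<le> 1"
proof (rule REP.AE_pair_measure)
  show "AE q in nu_pair a b. AE s in dirichlet (k - 1) lam. \<bar>rep_phase x y (q, s)\<bar> \<le> 1"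
    using AE_dirichlet[of "k - 1" lam]
    by (auto simp: rep_phase_def elim!: eventually_mono intro!: abs_phase_le_1)
qed measurable

lemma LINT_rep_phase:
  assumes [measurable]: "f \<in> borel_measurable borel" and bound: "\<And>l. \<bar>l\<bar> \<le> 1 \<Longrightarrow> \<bar>f l\<bar> \<le> C"
  shows "(LINT X|rep_measure. f (rep_phase x y X) :: real)
    = (LINT q|nu_pair a b. LINT s|dirichlet (k - 1) lam. f (phase (xi_angle x y q) s))"
proof -
  have "integrable rep_measure (\<lambda>X. f (rep_phase x y X))"
  proof (rule REP.integrable_const_bound)
    show "AE X in rep_measure. norm (f (rep_phase x y X)) \<le> C"
      using AE_abs_rep_phase_le_1[of x y] by eventually_elim (use bound in simp)
  qed measurable
  from REP.integral_fst'[OF this] show ?thesis by (simp add: rep_phase_def)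
qed

lemma LINT_rep_phase_powr:
  assumes x: "cmod x = 1" and y: "cmod y = 1" and t: "\<bar>t\<bar> < 1"
  shows "(LINT X|rep_measure. (1 - poisson_scale t * rep_phase x y X) powr (- gen_order))
    = closed_factor t / real k * gegenbauer_int (\<lambda>_. 1) (x ^ k) (y ^ k) (t ^ k)"
proof -
  let ?r = "poisson_scale t"
  have bound: "\<bar>(1 - ?r * l) powr (- gen_order)\<bar> \<le> (1 - \<bar>?r\<bar>) powr (- gen_order)" if "\<bar>l\<bar> \<le> 1" for l
  proof -
    have "?r * l \<le> \<bar>?r\<bar> * \<bar>l\<bar>" by (simp add: abs_mult[symmetric])
    also have "\<dots> \<le> \<bar>?r\<bar>" using that by (simp add: mult_left_le)
    finally have "(1 - ?r * l) powr (- gen_order) \<le> (1 - \<bar>?r\<bar>) powr (- gen_order)"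
      using gen_order_ge_1 abs_poisson_scale_less_1[OF t] by (intro powr_mono2') auto
    then show ?thesis by simp
  qed
  have "(LINT X|rep_measure. (1 - ?r * rep_phase x y X) powr (- gen_order))
      = (LINT q|nu_pair a b. LINT s|dirichlet (k - 1) lam.
          (1 - ?r * phase (xi_angle x y q) s) powr (- gen_order))"
    by (rule LINT_rep_phase[OF _ bound]) measurable
  also have "\<dots> = closed_factor t / real k *
      (LINT q|nu_pair a b. poisson_denom (t ^ k) (cos (xi_angle x y q)) powr (- lam - 1))"
    unfolding LINT_dirichlet_phase[OF t] by simp
  also have "(LINT q|nu_pair a b. poisson_denom (t ^ k) (cos (xi_angle x y q)) powr (- lam - 1))
      = (LINT q|nu_pair a b. 1 * xi_denom (x ^ k) (y ^ k) (t ^ k) q powr (- lam - 1))"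
  proof (rule LINT_nu_pair_cong)
    fix q assume "q \<in> square"
    then have "\<bar>xi_inner (x ^ k) (y ^ k) q\<bar> \<le> 1"
      using norm_power_k[OF x] norm_power_k[OF y] by (rule abs_xi_inner_le_1)
    then show "poisson_denom (t ^ k) (cos (xi_angle x y q)) powr (- lam - 1)
        = 1 * xi_denom (x ^ k) (y ^ k) (t ^ k) q powr (- lam - 1)"
      by (simp add: xi_angle_def cos_arccos_abs xi_denom_def)
  qed (unfold poisson_denom_def, measurable)
  finally show ?thesis by (simp add: gegenbauer_int_def)
qed

definition phase_moment :: "complex \<Rightarrow> complex \<Rightarrow> nat \<Rightarrow> real" where
  "phase_moment x y n = (LINT X|rep_measure. rep_phase x y X ^ n)"

lemma phase_moment_binomial_sums:
  assumes r: "\<bar>r\<bar> < 1"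
  shows "(\<lambda>n. pochhammer gen_order n * (phase_moment x y n / fact n) * r ^ n)
    sums (LINT X|rep_measure. (1 - r * rep_phase x y X) powr (- gen_order))"
proof -
  have "summable (\<lambda>n. pochhammer gen_order n / fact n * \<bar>r\<bar> ^ n)"
    using pochhammer_binomial_sums[of "\<bar>r\<bar>" gen_order] r by (auto simp: sums_iff)
  then have "summable (\<lambda>n. \<bar>pochhammer gen_order n / fact n * r ^ n\<bar>)"
    using gen_order_ge_1 by (simp add: abs_mult power_abs pochhammer_nonneg)
  moreover have "(\<lambda>n. pochhammer gen_order n / fact n * r ^ n * l ^ n) sums (1 - r * l) powr (- gen_order)"
    if "\<bar>l\<bar> \<le> 1" for l
  proof -
    have "\<bar>r * l\<bar> \<le> \<bar>r\<bar>" using that by (simp add: abs_mult mult_left_le)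
    then show ?thesis
      using pochhammer_binomial_sums[of "r * l" gen_order] r by (simp add: power_mult_distrib mult.assoc)
  qed
  ultimately have "(\<lambda>n. pochhammer gen_order n / fact n * r ^ n * (LINT X|rep_measure. rep_phase x y X ^ n))
      sums (LINT X|rep_measure. (1 - r * rep_phase x y X) powr (- gen_order))"
    using AE_abs_rep_phase_le_1[of x y] by (intro REP.powser_LINT_sums) measurable
  then show ?thesis by (simp add: phase_moment_def mult_ac)
qed

lemma phase_moment_exp_sums:
  "(\<lambda>n. phase_moment x y n / fact n * r ^ n) sums (LINT X|rep_measure. exp (r * rep_phase x y X))"
proof -
  have "summable (\<lambda>n. \<bar>r ^ n / fact n\<bar>)"
    using summable_exp[of "\<bar>r\<bar>"] by (simp add: abs_mult power_abs divide_inverse mult.commute)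
  moreover have "(\<lambda>n. r ^ n / fact n * l ^ n) sums exp (r * l)" for l
    using exp_converges[of "r * l"] by (simp add: power_mult_distrib divide_inverse mult_ac)
  ultimately have "(\<lambda>n. r ^ n / fact n * (LINT X|rep_measure. rep_phase x y X ^ n))
      sums (LINT X|rep_measure. exp (r * rep_phase x y X))"
    using AE_abs_rep_phase_le_1[of x y] by (intro REP.powser_LINT_sums) measurable
  then show ?thesis by (simp add: phase_moment_def mult_ac)
qed

section \<open>The generalized Bessel function\<close>

definition bessel_comp :: "complex \<Rightarrow> complex \<Rightarrow> nat \<Rightarrow> real" where
  "bessel_comp x y n = orbit_sum (\<lambda>p. dunkl_comp p n x) y / (4 * real k)"

lemma gen_bessel_eq_orbit_sum:
  "gen_bessel k a b x y = orbit_sum (\<lambda>p. dunkl_series p x) y / (4 * real k)"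
  by (simp add: gen_bessel_def orbit_sum_def dih_rot_eq dih_refl_eq dunkl_kernel_eq_dunkl_series)

lemma bessel_comp_scaleR: "bessel_comp (s *\<^sub>R x) (t *\<^sub>R y) n = bessel_comp x y n * (s * t) ^ n"
proof -
  have "orbit_sum (\<lambda>p. dunkl_comp p n (s *\<^sub>R x)) (t *\<^sub>R y) = (s * t) ^ n * orbit_sum (\<lambda>p. dunkl_comp p n x) y"
    by (simp add: orbit_sum_def rot_scaleR rfl_scaleR dunkl_comp_scaleR dunkl_comp_scaleR_left
        sum_distrib_left power_mult_distrib algebra_simps)
  then show ?thesis by (simp add: bessel_comp_def)
qed

lemma bessel_comp_sums: "(\<lambda>n. bessel_comp x y n * (s * t) ^ n) sums gen_bessel k a b (s *\<^sub>R x) (t *\<^sub>R y)"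
proof -
  have "(\<lambda>n. bessel_comp (s *\<^sub>R x) (t *\<^sub>R y) n) sums gen_bessel k a b (s *\<^sub>R x) (t *\<^sub>R y)"
    unfolding bessel_comp_def gen_bessel_eq_orbit_sum
    by (intro sums_divide orbit_sum_sums dunkl_series_sums)
  then show ?thesis by (simp only: bessel_comp_scaleR)
qed

lemma bessel_comp_binomial_sums:
  assumes x: "cmod x = 1" and y: "cmod y = 1" and r: "\<bar>r\<bar> < 1/5"
  shows "(\<lambda>n. pochhammer gen_order n * bessel_comp x y n * r ^ n)
    sums (orbit_sum (\<lambda>p. gen_series p r x) y / (4 * real k))"
proof -
  have "(\<lambda>n. orbit_sum (\<lambda>p. gen_coeff p n x * r ^ n) y / (4 * real k))
      sums (orbit_sum (\<lambda>p. gen_series p r x) y / (4 * real k))"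
    using x y r by (intro sums_divide orbit_sum_sums gen_series_sums) (auto simp: norm_orbit)
  moreover have "orbit_sum (\<lambda>p. gen_coeff p n x * r ^ n) y
      = (pochhammer gen_order n * r ^ n) * orbit_sum (\<lambda>p. dunkl_comp p n x) y" for n
    unfolding orbit_sum_cmult[symmetric] gen_coeff_def by (simp only: mult_ac)
  ultimately show ?thesis by (simp add: bessel_comp_def mult_ac)
qed

lemma orbit_sum_gen_series:
  assumes x: "cmod x = 1" and y: "cmod y = 1" and t: "0 \<le> t" "t < 1/10"
  shows "orbit_sum (\<lambda>p. gen_series p (poisson_scale t) x) y / (4 * real k)
    = (LINT X|rep_measure. (1 - poisson_scale t * rep_phase y x X) powr (- gen_order))"
proof -
  have t1: "\<bar>t\<bar> < 1" using t by simp
  have "orbit_sum (\<lambda>p. gen_series p (poisson_scale t) x) y = orbit_sum (closed_form x t) y"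
    using x y t
    by (intro orbit_sum_cong) (simp add: gen_series_eq_closed_form closed_form_commute[of x] norm_orbit)
  then show ?thesis
    using orbit_sum_closed_form[OF y x t1] LINT_rep_phase_powr[OF y x t1] by simp
qed

lemma bessel_comp_eq_phase_moment:
  assumes x: "cmod x = 1" and y: "cmod y = 1"
  shows "bessel_comp x y n = phase_moment y x n / fact n"
proof -
  have "pochhammer gen_order n * bessel_comp x y n = pochhammer gen_order n * (phase_moment y x n / fact n)"
  proof (rule powser_coeffs_eqI[where R = "1/5"])
    show "(\<lambda>n. pochhammer gen_order n * bessel_comp x y n * r ^ n)
        sums (orbit_sum (\<lambda>p. gen_series p r x) y / (4 * real k))" if "\<bar>r\<bar> < 1/5" for r
      using that by (rule bessel_comp_binomial_sums[OF x y])
    show "(\<lambda>n. pochhammer gen_order n * (phase_moment y x n / fact n) * r ^ n)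
        sums (LINT X|rep_measure. (1 - r * rep_phase y x X) powr (- gen_order))" if "\<bar>r\<bar> < 1/5" for r
      using that by (intro phase_moment_binomial_sums) simp
    fix e :: real assume "e > 0"
    define t where "t = min (1/20) (e / 2)"
    have t: "0 < t" "t < 1/10" "2 * t \<le> e" using \<open>e > 0\<close> by (auto simp: t_def min_def)
    have "0 < poisson_scale t" using t one_plus_square_pos[of t] by (simp add: poisson_scale_def)
    moreover have "poisson_scale t \<le> e" using abs_poisson_scale_le[of t] t by simp
    moreover have "orbit_sum (\<lambda>p. gen_series p (poisson_scale t) x) y / (4 * real k)
        = (LINT X|rep_measure. (1 - poisson_scale t * rep_phase y x X) powr (- gen_order))"
      using t by (intro orbit_sum_gen_series x y) auto
    ultimately show "\<exists>r. 0 < r \<and> r \<le> e \<and> orbit_sum (\<lambda>p. gen_series p r x) y / (4 * real k)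
        = (LINT X|rep_measure. (1 - r * rep_phase y x X) powr (- gen_order))" by blast
  qed simp
  moreover have "pochhammer gen_order n > 0" using gen_order_ge_1 by (intro pochhammer_pos) simp
  ultimately show ?thesis by (simp only: mult_cancel_left) simp
qed

lemma gen_bessel_eq_LINT_exp:
  assumes "cmod x = 1" "cmod y = 1"
  shows "gen_bessel k a b (s *\<^sub>R x) (t *\<^sub>R y) = (LINT X|rep_measure. exp (s * t * rep_phase y x X))"
  using bessel_comp_sums[of x y s t] phase_moment_exp_sums[of y x "s * t"]
  unfolding bessel_comp_eq_phase_moment[OF assms] by (rule sums_unique2)

definition exp_mean :: "real \<Rightarrow> real \<Rightarrow> real" where
  "exp_mean r q = (LINT s|dirichlet (k - 1) lam. exp (r * phase q s))"

lemma integrable_exp_phase: "integrable (dirichlet (k - 1) lam) (\<lambda>s. exp (r * phase q s))"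
  and abs_exp_mean_le: "\<bar>exp_mean r q\<bar> \<le> exp \<bar>r\<bar>"
proof -
  have bound: "AE s in dirichlet (k - 1) lam. norm (exp (r * phase q s)) \<le> exp \<bar>r\<bar>"
    using AE_dirichlet
  proof eventually_elim
    case (elim s)
    have "r * phase q s \<le> \<bar>r\<bar> * \<bar>phase q s\<bar>" by (simp add: abs_mult[symmetric])
    also have "\<dots> \<le> \<bar>r\<bar>" using abs_phase_le_1[OF elim, of q] by (simp add: mult_left_le)
    finally show ?case by simp
  qed
  then show int: "integrable (dirichlet (k - 1) lam) (\<lambda>s. exp (r * phase q s))"
    by (rule DIR.integrable_const_bound) measurable
  have "norm (exp_mean r q) \<le> (LINT s|dirichlet (k - 1) lam. norm (exp (r * phase q s)))"
    unfolding exp_mean_def by (rule integral_norm_bound)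
  also have "\<dots> \<le> (LINT s|dirichlet (k - 1) lam. exp \<bar>r\<bar>)"
    by (intro integral_mono_AE integrable_norm int DIR.integrable_const bound)
  also have "\<dots> = exp \<bar>r\<bar>" using DIR.prob_space by (simp del: One_nat_def)
  finally show "\<bar>exp_mean r q\<bar> \<le> exp \<bar>r\<bar>" by simp
qed

lemma exp_mean_measurable [measurable]: "exp_mean r \<in> borel_measurable borel"
  unfolding exp_mean_def[abs_def]
proof (rule DIR.borel_measurable_lebesgue_integral)
  have "snd \<in> borel \<Otimes>\<^sub>M dirichlet (k - 1) lam \<rightarrow>\<^sub>M PiM {1..k - 1} (\<lambda>_. lborel)"
    using measurable_snd[of borel "dirichlet (k - 1) lam"] by (simp cong: measurable_cong_sets)
  then show "(\<lambda>(q, s). exp (r * phase q s)) \<in> borel_measurable (borel \<Otimes>\<^sub>M dirichlet (k - 1) lam)"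
    unfolding case_prod_beta' by measurable
qed

lemma exp_mean_add:
  "exp_mean r q + exp_mean r q' = Gamma (real k * lam) / Gamma lam ^ k *
    (LINT s:unit_simplex (k - 1)|PiM {1..k - 1} (\<lambda>_. lborel).
      (exp (r * phase q s) + exp (r * phase q' s)) * (\<Prod>j<k. simplex_ext (k - 1) s j powr (lam - 1)))"
proof -
  have "exp_mean r q + exp_mean r q'
      = (LINT s|dirichlet (k - 1) lam. exp (r * phase q s) + exp (r * phase q' s))"
    unfolding exp_mean_def
    by (rule Bochner_Integration.integral_add[OF integrable_exp_phase integrable_exp_phase, symmetric])
  also have "\<dots> = Gamma (real (Suc (k - 1)) * lam) / Gamma lam ^ Suc (k - 1) *
    (LINT s:unit_simplex (k - 1)|PiM {1..k - 1} (\<lambda>_. lborel).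
      (exp (r * phase q s) + exp (r * phase q' s)) * (\<Prod>j<Suc (k - 1). simplex_ext (k - 1) s j powr (lam - 1)))"
    by (rule LINT_dirichlet[OF lam_pos]) measurable
  finally show ?thesis by simp
qed

lemma LINT_rep_phase_exp_symmetric:
  assumes x: "cmod x = 1" and y: "cmod y = 1"
  shows "(LINT X|rep_measure. exp (r * rep_phase x y X))
    = (LINT q|nu_pair a b. (exp_mean r (xi_angle x y q) + exp_mean r (pi - xi_angle x y q)) / 2)"
proof -
  have int: "integrable (nu_pair a b) (\<lambda>q. exp_mean r (f q))"
    if [measurable]: "f \<in> borel_measurable (borel \<Otimes>\<^sub>M borel)" for f
    by (rule NP.integrable_const_bound[of _ "exp \<bar>r\<bar>"]) (auto simp: abs_exp_mean_le)
  have "(LINT q|nu_pair a b. exp_mean r (pi - xi_angle x y q))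
      = (LINT q|nu_pair a b. exp_mean r (xi_angle x y (- 1 * fst q, - 1 * snd q)))"
  proof (rule LINT_nu_pair_cong)
    fix q assume "q \<in> square"
    then have "\<bar>xi_inner (x ^ k) (y ^ k) q\<bar> \<le> 1"
      using norm_power_k[OF x] norm_power_k[OF y] by (rule abs_xi_inner_le_1)
    moreover have "xi_inner (x ^ k) (y ^ k) (- 1 * fst q, - 1 * snd q) = - xi_inner (x ^ k) (y ^ k) q"
      by (simp add: xi_inner_def)
    ultimately show "exp_mean r (pi - xi_angle x y q) = exp_mean r (xi_angle x y (- 1 * fst q, - 1 * snd q))"
      by (simp add: xi_angle_def arccos_minus abs_le_iff)
  qed measurable
  also have "\<dots> = (LINT q|nu_pair a b. exp_mean r (xi_angle x y q))"
    by (rule LINT_nu_pair_sign) auto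
  also have "\<dots> = (LINT X|rep_measure. exp (r * rep_phase x y X))"
    unfolding exp_mean_def
  proof (rule LINT_rep_phase[symmetric, where C = "exp \<bar>r\<bar>"])
    show "\<bar>exp (r * l)\<bar> \<le> exp \<bar>r\<bar>" if "\<bar>l\<bar> \<le> 1" for l
      using mult_left_le[OF that, of "\<bar>r\<bar>"] abs_ge_self[of "r * l"] by (simp add: abs_mult)
  qed measurable
  finally show ?thesis
    using int[of "xi_angle x y"] int[of "\<lambda>q. pi - xi_angle x y q"]
      \<open>(LINT q|nu_pair a b. exp_mean r (xi_angle x y q)) = _\<close> by simp
qed

lemma LINT_rep_phase_exp:
  assumes x: "cmod x = 1" and y: "cmod y = 1"
  shows "(LINT X|rep_measure. exp (r * rep_phase x y X)) = Gamma (real k * lam) / (2 * Gamma lam ^ k) *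
    (LINT u:{-1..1}|lborel. LINT v:{-1..1}|lborel. nu_density a u * nu_density b v *
      (LINT s:unit_simplex (k - 1)|PiM {1..k - 1} (\<lambda>_. lborel).
        (exp (r * phase (xi_angle x y (u, v)) s) + exp (r * phase (pi - xi_angle x y (u, v)) s))
          * (\<Prod>j<k. simplex_ext (k - 1) s j powr (lam - 1))))"
proof -
  define h where "h q = (exp_mean r (xi_angle x y q) + exp_mean r (pi - xi_angle x y q)) / 2" for q
  have "\<bar>h q\<bar> \<le> exp \<bar>r\<bar>" for q
    using abs_exp_mean_le[of r "xi_angle x y q"] abs_exp_mean_le[of r "pi - xi_angle x y q"]
    by (simp add: h_def abs_le_iff)
  then have int: "integrable (nu_pair a b) h"
    by (intro NP.integrable_const_bound[of _ "exp \<bar>r\<bar>"]) (auto simp: h_def[abs_def])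
  have "(LINT X|rep_measure. exp (r * rep_phase x y X)) = (LINT q|nu_pair a b. h q)"
    unfolding h_def by (rule LINT_rep_phase_exp_symmetric[OF assms])
  also have "\<dots> = (LINT u:{-1..1}|lborel. LINT v:{-1..1}|lborel. nu_density a u * nu_density b v * h (u, v))"
    by (rule LINT_nu_pair[OF _ int]) (simp add: h_def[abs_def])
  finally show ?thesis
    unfolding h_def exp_mean_add
    by (simp add: mult_ac flip: set_integral_mult_right set_integral_mult_left)
qed

lemma q_uv_eq_xi_angle: "q_uv u v (real k * s) (real k * t) = xi_angle (cis s) (cis t) (u, v)"
  by (simp add: q_uv_def xi_uv_def xi_angle_def xi_inner_def Complex.DeMoivre mult.assoc)

lemma xi_angle_commute: "xi_angle x y = xi_angle y x"
  by (simp add: xi_angle_def xi_inner_def fun_eq_iff mult.commute)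

end

theorem mainTheorem7:
  fixes k :: nat and a b :: real and z w :: complex
  assumes "k \<ge> 2" and "a > 0" and "b > 0"
  shows "gen_bessel k a b z w =
    Gamma (real k * (a + b)) / (2 * Gamma (a + b) ^ k) *
    (LINT u:{-1..1}|lborel. LINT v:{-1..1}|lborel.
       nu_density a u * nu_density b v *
       (LINT t:unit_simplex (k - 1)|PiM {1..k - 1} (\<lambda>_. lborel).
          (let q = q_uv u v (real k * Arg z) (real k * Arg w);
               ap = (\<lambda>j. cmod z * cmod w * cos ((q - 2 * real j * pi) / real k));
               am = (\<lambda>j. cmod z * cmod w * cos ((pi - q - 2 * real j * pi) / real k));
               s = simplex_ext (k - 1) t
           in (exp (\<Sum>j<k. ap j * s j) + exp (\<Sum>j<k. am j * s j))
              * (\<Prod>j<k. s j powr (a + b - 1)))))"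
proof -
  interpret dihedral k a b by unfold_locales (use assms in auto)
  have polar: "cmod p *\<^sub>R cis (Arg p) = p" for p
    using rcis_cmod_Arg[of p] by (simp add: rcis_def scaleR_conv_of_real)
  have "gen_bessel k a b z w
      = (LINT X|rep_measure. exp (cmod z * cmod w * rep_phase (cis (Arg w)) (cis (Arg z)) X))"
    using gen_bessel_eq_LINT_exp[of "cis (Arg z)" "cis (Arg w)" "cmod z" "cmod w"] by (simp add: polar)
  moreover have "(\<Sum>j<k. cmod z * cmod w * cos ((q - 2 * real j * pi) / real k) * simplex_ext (k - 1) t j)
      = cmod z * cmod w * phase q t" for q t
    by (simp add: phase_def sum_distrib_left mult.assoc)
  ultimately show ?thesis
    by (simp only: LINT_rep_phase_exp norm_cis xi_angle_commute[of "cis (Arg w)" "cis (Arg z)"]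
        q_uv_eq_xi_angle Let_def)
qed

end
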